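(* Let $X$ be the mapping cone of a map $\alpha:S^1\to S^1$, whose degree is denoted by $d_\alpha$. Then $$\mathrm{TC}(X)=\begin{cases}2 & \text{if } d_\alpha=0,\\ 0 & \text{if } d_\alpha=\pm1,\\ 3 & \text{if } d_\alpha=\pm2,\\ 4 & \text{otherwise.}\end{cases}$$
   Context: $\mathrm{TC}(X)$ is the least integer $n\ge0$ such that $X\times X$ admits a cover by $n+1$ open sets on each of which the evaluation fibration $\pi_X:X^I\to X\times X$, $\gamma\mapsto(\gamma(0),\gamma(1))$, has a continuous local section (so a contractible space has $\mathrm{TC}=0$). *)

theory Defs
  imports "HOL-Homology.Homology" "HOL-Library.Extended_Nat"
begin

subsection \<open>The path space and topological complexity\<close>

text \<open>Points are continuous maps, made unique outside \<^term>\<open>topspace X\<close> by extensionality; the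
  sets of maps sending a compact \<open>K\<close> into an open \<open>V\<close> form a subbasis.  The choice \<open>K = {}\<close>
  gives the whole space of maps.\<close>

definition compact_open_topology :: "'a topology \<Rightarrow> 'b topology \<Rightarrow> ('a \<Rightarrow> 'b) topology" where
  "compact_open_topology X Y =
     topology_generated_by
       {{f \<in> extensional (topspace X). continuous_map X Y f \<and> f ` K \<subseteq> V} | K V.
          compactin X K \<and> openin Y V}"

lemma topspace_compact_open_topology:
  "topspace (compact_open_topology X Y) =
     {f \<in> extensional (topspace X). continuous_map X Y f}" (is "_ = ?C")
proof -
  have "?C = {f \<in> extensional (topspace X). continuous_map X Y f \<and> f ` {} \<subseteq> {}}"
    by auto
  then have "?C \<in> {{f \<in> extensional (topspace X). continuous_map X Y f \<and> f ` K \<subseteq> V} | K V.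
          compactin X K \<and> openin Y V}"
    using compactin_empty openin_empty by blast
  then show ?thesis
    unfolding compact_open_topology_def topology_generated_by_topspace
    by blast
qed

definition path_space :: "'a topology \<Rightarrow> (real \<Rightarrow> 'a) topology" where
  "path_space X = compact_open_topology (top_of_set {0..1}) X"

lemma topspace_path_space:
  "topspace (path_space X) = {\<gamma> \<in> extensional {0..1}. pathin X \<gamma>}"
  by (simp add: path_space_def topspace_compact_open_topology pathin_def)

definition path_eval :: "(real \<Rightarrow> 'a) \<Rightarrow> 'a \<times> 'a" where
  "path_eval \<gamma> = (\<gamma> 0, \<gamma> 1)"

definition has_path_section :: "'a topology \<Rightarrow> ('a \<times> 'a) set \<Rightarrow> bool" where
  "has_path_section X U \<longleftrightarrow>
     (\<exists>s. continuous_map (subtopology (prod_topology X X) U) (path_space X) s \<and>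
          (\<forall>p\<in>U. path_eval (s p) = p))"

text \<open>The value is \<open>\<infinity>\<close> if there is no finite cover of the required kind.\<close>

definition TC :: "'a topology \<Rightarrow> enat" where
  "TC X = Inf {enat n | n. \<exists>U :: nat \<Rightarrow> ('a \<times> 'a) set.
     (\<forall>i\<le>n. openin (prod_topology X X) (U i) \<and> has_path_section X (U i)) \<and>
     (\<Union>i\<le>n. U i) = topspace (prod_topology X X)}"

subsection \<open>Quotients, disjoint unions and mapping cones\<close>

definition quotient_topology :: "'a topology \<Rightarrow> ('a \<times> 'a) set \<Rightarrow> 'a set topology" where
  "quotient_topology X r = topology (\<lambda>U. U \<subseteq> topspace X // r \<and> openin X (\<Union>U))"

lemma openin_quotient_topology:
  assumes "equiv (topspace X) r"
  shows "openin (quotient_topology X r) U \<longleftrightarrow> U \<subseteq> topspace X // r \<and> openin X (\<Union>U)"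
proof -
  have "istopology (\<lambda>U. U \<subseteq> topspace X // r \<and> openin X (\<Union>U))"
    unfolding istopology_def
  proof (intro conjI allI impI)
    fix S T
    assume S: "S \<subseteq> topspace X // r \<and> openin X (\<Union>S)"
      and T: "T \<subseteq> topspace X // r \<and> openin X (\<Union>T)"
    show "S \<inter> T \<subseteq> topspace X // r"
      using S by blast
    have "\<Union>(S \<inter> T) = \<Union>S \<inter> \<Union>T"
      using S T quotient_disj[OF assms] by blast
    then show "openin X (\<Union>(S \<inter> T))"
      using S T by (simp add: openin_Int)
  next
    fix \<K>
    assume K: "\<forall>K\<in>\<K>. K \<subseteq> topspace X // r \<and> openin X (\<Union>K)"
    show "\<Union>\<K> \<subseteq> topspace X // r"
      using K by blast
    have "\<Union>(\<Union>\<K>) = \<Union>(Union ` \<K>)"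
      by blast
    then show "openin X (\<Union>(\<Union>\<K>))"
      using K by auto
  qed
  then show ?thesis
    unfolding quotient_topology_def by (simp add: topology_inverse')
qed

lemma topspace_quotient_topology:
  assumes "equiv (topspace X) r"
  shows "topspace (quotient_topology X r) = topspace X // r"
proof -
  have "openin (quotient_topology X r) (topspace X // r)"
    using assms by (simp add: openin_quotient_topology Union_quotient)
  then show ?thesis
    using openin_quotient_topology[OF assms, of "topspace (quotient_topology X r)"]
      openin_subset openin_topspace by blast
qed

lemma quotient_map_quotient_topology:
  assumes "equiv (topspace X) r"
  shows "quotient_map X (quotient_topology X r) (\<lambda>x. r `` {x})"
  unfolding quotient_map_def
proof (intro conjI allI impI)
  show "(\<lambda>x. r `` {x}) ` topspace X = topspace (quotient_topology X r)"
    by (auto simp: topspace_quotient_topology[OF assms] quotient_def)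
  fix U
  assume "U \<subseteq> topspace (quotient_topology X r)"
  then have U: "U \<subseteq> topspace X // r"
    by (simp add: topspace_quotient_topology[OF assms])
  have "{x \<in> topspace X. r `` {x} \<in> U} = \<Union>U"
  proof (intro subset_antisym subsetI)
    fix x assume "x \<in> {x \<in> topspace X. r `` {x} \<in> U}"
    then show "x \<in> \<Union>U"
      using equiv_class_self[OF assms] by blast
  next
    fix x assume "x \<in> \<Union>U"
    then obtain A where A: "A \<in> U" "x \<in> A" by blast
    then have Aq: "A \<in> topspace X // r" using U by blast
    have x: "x \<in> topspace X"
      using A Aq Union_quotient[OF assms] by blast
    have "r `` {x} = A"
      using Aq A(2) by (metis assms equiv_class_eq_iff quotientE Image_singleton_iff)
    then show "x \<in> {x \<in> topspace X. r `` {x} \<in> U}"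
      using x A by simp
  qed
  then show "openin X {x \<in> topspace X. r `` {x} \<in> U} \<longleftrightarrow> openin (quotient_topology X r) U"
    using U by (simp add: openin_quotient_topology[OF assms])
qed

text \<open>The library's \<^const>\<open>sum_topology\<close> requires all summands to have the same type.\<close>

definition disjoint_union_topology :: "'a topology \<Rightarrow> 'b topology \<Rightarrow> ('a + 'b) topology" where
  "disjoint_union_topology X Y = topology (\<lambda>U. openin X (Inl -` U) \<and> openin Y (Inr -` U))"

lemma openin_disjoint_union_topology:
  "openin (disjoint_union_topology X Y) U \<longleftrightarrow> openin X (Inl -` U) \<and> openin Y (Inr -` U)"
proof -
  have "istopology (\<lambda>U. openin X (Inl -` U) \<and> openin Y (Inr -` U))"
    unfolding istopology_def by (auto simp: vimage_Union)
  then show ?thesis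
    unfolding disjoint_union_topology_def by (simp add: topology_inverse')
qed

lemma topspace_disjoint_union_topology:
  "topspace (disjoint_union_topology X Y) = topspace X <+> topspace Y"
proof
  show "topspace (disjoint_union_topology X Y) \<subseteq> topspace X <+> topspace Y"
  proof
    fix z assume z: "z \<in> topspace (disjoint_union_topology X Y)"
    have "openin X (Inl -` topspace (disjoint_union_topology X Y))"
      "openin Y (Inr -` topspace (disjoint_union_topology X Y))"
      using openin_topspace openin_disjoint_union_topology by blast+
    then show "z \<in> topspace X <+> topspace Y"
      using z by (cases z) (auto dest!: openin_subset)
  qed
  have "Inl -` (topspace X <+> topspace Y) = topspace X"
    "Inr -` (topspace X <+> topspace Y) = topspace Y"
    by auto
  then show "topspace X <+> topspace Y \<subseteq> topspace (disjoint_union_topology X Y)"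
    by (intro openin_subset) (simp add: openin_disjoint_union_topology)
qed

text \<open>The unreduced mapping cone of \<open>f\<close>, for nonempty \<open>X\<close>: in \<open>X \<times> [0,1] \<squnion> Y\<close> the end
  \<open>X \<times> {0}\<close> is collapsed to the cone point and \<open>(x, 1)\<close> is glued to \<open>f x\<close>.\<close>

definition mapping_cone_space :: "'a topology \<Rightarrow> 'b topology \<Rightarrow> ('a \<times> real + 'b) topology" where
  "mapping_cone_space X Y = disjoint_union_topology (prod_topology X (top_of_set {0..1})) Y"

inductive cone_glue :: "'a topology \<Rightarrow> ('a \<Rightarrow> 'b) \<Rightarrow> 'a \<times> real + 'b \<Rightarrow> 'a \<times> real + 'b \<Rightarrow> bool"
  for X f where
  collapse: "x \<in> topspace X \<Longrightarrow> y \<in> topspace X \<Longrightarrow> cone_glue X f (Inl (x, 0)) (Inl (y, 0))"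
| attach: "x \<in> topspace X \<Longrightarrow> cone_glue X f (Inl (x, 1)) (Inr (f x))"

definition cone_rel ::
    "'a topology \<Rightarrow> 'b topology \<Rightarrow> ('a \<Rightarrow> 'b) \<Rightarrow> (('a \<times> real + 'b) \<times> ('a \<times> real + 'b)) set" where
  "cone_rel X Y f =
     {(p, q). p \<in> topspace (mapping_cone_space X Y) \<and> q \<in> topspace (mapping_cone_space X Y) \<and>
              equivclp (cone_glue X f) p q}"

lemma equiv_cone_rel: "equiv (topspace (mapping_cone_space X Y)) (cone_rel X Y f)"
  by (rule equivI) (auto simp: cone_rel_def refl_on_def sym_def trans_def
      intro: equivclp_sym equivclp_trans)

definition mapping_cone ::
    "'a topology \<Rightarrow> 'b topology \<Rightarrow> ('a \<Rightarrow> 'b) \<Rightarrow> ('a \<times> real + 'b) set topology" where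
  "mapping_cone X Y f = quotient_topology (mapping_cone_space X Y) (cone_rel X Y f)"

end

theory Submission
  imports Defs "HOL-Analysis.Analysis" "HOL-Number_Theory.Cong"
begin

text \<open>Up to homotopy the cone depends only on the absolute value \<open>d\<close> of the degree.

  Upper bounds: if a space has \<open>m + 1\<close> strata with neighbourhoods contractible in it, then
  \<open>TC \<le> 2 * m\<close>.  For \<open>d = 2\<close> the cone is the projective plane; a bilinear form that does not vanish
  on \<open>(x, y)\<close> tells how to rotate the line of \<open>x\<close> to that of \<open>y\<close>, and the inner product together with
  the three components of the cross product have no common zero.

  Lower bounds: for \<open>d = 0\<close>, two planners would deform the product of a circle and a sphere into its wedge.
  For \<open>d \<ge> 2\<close>, a planner on \<open>U\<close> gives a locally constant function from the preimage of \<open>U\<close> in the square of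
  the universal cover to the roots of unity of order \<open>d\<close>, equivariant under deck transformations.  Labelling
  a fine grid by members of the cover and roots of unity pulls back cochains of the cyclic group.
  The class \<open>T = a \<union> u\<close> in degree 3 has value 1 modulo \<open>d\<close> on the product of a disc and a circle, but
  vanishes if there are only three members.  If there are four, then \<open>u \<union> u\<close> vanishes, and Stokes' formula
  for \<open>\<delta>T = d * (u \<union> u)\<close> on the product of two discs gives \<open>2 = 0\<close> modulo \<open>d\<close>.\<close>

section \<open>Motion planners\<close>

text \<open>In the lower bound for \<open>d \<ge> 2\<close> the labels amount to an equivariant map
  from the square of the universal cover to a join of copies of the cyclic group, one copy for each
  member of the open cover. Two labels in one small cube with the same index agree, a locally
  constant function being constant on a connected cube. So a chain of vertices ordered by index
  degenerates as soon as it has more vertices than there are indices, and a small cover annihilates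
  the classes pulled back from the group. The deck transformations of the two factors shift the
  labels in opposite directions, so in cohomology \<open>u\<close> pulls back to a difference
  \<open>u1 - u2\<close>. Its square is \<open>- 2 * u1 * u2\<close>, since \<open>u1\<close> and
  \<open>u2\<close> have square zero for reasons of dimension, and \<open>u1 * u2\<close> has order
  \<open>d\<close>. Hence the exception at \<open>d = 2\<close>, where only the class in degree 3
  survives. With explicit cochains this becomes bookkeeping on a grid over the product of two discs,
  in which a deck transformation appears as a rotation of a boundary circle by \<open>1 / d\<close>
  of a turn.\<close>

lemma continuous_map_path_space:
  assumes h: "continuous_map (prod_topology Z (top_of_set {0..1::real})) X h"
  shows "continuous_map Z (path_space X) (\<lambda>p. restrict (\<lambda>t. h (p, t)) {0..1})"
  unfolding path_space_def compact_open_topology_def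
proof (rule continuous_on_generated_topo)
  let ?I = "top_of_set {0..1::real}"
  let ?s = "\<lambda>p. restrict (\<lambda>t. h (p, t)) {0..1::real}"
  have cont: "continuous_map ?I X (?s p)" if "p \<in> topspace Z" for p
  proof -
    have "continuous_map ?I X (h \<circ> (\<lambda>t. (p, t)))"
      by (rule continuous_map_compose[OF _ h]) (auto simp: that continuous_map_pairedI)
    then show ?thesis by (rule continuous_map_eq) auto
  qed
  fix W
  assume "W \<in> {{f \<in> extensional (topspace ?I). continuous_map ?I X f \<and> f ` K \<subseteq> V} |K V.
          compactin ?I K \<and> openin X V}"
  then obtain K V where W: "W = {f \<in> extensional (topspace ?I). continuous_map ?I X f \<and> f ` K \<subseteq> V}"
    and K: "compactin ?I K" and V: "openin X V" by blast
  have KI: "K \<subseteq> {0..1}" using compactin_subset_topspace[OF K] by simp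
  let ?O = "{q \<in> topspace (prod_topology Z ?I). h q \<in> V}"
  have O: "openin (prod_topology Z ?I) ?O"
    using h V by (rule openin_continuous_map_preimage)
  have eq: "?s -` W \<inter> topspace Z = {p \<in> topspace Z. {p} \<times> K \<subseteq> ?O}"
    using cont KI unfolding W by (auto simp: image_subset_iff)
  show "openin Z (?s -` W \<inter> topspace Z)"
    unfolding eq
  proof (subst openin_subopen, intro ballI)
    \<comment> \<open>Compactness of \<open>K\<close> enters here: a neighbourhood of
      \<open>{p} \<times> K\<close> contains a product neighbourhood.\<close>
    fix p assume p: "p \<in> {p \<in> topspace Z. {p} \<times> K \<subseteq> ?O}"
    then obtain A B where "openin Z A" "openin ?I B" "p \<in> A" "K \<subseteq> B" "A \<times> B \<subseteq> ?O"
      using tube_lemma_right[OF O K, of p] by auto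
    then show "\<exists>T. openin Z T \<and> p \<in> T \<and> T \<subseteq> {p \<in> topspace Z. {p} \<times> K \<subseteq> ?O}"
      by (intro exI[of _ A]) (auto dest: openin_subset)
  qed
next
  let ?I = "top_of_set {0..1::real}"
  let ?s = "\<lambda>p. restrict (\<lambda>t. h (p, t)) {0..1::real}"
  have cont: "continuous_map ?I X (?s p)" if "p \<in> topspace Z" for p
  proof -
    have "continuous_map ?I X (h \<circ> (\<lambda>t. (p, t)))"
      by (rule continuous_map_compose[OF _ h]) (auto simp: that continuous_map_pairedI)
    then show ?thesis by (rule continuous_map_eq) auto
  qed
  show "?s ` topspace Z \<subseteq> \<Union> {{f \<in> extensional (topspace ?I). continuous_map ?I X f \<and> f ` K \<subseteq> V} |K V.
          compactin ?I K \<and> openin X V}"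
  proof
    fix f assume "f \<in> ?s ` topspace Z"
    then have "f \<in> {f \<in> extensional (topspace ?I). continuous_map ?I X f \<and> f ` {} \<subseteq> {}}"
      using cont by auto
    then show "f \<in> \<Union> {{f \<in> extensional (topspace ?I). continuous_map ?I X f \<and> f ` K \<subseteq> V} |K V.
          compactin ?I K \<and> openin X V}"
      using compactin_empty openin_empty by blast
  qed
qed

text \<open>The half of the exponential law that rests on local compactness of the interval:
  \<open>s p\<close> maps a compact neighbourhood \<open>?K\<close> of \<open>t\<close> into
  \<open>V\<close>, and this is a subbasic, hence open, condition on \<open>s p\<close>.\<close>

lemma continuous_map_path_space_eval:
  assumes s: "continuous_map Z (path_space X) s"
  shows "continuous_map (prod_topology Z (top_of_set {0..1})) X (\<lambda>(p, t). s p t)"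
proof -
  let ?I = "top_of_set {0..1::real}"
  have sp: "continuous_map ?I X (s p)" if "p \<in> topspace Z" for p
  proof -
    have "s p \<in> topspace (path_space X)"
      using s that by (auto simp: continuous_map_def)
    then show ?thesis by (simp add: topspace_path_space pathin_def)
  qed
  show ?thesis
    unfolding continuous_map_def
  proof (intro conjI allI impI)
    show "(\<lambda>(p, t). s p t) \<in> topspace (prod_topology Z ?I) \<rightarrow> topspace X"
      using sp by (fastforce simp: continuous_map_def)
    fix V assume V: "openin X V"
    let ?O = "{q \<in> topspace (prod_topology Z ?I). (case q of (p, t) \<Rightarrow> s p t) \<in> V}"
    show "openin (prod_topology Z ?I) ?O"
    proof (subst openin_subopen, intro ballI)
      fix q assume q: "q \<in> ?O"
      then obtain p t where pt: "q = (p, t)" "p \<in> topspace Z" "t \<in> {0..1}" "s p t \<in> V"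
        by auto
      have "openin ?I {u \<in> topspace ?I. s p u \<in> V}"
        using sp[OF pt(2)] V by (rule openin_continuous_map_preimage)
      then obtain T where T: "open T" "{u \<in> {0..1}. s p u \<in> V} = {0..1} \<inter> T"
        by (auto simp: openin_open)
      then obtain e where e: "e > 0" "cball t e \<subseteq> T"
        using pt by (metis (no_types, lifting) IntD2 mem_Collect_eq open_contains_cball)
      let ?K = "{0..1} \<inter> cball t e"
      let ?A = "{p \<in> topspace Z. s p \<in> {f \<in> extensional (topspace ?I). continuous_map ?I X f \<and> f ` ?K \<subseteq> V}}"
      have "compactin ?I ?K"
        by (simp add: compactin_subtopology compact_Int_closed)
      then have "openin (path_space X) {f \<in> extensional (topspace ?I). continuous_map ?I X f \<and> f ` ?K \<subseteq> V}"
        unfolding path_space_def compact_open_topology_def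
        by (intro topology_generated_by_Basis) (use V in blast)
      then have A: "openin Z ?A"
        using s by (intro openin_continuous_map_preimage)
      have B: "openin ?I ({0..1} \<inter> ball t e)" by (simp add: openin_open_Int)
      have "?A \<times> ({0..1} \<inter> ball t e) \<subseteq> ?O" by auto
      moreover have "q \<in> ?A \<times> ({0..1} \<inter> ball t e)"
      proof -
        have "s p \<in> extensional {0..1}"
          using s pt(2) by (auto simp: continuous_map_def topspace_path_space)
        moreover have "s p ` ?K \<subseteq> V" using T(2) e(2) by blast
        ultimately show ?thesis using pt e(1) sp by auto
      qed
      ultimately show "\<exists>T. openin (prod_topology Z ?I) T \<and> q \<in> T \<and> T \<subseteq> ?O"
        using A B by (intro exI[of _ "?A \<times> ({0..1} \<inter> ball t e)"]) (simp add: openin_prod_Times_iff)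
    qed
  qed
qed

text \<open>Removes the function space: by the exponential law a section over \<open>U\<close> is a
  homotopy between the two projections.\<close>

lemma has_path_section_iff:
  "has_path_section X U \<longleftrightarrow>
   (\<exists>h. continuous_map (prod_topology (subtopology (prod_topology X X) U) (top_of_set {0..1::real})) X h \<and>
        (\<forall>p\<in>U. h (p, 0) = fst p \<and> h (p, 1) = snd p))" (is "_ \<longleftrightarrow> ?rhs")
proof
  assume "has_path_section X U"
  then obtain s where s: "continuous_map (subtopology (prod_topology X X) U) (path_space X) s"
      "\<forall>p\<in>U. path_eval (s p) = p"
    by (auto simp: has_path_section_def)
  show ?rhs
    using continuous_map_path_space_eval[OF s(1)] s(2)
    by (intro exI[of _ "\<lambda>(p, t). s p t"]) (auto simp: path_eval_def)
next
  assume ?rhs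
  then obtain h where h: "continuous_map (prod_topology (subtopology (prod_topology X X) U) (top_of_set {0..1::real})) X h"
    "\<forall>p\<in>U. h (p, 0) = fst p \<and> h (p, 1) = snd p" by blast
  show "has_path_section X U"
    unfolding has_path_section_def
    using continuous_map_path_space[OF h(1)] h(2)
    by (intro exI[of _ "\<lambda>p. restrict (\<lambda>t. h (p, t)) {0..1}"]) (auto simp: path_eval_def)
qed

section \<open>Planners on subsets of a topological type, and homotopy domination\<close>

definition motion_planner :: "'a::topological_space set \<Rightarrow> ('a \<times> 'a) set \<Rightarrow> (('a \<times> 'a) \<times> real \<Rightarrow> 'a) \<Rightarrow> bool" where
  "motion_planner S U h \<longleftrightarrow> continuous_on (U \<times> {0..1}) h \<and> h ` (U \<times> {0..1}) \<subseteq> S \<and>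
     (\<forall>p\<in>U. h (p, 0) = fst p \<and> h (p, 1) = snd p)"

definition TC_le :: "'a::topological_space set \<Rightarrow> nat \<Rightarrow> bool" where
  "TC_le S n \<longleftrightarrow> (\<exists>U. (\<forall>i\<le>n. openin (top_of_set (S \<times> S)) (U i) \<and> (\<exists>h. motion_planner S (U i) h)) \<and>
      (\<Union>i\<le>n. U i) = S \<times> S)"

lemma has_path_section_top_of_set:
  assumes "U \<subseteq> S \<times> S"
  shows "has_path_section (top_of_set S) U \<longleftrightarrow> (\<exists>h. motion_planner S U h)"
proof -
  have "prod_topology (subtopology (prod_topology (top_of_set S) (top_of_set S)) U) (top_of_set {0..1::real})
      = top_of_set (U \<times> {0..1})"
    using assms by (simp add: subtopology_subtopology Int_absorb1)
  then show ?thesis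
    unfolding has_path_section_iff motion_planner_def by (simp add: image_subset_iff_funcset)
qed

lemma has_path_section_homeomorphic:
  assumes fg: "homeomorphic_maps X Y f g" and "has_path_section X U" and "openin (prod_topology X X) U"
  shows "has_path_section Y (map_prod f f ` U)" and "openin (prod_topology Y Y) (map_prod f f ` U)"
proof -
  have UX: "U \<subseteq> topspace X \<times> topspace X" using openin_subset[OF assms(3)] by simp
  have f: "continuous_map X Y f" and g: "continuous_map Y X g"
    and gf: "\<And>x. x \<in> topspace X \<Longrightarrow> g (f x) = x" and fgy: "\<And>y. y \<in> topspace Y \<Longrightarrow> f (g y) = y"
    using fg by (auto simp: homeomorphic_maps_def)
  have "homeomorphic_map (prod_topology X X) (prod_topology Y Y) (\<lambda>(x,y). (f x, f y))"
    using fg homeomorphic_maps_prod[of X X Y Y f f g g] homeomorphic_maps_map by blast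
  then show "openin (prod_topology Y Y) (map_prod f f ` U)"
    using assms(3) UX by (simp add: map_prod_def homeomorphic_map_openness_eq)
  obtain h where h: "continuous_map (prod_topology (subtopology (prod_topology X X) U) (top_of_set {0..1::real})) X h"
    "\<forall>p\<in>U. h (p, 0) = fst p \<and> h (p, 1) = snd p" using assms(2) by (auto simp: has_path_section_iff)
  let ?V = "map_prod f f ` U"
  have 1: "continuous_map (prod_topology (subtopology (prod_topology Y Y) ?V) (top_of_set {0..1}))
      (prod_topology (subtopology (prod_topology X X) U) (top_of_set {0..1})) (\<lambda>(p, t). (map_prod g g p, t))"
  proof -
    have "continuous_map (subtopology (prod_topology Y Y) ?V) (prod_topology X X) (map_prod g g)"
      using g unfolding map_prod_def
      by (intro continuous_map_from_subtopology) (simp add: continuous_map_prod_top)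
    moreover have "map_prod g g p \<in> U" if "p \<in> ?V" for p
      using that UX gf by (auto simp: subset_iff)
    ultimately have "continuous_map (subtopology (prod_topology Y Y) ?V) (subtopology (prod_topology X X) U) (map_prod g g)"
      by (auto simp: continuous_map_in_subtopology)
    then show ?thesis by (simp add: continuous_map_prod_top)
  qed
  show "has_path_section Y ?V"
    unfolding has_path_section_iff
  proof (intro exI conjI ballI)
    show "continuous_map (prod_topology (subtopology (prod_topology Y Y) ?V) (top_of_set {0..1})) Y
       (f \<circ> h \<circ> (\<lambda>(p, t). (map_prod g g p, t)))"
      by (intro continuous_map_compose[OF 1] continuous_map_compose[OF h(1)] f)
    fix p assume "p \<in> ?V"
    then obtain x y where xy: "p = (f x, f y)" "(x, y) \<in> U" by auto
    then have "g (f x) = x" "g (f y) = y" using UX gf by auto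
    then show "(f \<circ> h \<circ> (\<lambda>(p, t). (map_prod g g p, t))) (p, 0) = fst p"
      "(f \<circ> h \<circ> (\<lambda>(p, t). (map_prod g g p, t))) (p, 1) = snd p"
      using h(2) xy by auto
  qed
qed

lemma TC_le_of_homeomorphic:
  assumes fg: "homeomorphic_maps X Y f g"
    and "\<forall>i\<le>n. openin (prod_topology X X) (U i) \<and> has_path_section X (U i)"
    and "(\<Union>i\<le>n. U i) = topspace (prod_topology X X)"
  shows "\<exists>U. (\<forall>i\<le>n::nat. openin (prod_topology Y Y) (U i) \<and> has_path_section Y (U i)) \<and>
     (\<Union>i\<le>n. U i) = topspace (prod_topology Y Y)"
proof (intro exI conjI allI impI)
  let ?V = "\<lambda>i. map_prod f f ` U i"
  show "openin (prod_topology Y Y) (?V i)" "has_path_section Y (?V i)" if "i \<le> n" for i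
    using has_path_section_homeomorphic[OF fg, of "U i"] assms(2) that by auto
  have "f ` topspace X = topspace Y"
    using fg by (metis homeomorphic_imp_surjective_map homeomorphic_maps_map)
  then show "(\<Union>i\<le>n. ?V i) = topspace (prod_topology Y Y)"
    using assms(3) by (simp add: map_prod_surj_on flip: image_UN)
qed

lemma TC_eq_Inf:
  assumes "X homeomorphic_space top_of_set S"
  shows "TC X = Inf (enat ` {n. TC_le S n})"
proof -
  obtain f g where fg: "homeomorphic_maps X (top_of_set S) f g"
    using assms by (auto simp: homeomorphic_space_def)
  have TCS: "TC_le S n \<longleftrightarrow> (\<exists>U. (\<forall>i\<le>n. openin (prod_topology (top_of_set S) (top_of_set S)) (U i) \<and>
      has_path_section (top_of_set S) (U i)) \<and> (\<Union>i\<le>n. U i) = topspace (prod_topology (top_of_set S) (top_of_set S)))" for n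
  proof -
    have key: "(openin (top_of_set (S \<times> S)) V \<and> (\<exists>h. motion_planner S V h)) \<longleftrightarrow>
      (openin (prod_topology (top_of_set S) (top_of_set S)) V \<and> has_path_section (top_of_set S) V)" for V
    proof -
      have "openin (top_of_set (S \<times> S)) V \<Longrightarrow> V \<subseteq> S \<times> S" by (rule openin_imp_subset)
      then show ?thesis using has_path_section_top_of_set[of V S] unfolding prod_topology_subtopology_eu by blast
    qed
    have top: "topspace (prod_topology (top_of_set S) (top_of_set S)) = S \<times> S" by simp
    show ?thesis unfolding TC_le_def key top ..
  qed
  have "(\<exists>U. (\<forall>i\<le>n. openin (prod_topology X X) (U i) \<and> has_path_section X (U i)) \<and>
     (\<Union>i\<le>n. U i) = topspace (prod_topology X X)) \<longleftrightarrow> TC_le S n" for n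
  proof
    assume "\<exists>U. (\<forall>i\<le>n. openin (prod_topology X X) (U i) \<and> has_path_section X (U i)) \<and>
     (\<Union>i\<le>n. U i) = topspace (prod_topology X X)"
    then show "TC_le S n" unfolding TCS by (elim exE conjE) (rule TC_le_of_homeomorphic[OF fg])
  next
    have gf: "homeomorphic_maps (top_of_set S) X g f" by (rule homeomorphic_maps_sym[THEN iffD1, OF fg])
    assume "TC_le S n"
    then obtain U where U: "\<forall>i\<le>n. openin (prod_topology (top_of_set S) (top_of_set S)) (U i) \<and>
        has_path_section (top_of_set S) (U i)"
      "(\<Union>i\<le>n. U i) = topspace (prod_topology (top_of_set S) (top_of_set S))"
      unfolding TCS by blast
    show "\<exists>U. (\<forall>i\<le>n. openin (prod_topology X X) (U i) \<and> has_path_section X (U i)) \<and>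
     (\<Union>i\<le>n. U i) = topspace (prod_topology X X)"
      by (rule TC_le_of_homeomorphic[OF gf U])
  qed
  then have "{enat n |n. \<exists>U. (\<forall>i\<le>n. openin (prod_topology X X) (U i) \<and> has_path_section X (U i)) \<and>
     (\<Union>i\<le>n. U i) = topspace (prod_topology X X)} = enat ` {n. TC_le S n}"
    by auto
  then show ?thesis unfolding TC_def by simp
qed

lemma TC_le_mono:
  assumes "TC_le S m" "m \<le> n"
  shows "TC_le S n"
proof -
  obtain U where U: "\<forall>i\<le>m. openin (top_of_set (S \<times> S)) (U i) \<and> (\<exists>h. motion_planner S (U i) h)" "(\<Union>i\<le>m. U i) = S \<times> S"
    using assms(1) by (auto simp: TC_le_def)
  have "motion_planner S {} h" for h by (simp add: motion_planner_def)
  then have 1: "\<forall>i\<le>n. openin (top_of_set (S \<times> S)) (if i \<le> m then U i else {}) \<and> (\<exists>h. motion_planner S (if i \<le> m then U i else {}) h)"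
    using U by auto
  have 2: "(\<Union>i\<le>n. if i \<le> m then U i else {}) = S \<times> S"
  proof -
    have "(\<Union>i\<le>n. if i \<le> m then U i else {}) = (\<Union>i\<le>m. U i)"
      using assms(2) order_trans by (fastforce split: if_splits)
    then show ?thesis using U by simp
  qed
  show ?thesis unfolding TC_le_def
    using 1 2 by (intro exI[of _ "\<lambda>i. if i \<le> m then U i else {}"] conjI)
qed

text \<open>By monotonicity only the predecessor has to be excluded; for \<open>n = 0\<close>
  nothing is left to exclude.\<close>

lemma TC_eqI:
  assumes "X homeomorphic_space top_of_set S" "TC_le S n" "\<And>m. n = Suc m \<Longrightarrow> \<not> TC_le S m"
  shows "TC X = enat n"
proof -
  have "enat n \<le> e" if "e \<in> enat ` {n. TC_le S n}" for e
  proof -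
    from that obtain m where m: "e = enat m" "TC_le S m" by blast
    have "n \<le> m"
    proof (cases n)
      case (Suc k)
      then show ?thesis using assms(3)[of k] TC_le_mono[OF m(2), of k] by (cases "m \<le> k") auto
    qed simp
    then show ?thesis using m by simp
  qed
  then show ?thesis unfolding TC_eq_Inf[OF assms(1)]
    using assms(2) by (intro antisym Inf_lower Inf_greatest) auto
qed

definition join_homotopy :: "('a \<times> real \<Rightarrow> 'b) \<Rightarrow> ('a \<times> real \<Rightarrow> 'b) \<Rightarrow> 'a \<times> real \<Rightarrow> 'b" where
  "join_homotopy h k q = (if snd q \<le> 1/2 then h (fst q, 2 * snd q) else k (fst q, 2 * snd q - 1))"

lemma join_homotopy_0 [simp]: "join_homotopy h k (p, 0) = h (p, 0)"
  and join_homotopy_1 [simp]: "join_homotopy h k (p, 1) = k (p, 1)"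
  by (simp_all add: join_homotopy_def)

lemma continuous_on_join_homotopy:
  fixes h k :: "'a::topological_space \<times> real \<Rightarrow> 'b::topological_space"
  assumes h: "continuous_on (U \<times> {0..1}) h" and k: "continuous_on (U \<times> {0..1}) k"
    and "\<And>p. p \<in> U \<Longrightarrow> h (p, 1) = k (p, 0)"
  shows "continuous_on (U \<times> {0..1}) (join_homotopy h k)"
proof -
  have "continuous_on (U \<times> {0..1/2} \<union> U \<times> {1/2..1})
     (\<lambda>q. if snd q \<le> 1/2 then h (fst q, 2 * snd q) else k (fst q, 2 * snd q - 1))"
  proof (rule continuous_on_cases_local)
    have e: "U \<times> {0..1/2} \<union> U \<times> {1/2..1} = U \<times> {0..1::real}" by auto
    have "U \<times> {0..1/2} = (U \<times> {0..1::real}) \<inter> (UNIV \<times> {..1/2})" "U \<times> {1/2..1} = (U \<times> {0..1::real}) \<inter> (UNIV \<times> {1/2..})"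
      by auto
    then show "closedin (top_of_set (U \<times> {0..1/2} \<union> U \<times> {1/2..1})) (U \<times> {0..1/2::real})"
      "closedin (top_of_set (U \<times> {0..1/2} \<union> U \<times> {1/2..1})) (U \<times> {1/2..1::real})"
      unfolding e by (simp_all only:) (intro closedin_closed_Int closed_Times closed_UNIV closed_atMost closed_atLeast)+
    show "continuous_on (U \<times> {0..1/2}) (\<lambda>q. h (fst q, 2 * snd q))"
      by (rule continuous_on_compose2[OF h]) (auto intro!: continuous_intros)
    show "continuous_on (U \<times> {1/2..1}) (\<lambda>q. k (fst q, 2 * snd q - 1))"
      by (rule continuous_on_compose2[OF k]) (auto intro!: continuous_intros)
    fix q :: "'a \<times> real"
    assume "q \<in> U \<times> {0..1/2} \<and> \<not> snd q \<le> 1/2 \<or> q \<in> U \<times> {1/2..1} \<and> snd q \<le> 1/2"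
    then have "fst q \<in> U" "2 * snd q = 1" by auto
    then show "h (fst q, 2 * snd q) = k (fst q, 2 * snd q - 1)"
      using assms(3)[of "fst q"] by (simp only: diff_self)
  qed
  moreover have "U \<times> {0..1/2} \<union> U \<times> {1/2..1} = U \<times> {0..1::real}" by auto
  ultimately show ?thesis unfolding join_homotopy_def by simp
qed

lemma join_homotopy_image:
  assumes "h ` (U \<times> {0..1}) \<subseteq> S" "k ` (U \<times> {0..1}) \<subseteq> S"
  shows "join_homotopy h k ` (U \<times> {0..1}) \<subseteq> S"
  using assms by (auto simp: join_homotopy_def image_subset_iff)

text \<open>Travel from \<open>x\<close> to \<open>g (f x)\<close> along \<open>H\<close>, then
  along the image under \<open>g\<close> of a path planned in \<open>T\<close>, and finally from
  \<open>g (f y)\<close> back to \<open>y\<close> along \<open>H\<close>.\<close>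

lemma TC_le_dominated:
  fixes S :: "'a::topological_space set" and T :: "'b::topological_space set"
  assumes f: "continuous_on S f" "f ` S \<subseteq> T" and g: "continuous_on T g" "g ` T \<subseteq> S"
    and H: "continuous_on (S \<times> {0..1}) H" "H ` (S \<times> {0..1}) \<subseteq> S"
    and H01: "\<And>x. x \<in> S \<Longrightarrow> H (x, 0) = x" "\<And>x. x \<in> S \<Longrightarrow> H (x, 1::real) = g (f x)"
    and "TC_le T n"
  shows "TC_le S n"
proof -
  obtain U where U: "\<And>i. i \<le> n \<Longrightarrow> openin (top_of_set (T \<times> T)) (U i)" "\<And>i. i \<le> n \<Longrightarrow> \<exists>h. motion_planner T (U i) h"
      "(\<Union>i\<le>n. U i) = T \<times> T"
    using assms(9) by (auto simp: TC_le_def)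
  define ff where "ff p = (f (fst p), f (snd p))" for p
  define V where "V i = (S \<times> S) \<inter> ff -` U i" for i
  have ff: "continuous_on (S \<times> S) ff" "ff ` (S \<times> S) \<subseteq> T \<times> T"
    unfolding ff_def using f by (auto intro!: continuous_intros continuous_on_compose2[OF f(1)])
  have "openin (top_of_set (S \<times> S)) (V i)" if "i \<le> n" for i
    unfolding V_def using continuous_openin_preimage[OF ff(1) _ U(1)[OF that]] ff(2) by (simp add: image_subset_iff_funcset)
  moreover have "\<exists>k. motion_planner S (V i) k" if i: "i \<le> n" for i
  proof -
    from U(2)[OF i] obtain h where hm: "motion_planner T (U i) h" by blast
    then have h: "continuous_on (U i \<times> {0..1}) h" "h ` (U i \<times> {0..1}) \<subseteq> T"
      "\<And>p. p \<in> U i \<Longrightarrow> h (p, 0) = fst p" "\<And>p. p \<in> U i \<Longrightarrow> h (p, 1) = snd p"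
      unfolding motion_planner_def by blast+
    let ?h1 = "\<lambda>q. H (fst (fst q), snd q)"
    let ?h2 = "\<lambda>q. g (h (ff (fst q), snd q))"
    let ?h3 = "\<lambda>q. H (snd (fst q), 1 - snd q)"
    let ?k = "join_homotopy ?h1 (join_homotopy ?h2 ?h3)"
    have VS: "V i \<subseteq> S \<times> S" and VU: "\<And>p. p \<in> V i \<Longrightarrow> ff p \<in> U i" by (auto simp: V_def)
    have c1: "continuous_on (V i \<times> {0..1}) ?h1"
      using VS by (intro continuous_on_compose2[OF H(1)] continuous_intros) auto
    have c3: "continuous_on (V i \<times> {0..1}) ?h3"
      using VS by (intro continuous_on_compose2[OF H(1)] continuous_intros) auto
    have c2: "continuous_on (V i \<times> {0..1}) ?h2"
    proof (rule continuous_on_compose2[OF g(1)])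
      show "continuous_on (V i \<times> {0..1}) (\<lambda>q. h (ff (fst q), snd q))"
        using VS VU
        by (intro continuous_on_compose2[OF h(1)] continuous_intros continuous_on_compose2[OF ff(1)]) auto
      show "(\<lambda>q. h (ff (fst q), snd q)) ` (V i \<times> {0..1}) \<subseteq> T" using VU h(2) by auto
    qed
    have i1: "?h1 ` (V i \<times> {0..1}) \<subseteq> S" "?h3 ` (V i \<times> {0..1}) \<subseteq> S" using VS H(2) by (auto simp: image_subset_iff)
    have i2: "?h2 ` (V i \<times> {0..1}) \<subseteq> S" using VU h(2) g(2) by (auto simp: image_subset_iff)
    have e: "H (fst p, 1) = g (h (ff p, 0))" "g (h (ff p, 1)) = H (snd p, 1)" if "p \<in> V i" for p
      using that VS VU[OF that] h(3,4) H01 by (auto simp: ff_def)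
    have "motion_planner S (V i) ?k"
      unfolding motion_planner_def
    proof (intro conjI ballI)
      show "continuous_on (V i \<times> {0..1}) ?k"
        using e by (intro continuous_on_join_homotopy c1 c2 c3) auto
      show "?k ` (V i \<times> {0..1}) \<subseteq> S"
        by (intro join_homotopy_image i1 i2)
      fix p assume "p \<in> V i"
      then show "?k (p, 0) = fst p" "?k (p, 1) = snd p" using VS H01 by auto
    qed
    then show ?thesis by blast
  qed
  moreover have "(\<Union>i\<le>n. V i) = S \<times> S"
  proof -
    have "(\<Union>i\<le>n. V i) = S \<times> S \<inter> ff -` (\<Union>i\<le>n. U i)" by (auto simp: V_def)
    then show ?thesis unfolding U(3) using ff(2) by (simp only: image_subset_iff_subset_vimage Int_absorb2)
  qed
  ultimately show ?thesis unfolding TC_le_def by blast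
qed

lemma TC_le_homeomorphic:
  fixes S :: "'a::topological_space set" and T :: "'b::topological_space set"
  assumes "S homeomorphic T" "TC_le T n"
  shows "TC_le S n"
proof -
  obtain f g where fg: "homeomorphism S T f g" using assms(1) by (auto simp: homeomorphic_def)
  show ?thesis
  proof (rule TC_le_dominated[where f = f and g = g and H = fst])
    show "continuous_on S f" "f ` S \<subseteq> T" "continuous_on T g" "g ` T \<subseteq> S"
      using fg by (auto simp: homeomorphism_def)
    show "continuous_on (S \<times> {0..1::real}) fst" by (intro continuous_intros)
    show "fst ` (S \<times> {0..1::real}) \<subseteq> S" by auto
    show "fst (x, 1::real) = g (f x)" if "x \<in> S" for x
      using fg that by (auto simp: homeomorphism_def)
  qed (auto simp: assms)
qed

section \<open>A compact model of the mapping cone\<close>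

definition plane :: "(nat \<Rightarrow> real) \<Rightarrow> complex" where "plane x = Complex (x 0) (x 1)"
definition coords :: "complex \<Rightarrow> nat \<Rightarrow> real" where
  "coords z = (\<lambda>i. if i = 0 then Re z else if i = 1 then Im z else 0)"

abbreviation "circle \<equiv> sphere (0::complex) 1"

lemma plane_coords [simp]: "plane (coords z) = z"
  by (simp add: plane_def coords_def complex_eq_iff)

lemma topspace_nsphere1: "x \<in> topspace (nsphere 1) \<longleftrightarrow> (x 0)\<^sup>2 + (x 1)\<^sup>2 = 1 \<and> (\<forall>i>1. x i = 0)"
proof -
  have "{..1::nat} = {0, 1}" by auto
  then show ?thesis by (simp add: nsphere)
qed

lemma coords_plane: "x \<in> topspace (nsphere 1) \<Longrightarrow> coords (plane x) = x"
  unfolding topspace_nsphere1 by (auto simp: plane_def coords_def fun_eq_iff)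

lemma plane_in: "x \<in> topspace (nsphere 1) \<Longrightarrow> plane x \<in> circle"
  unfolding topspace_nsphere1 by (simp add: plane_def cmod_def)

lemma coords_in: "z \<in> circle \<Longrightarrow> coords z \<in> topspace (nsphere 1)"
  unfolding topspace_nsphere1 by (simp add: coords_def cmod_def)

lemma continuous_map_plane: "continuous_map (nsphere 1) (top_of_set circle) plane"
proof -
  have c: "continuous_on UNIV (\<lambda>p. Complex (fst p) (snd p))"
    by (simp add: Complex_eq) (intro continuous_intros)
  have "continuous_map (nsphere 1) (prod_topology euclideanreal euclideanreal) (\<lambda>x. (x 0, x 1))"
    by (intro continuous_map_pairedI continuous_map_nsphere_projection)
  then have "continuous_map (nsphere 1) euclidean ((\<lambda>p. Complex (fst p) (snd p)) \<circ> (\<lambda>x. (x 0, x 1)))"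
    using c by (intro continuous_map_compose[of _ euclidean]) auto
  moreover have "(\<lambda>p. Complex (fst p) (snd p)) \<circ> (\<lambda>x. (x 0, x 1)) = plane"
    by (simp add: fun_eq_iff plane_def)
  ultimately show ?thesis
    using plane_in by (auto simp: continuous_map_in_subtopology)
qed

lemma continuous_map_coords: "continuous_map (top_of_set circle) (nsphere 1) coords"
  unfolding nsphere continuous_map_in_subtopology
proof
  show "continuous_map (top_of_set circle) (powertop_real UNIV) coords"
    unfolding continuous_map_componentwise_UNIV coords_def
    by (auto intro!: continuous_intros simp: if_distrib)
  show "coords \<in> topspace (top_of_set circle) \<rightarrow> {x. (\<Sum>i\<le>1. (x i)\<^sup>2) = 1 \<and> (\<forall>i>1. x i = 0)}"
    using coords_in by (auto simp: nsphere)
qed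

text \<open>The factor \<open>t * (1 - t)\<close> in the middle vanishes exactly where the cone
  forgets the point of the circle, at the apex and at the glued end.\<close>

definition cone_pt :: "(complex \<Rightarrow> complex) \<Rightarrow> complex \<times> real \<Rightarrow> complex \<times> complex \<times> real" where
  "cone_pt \<beta> p = (of_real (snd p) * \<beta> (fst p), of_real (snd p * (1 - snd p)) * fst p, snd p)"

definition rim :: "complex \<Rightarrow> complex \<times> complex \<times> real" where
  "rim u = (u, 0, 1)"

text \<open>A compact model in \<open>\<complex> \<times> \<complex> \<times> \<real>\<close> of the mapping cone of \<open>\<beta>\<close>: the last coordinate is the
  cone parameter and the middle one separates the points of the open cone.\<close>

definition cone_set :: "(complex \<Rightarrow> complex) \<Rightarrow> (complex \<times> complex \<times> real) set" where
  "cone_set \<beta> = cone_pt \<beta> ` (circle \<times> {0..1}) \<union> rim ` circle"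

lemma continuous_on_cone_pt:
  assumes "continuous_on circle \<beta>"
  shows "continuous_on (circle \<times> {0..1}) (cone_pt \<beta>)"
  unfolding cone_pt_def
  by (intro continuous_intros continuous_on_compose2[OF assms]) auto

lemma continuous_on_rim: "continuous_on S rim"
  unfolding rim_def by (intro continuous_intros)

lemma compact_cone_set: "continuous_on circle \<beta> \<Longrightarrow> compact (cone_set \<beta>)"
  unfolding cone_set_def
  by (intro compact_Un compact_continuous_image continuous_on_cone_pt continuous_on_rim compact_Times) auto

lemma cone_pt_eq_iff:
  assumes "x \<in> circle" "y \<in> circle" "s \<in> {0..1}" "t \<in> {0..1}"
  shows "cone_pt \<beta> (x, s) = cone_pt \<beta> (y, t) \<longleftrightarrow> s = t \<and> (s = 0 \<or> s = 1 \<and> \<beta> x = \<beta> y \<or> x = y)"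
  using assms by (auto simp: cone_pt_def)

lemma cone_pt_eq_rim_iff:
  assumes "x \<in> circle" "s \<in> {0..1}"
  shows "cone_pt \<beta> (x, s) = rim u \<longleftrightarrow> s = 1 \<and> u = \<beta> x"
  using assms by (auto simp: cone_pt_def rim_def)

lemma rim_eq_iff [simp]: "rim u = rim v \<longleftrightarrow> u = v"
  by (simp add: rim_def)

section \<open>The quotient space and the compact model\<close>

lemma continuous_map_disjoint_union:
  assumes "continuous_map X Z (f \<circ> Inl)" "continuous_map Y Z (f \<circ> Inr)"
  shows "continuous_map (disjoint_union_topology X Y) Z f"
  unfolding continuous_map_def
proof (intro conjI allI impI)
  show "f \<in> topspace (disjoint_union_topology X Y) \<rightarrow> topspace Z"
    using assms by (auto simp: topspace_disjoint_union_topology continuous_map_def)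
  fix U assume U: "openin Z U"
  have "Inl -` {x \<in> topspace (disjoint_union_topology X Y). f x \<in> U} = {x \<in> topspace X. (f \<circ> Inl) x \<in> U}"
    "Inr -` {x \<in> topspace (disjoint_union_topology X Y). f x \<in> U} = {x \<in> topspace Y. (f \<circ> Inr) x \<in> U}"
    by (auto simp: topspace_disjoint_union_topology)
  then show "openin (disjoint_union_topology X Y) {x \<in> topspace (disjoint_union_topology X Y). f x \<in> U}"
    unfolding openin_disjoint_union_topology
    using openin_continuous_map_preimage[OF assms(1) U] openin_continuous_map_preimage[OF assms(2) U] by simp
qed

lemma compact_space_disjoint_union:
  assumes "compact_space X" "compact_space Y"
  shows "compact_space (disjoint_union_topology X Y)"
proof -
  have l: "continuous_map X (disjoint_union_topology X Y) Inl"
    unfolding continuous_map_def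
    by (auto simp: topspace_disjoint_union_topology openin_disjoint_union_topology vimage_def Collect_conj_eq
        intro!: openin_Int)
  have r: "continuous_map Y (disjoint_union_topology X Y) Inr"
    unfolding continuous_map_def
    by (auto simp: topspace_disjoint_union_topology openin_disjoint_union_topology vimage_def Collect_conj_eq
        intro!: openin_Int)
  have "compactin (disjoint_union_topology X Y) (Inl ` topspace X \<union> Inr ` topspace Y)"
    using assms unfolding compact_space_def
    by (intro compactin_Un image_compactin[OF _ l] image_compactin[OF _ r])
  then show ?thesis
    unfolding compact_space_def topspace_disjoint_union_topology Plus_def .
qed

lemma quotient_maps_homeomorphic:
  assumes f: "quotient_map X Y f" and g: "quotient_map X Z g"
    and fg: "\<And>x y. x \<in> topspace X \<Longrightarrow> y \<in> topspace X \<Longrightarrow> f x = f y \<longleftrightarrow> g x = g y"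
  shows "Y homeomorphic_space Z"
proof -
  obtain k where k: "continuous_map Y Z k" "\<And>x. x \<in> topspace X \<Longrightarrow> k (f x) = g x"
    using quotient_map_lift_exists[OF f quotient_imp_continuous_map[OF g]] fg by metis
  obtain l where l: "continuous_map Z Y l" "\<And>x. x \<in> topspace X \<Longrightarrow> l (g x) = f x"
    using quotient_map_lift_exists[OF g quotient_imp_continuous_map[OF f]] fg by metis
  have "homeomorphic_maps Y Z k l"
    unfolding homeomorphic_maps_def
    using k l quotient_imp_surjective_map[OF f] quotient_imp_surjective_map[OF g] by force
  then show ?thesis by (auto simp: homeomorphic_space_def)
qed

definition circle_map :: "((nat \<Rightarrow> real) \<Rightarrow> nat \<Rightarrow> real) \<Rightarrow> complex \<Rightarrow> complex" where
  "circle_map \<alpha> = plane \<circ> \<alpha> \<circ> coords"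

lemma continuous_on_circle_map:
  assumes "continuous_map (nsphere 1) (nsphere 1) \<alpha>"
  shows "continuous_on circle (circle_map \<alpha>)" and "circle_map \<alpha> ` circle \<subseteq> circle"
proof -
  have "continuous_map (top_of_set circle) (top_of_set circle) (circle_map \<alpha>)"
    unfolding circle_map_def
    by (intro continuous_map_compose[OF continuous_map_coords] continuous_map_compose[OF assms] continuous_map_plane)
       (simp add: comp_assoc, intro continuous_map_compose[OF continuous_map_coords] continuous_map_compose[OF assms] continuous_map_plane)?
  then show "continuous_on circle (circle_map \<alpha>)" "circle_map \<alpha> ` circle \<subseteq> circle"
    by (auto simp: continuous_map_in_subtopology)
qed

text \<open>The map \<open>F\<close> is a continuous surjection from a compact space to a Hausdorff
  space, hence a quotient map. It has the same fibres as the projection to the mapping cone, so the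
  two quotients agree.\<close>

theorem mapping_cone_homeomorphic:
  assumes \<alpha>: "continuous_map (nsphere 1) (nsphere 1) \<alpha>"
  shows "mapping_cone (nsphere 1) (nsphere 1) \<alpha> homeomorphic_space top_of_set (cone_set (circle_map \<alpha>))"
proof -
  let ?S = "nsphere 1" and ?\<beta> = "circle_map \<alpha>"
  let ?X = "mapping_cone_space ?S ?S"
  let ?Y = "top_of_set (cone_set ?\<beta>)"
  define F where "F p = (case p of Inl (x, t) \<Rightarrow> cone_pt ?\<beta> (plane x, t) | Inr y \<Rightarrow> rim (plane y))"
    for p :: "(nat \<Rightarrow> real) \<times> real + (nat \<Rightarrow> real)"
  have top: "topspace ?X = (topspace ?S \<times> {0..1}) <+> topspace ?S"
    by (simp add: mapping_cone_space_def topspace_disjoint_union_topology)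
  have surj: "F ` topspace ?X = cone_set ?\<beta>"
  proof -
    have 1: "plane ` topspace ?S = circle"
      using plane_in coords_in plane_coords by (metis image_eqI image_subsetI subsetI subset_antisym)
    have "F ` topspace ?X = (\<lambda>(x, t). cone_pt ?\<beta> (plane x, t)) ` (topspace ?S \<times> {0..1}) \<union> (\<lambda>y. rim (plane y)) ` topspace ?S"
      unfolding top Plus_def image_Un image_image F_def by (simp add: split_def)
    also have "(\<lambda>(x, t). cone_pt ?\<beta> (plane x, t)) ` (topspace ?S \<times> {0..1}) = cone_pt ?\<beta> ` (plane ` topspace ?S \<times> {0..1})"
      by (auto simp: image_iff) force+
    also have "(\<lambda>y. rim (plane y)) ` topspace ?S = rim ` plane ` topspace ?S"
      by (simp add: image_image)
    finally show ?thesis unfolding 1 cone_set_def .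
  qed
  have contF: "continuous_map ?X ?Y F"
  proof -
    have l: "continuous_map (prod_topology ?S (top_of_set {0..1})) euclidean (F \<circ> Inl)"
    proof -
      have "continuous_map (prod_topology ?S (top_of_set {0..1})) (top_of_set (circle \<times> {0..1})) (\<lambda>p. (plane (fst p), snd p))"
        unfolding prod_topology_subtopology_eu[symmetric]
        using continuous_map_compose[OF continuous_map_fst continuous_map_plane]
        by (intro continuous_map_pairedI continuous_map_snd) (simp add: comp_def)
      moreover have "continuous_map (top_of_set (circle \<times> {0..1})) euclidean (cone_pt ?\<beta>)"
        using continuous_on_cone_pt[OF continuous_on_circle_map(1)[OF \<alpha>]] by simp
      ultimately have "continuous_map (prod_topology ?S (top_of_set {0..1})) euclidean (cone_pt ?\<beta> \<circ> (\<lambda>p. (plane (fst p), snd p)))"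
        by (rule continuous_map_compose)
      then show ?thesis by (simp add: comp_def F_def split_def)
    qed
    have r: "continuous_map ?S euclidean (F \<circ> Inr)"
    proof -
      have "continuous_map ?S euclidean (rim \<circ> plane)"
        by (rule continuous_map_compose[OF continuous_map_plane]) (simp add: continuous_on_rim)
      then show ?thesis by (simp add: comp_def F_def)
    qed
    have "continuous_map ?X euclidean F"
      unfolding mapping_cone_space_def by (rule continuous_map_disjoint_union[OF l r])
    then show ?thesis using surj by (auto simp: continuous_map_in_subtopology)
  qed
  have "compact_space ?S"
  proof -
    have "compactin ?S (coords ` circle)"
      by (rule image_compactin[OF _ continuous_map_coords]) (simp add: compactin_subtopology)
    moreover have "coords ` circle = topspace ?S"
      using plane_in coords_in coords_plane by (metis image_eqI image_subsetI subsetI subset_antisym)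
    ultimately show ?thesis by (simp add: compact_space_def)
  qed
  then have "compact_space ?X"
    unfolding mapping_cone_space_def
    by (intro compact_space_disjoint_union) (simp_all add: compact_space_prod_topology compact_space_subtopology)
  then have qF: "quotient_map ?X ?Y F"
    by (intro continuous_imp_quotient_map contF) (use surj in \<open>simp_all add: Hausdorff_space_subtopology\<close>)
  have qq: "quotient_map ?X (mapping_cone ?S ?S \<alpha>) (\<lambda>x. cone_rel ?S ?S \<alpha> `` {x})"
    unfolding mapping_cone_def by (rule quotient_map_quotient_topology[OF equiv_cone_rel])
  show ?thesis
  proof (rule quotient_maps_homeomorphic[OF qq qF])
    fix p q assume p: "p \<in> topspace ?X" and q: "q \<in> topspace ?X"
    have \<alpha>im: "\<alpha> x \<in> topspace ?S" if "x \<in> topspace ?S" for x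
      using \<alpha> that by (auto simp: continuous_map_def)
    have inj: "x = y" if "plane x = plane y" "x \<in> topspace ?S" "y \<in> topspace ?S" for x y
      using that coords_plane by metis
    have \<beta>: "?\<beta> (plane x) = plane (\<alpha> x)" if "x \<in> topspace ?S" for x
      using that by (simp add: circle_map_def coords_plane)
    have glue: "F a = F b" if "cone_glue ?S \<alpha> a b" for a b
      using that
      by cases (auto simp: F_def cone_pt_def rim_def \<beta>)
    have 1: "F a = F b" if "equivclp (cone_glue ?S \<alpha>) a b" for a b
      using that by (induction rule: equivclp_induct) (metis glue)+
    have att: "equivclp (cone_glue ?S \<alpha>) (Inl (x, 1)) (Inr (\<alpha> x))" if "x \<in> topspace ?S" for x
      using that by (intro r_into_equivclp cone_glue.attach)
    have col: "equivclp (cone_glue ?S \<alpha>) (Inl (x, 0)) (Inl (y, 0))"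
      if "x \<in> topspace ?S" "y \<in> topspace ?S" for x y
      using that by (intro r_into_equivclp cone_glue.collapse)
    have LR: "equivclp (cone_glue ?S \<alpha>) (Inl (x, t)) (Inr y)"
      if "x \<in> topspace ?S" "y \<in> topspace ?S" "t \<in> {0..1}" "F (Inl (x, t)) = F (Inr y)" for x t y
    proof -
      have "t = 1 \<and> plane y = ?\<beta> (plane x)"
        using that cone_pt_eq_rim_iff[of "plane x" t ?\<beta> "plane y"] plane_in by (simp add: F_def)
      then have "t = 1" "y = \<alpha> x" using that \<beta> inj \<alpha>im by auto
      then show ?thesis using att that by simp
    qed
    have 2: "equivclp (cone_glue ?S \<alpha>) p q" if eq: "F p = F q"
    proof (cases p)
      case (Inl p')
      obtain x s where p': "p = Inl (x, s)" "x \<in> topspace ?S" "s \<in> {0..1}"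
        using Inl p top by (cases p') auto
      show ?thesis
      proof (cases q)
        case (Inl q')
        obtain y t where q': "q = Inl (y, t)" "y \<in> topspace ?S" "t \<in> {0..1}"
          using Inl q top by (cases q') auto
        have "s = t \<and> (s = 0 \<or> s = 1 \<and> ?\<beta> (plane x) = ?\<beta> (plane y) \<or> plane x = plane y)"
        proof -
          have "cone_pt ?\<beta> (plane x, s) = cone_pt ?\<beta> (plane y, t)" using eq p' q' by (simp add: F_def)
          then show ?thesis using cone_pt_eq_iff[of "plane x" "plane y" s t ?\<beta>] plane_in p' q' by blast
        qed
        then consider "s = 0" "t = 0" | "s = 1" "t = 1" "\<alpha> x = \<alpha> y" | "s = t" "x = y"
          using p' q' \<beta> inj \<alpha>im by metis
        then show ?thesis
        proof cases
          case 1
          then show ?thesis using p' q' col by simp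
        next
          case 2
          then show ?thesis using p' q' att[of x] att[of y] by (metis equivclp_sym equivclp_trans)
        next
          case 3
          then show ?thesis using p' q' by simp
        qed
      next
        case (Inr y)
        then show ?thesis using LR[of x y s] p' q eq top by auto
      qed
    next
      case (Inr x)
      show ?thesis
      proof (cases q)
        case (Inl q')
        obtain y t where q': "q = Inl (y, t)" "y \<in> topspace ?S" "t \<in> {0..1}"
          using Inl q top by (cases q') auto
        then show ?thesis using LR[of y x t] Inr p eq top by (auto intro: equivclp_sym)
      next
        case (Inr y)
        have "x = y" using eq \<open>p = Inr x\<close> Inr p q top by (auto simp: F_def dest!: inj)
        then show ?thesis using \<open>p = Inr x\<close> Inr by simp
      qed
    qed
    have "cone_rel ?S ?S \<alpha> `` {p} = cone_rel ?S ?S \<alpha> `` {q} \<longleftrightarrow> (p, q) \<in> cone_rel ?S ?S \<alpha>"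
      using eq_equiv_class_iff[OF equiv_cone_rel p q] .
    also have "\<dots> \<longleftrightarrow> equivclp (cone_glue ?S \<alpha>) p q"
      using p q by (simp add: cone_rel_def)
    also have "\<dots> \<longleftrightarrow> F p = F q" using 1 2 by blast
    finally show "cone_rel ?S ?S \<alpha> `` {p} = cone_rel ?S ?S \<alpha> `` {q} \<longleftrightarrow> F p = F q" .
  qed
qed

section \<open>Maps out of the cone, and homotopic attaching maps\<close>

text \<open>A continuous map from a compact space to a Hausdorff space is closed, so continuity
  descends along it.\<close>

lemma continuous_on_compact_image:
  fixes q :: "'a::topological_space \<Rightarrow> 'b::t2_space"
  assumes "compact K" "continuous_on K q" "continuous_on K (\<lambda>x. f (q x))"
  shows "continuous_on (q ` K) f"
  unfolding continuous_on_closed_invariant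
proof (intro allI impI)
  fix B :: "'c set" assume B: "closed B"
  obtain A where A: "closed A" "A \<inter> K = (\<lambda>x. f (q x)) -` B \<inter> K"
    using assms(3) B unfolding continuous_on_closed_invariant by metis
  have "compact (q ` (A \<inter> K))"
    using assms(1,2) A(1) by (intro compact_continuous_image) (auto intro: continuous_on_subset compact_Int_closed simp: Int_commute)
  moreover have "q ` (A \<inter> K) \<inter> q ` K = f -` B \<inter> q ` K"
    unfolding A(2) by auto
  ultimately show "\<exists>A. closed A \<and> A \<inter> q ` K = f -` B \<inter> q ` K"
    by (blast intro: compact_imp_closed)
qed

text \<open>The universal property of the cone, with a compact parameter space:
  \<open>P = {0}\<close> yields maps and \<open>P = {0..1}\<close> yields homotopies.\<close>

lemma cone_set_extend:
  fixes \<Phi> :: "(complex \<times> real) \<times> 'p::t2_space \<Rightarrow> 'z::topological_space"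
  assumes \<beta>: "continuous_on circle \<beta>" and P: "compact P"
    and \<Phi>: "continuous_on ((circle \<times> {0..1}) \<times> P) \<Phi>"
    and \<Psi>: "continuous_on (circle \<times> P) \<Psi>"
    and apex: "\<And>x y p. x \<in> circle \<Longrightarrow> y \<in> circle \<Longrightarrow> p \<in> P \<Longrightarrow> \<Phi> ((x, 0), p) = \<Phi> ((y, 0), p)"
    and base: "\<And>x p. x \<in> circle \<Longrightarrow> p \<in> P \<Longrightarrow> \<Phi> ((x, 1), p) = \<Psi> (\<beta> x, p)"
  obtains f where "continuous_on (cone_set \<beta> \<times> P) f"
    and "\<And>x t p. x \<in> circle \<Longrightarrow> t \<in> {0..1} \<Longrightarrow> p \<in> P \<Longrightarrow> f (cone_pt \<beta> (x, t), p) = \<Phi> ((x, t), p)"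
    and "\<And>u p. u \<in> circle \<Longrightarrow> p \<in> P \<Longrightarrow> f (rim u, p) = \<Psi> (u, p)"
proof -
  let ?A = "cone_pt \<beta> ` (circle \<times> {0..1})" and ?B = "rim ` circle"
  define f where "f y = (if fst y \<in> ?B then \<Psi> (fst (fst y), snd y)
     else \<Phi> (SOME q. q \<in> circle \<times> {0..1} \<and> cone_pt \<beta> q = fst y, snd y))" for y
  have fB: "f (rim u, p) = \<Psi> (u, p)" if "u \<in> circle" for u p
    using that by (simp add: f_def) (simp add: rim_def)
  have fA: "f (cone_pt \<beta> (x, t), p) = \<Phi> ((x, t), p)" if x: "x \<in> circle" "t \<in> {0..1}" "p \<in> P" for x t p
  proof (cases "t = 1")
    case True
    have e: "cone_pt \<beta> (x, 1) = rim (\<beta> x)" using x cone_pt_eq_rim_iff[of x 1] by simp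
    show ?thesis
    proof (cases "\<beta> x \<in> circle")
      case True
      then show ?thesis using e fB base x \<open>t = 1\<close> by simp
    next
      \<comment> \<open>The end of the cone line misses the rim here, so \<open>f\<close> picks some
        preimage; all candidates have parameter 1 and the same image under \<open>\<beta>\<close>,
        and \<open>base\<close> shows that the choice does not matter.\<close>
      case False
      then have nB: "cone_pt \<beta> (x, 1) \<notin> ?B" using e by auto
      let ?q = "SOME q. q \<in> circle \<times> {0..1} \<and> cone_pt \<beta> q = cone_pt \<beta> (x, 1)"
      have "?q \<in> circle \<times> {0..1} \<and> cone_pt \<beta> ?q = cone_pt \<beta> (x, 1)"
        by (rule someI[where x = "(x, 1)"]) (use x in auto)
      then obtain y where y: "?q = (y, 1)" "y \<in> circle" "\<beta> y = \<beta> x"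
        using x by (cases ?q) (auto simp: cone_pt_eq_iff)
      then show ?thesis using nB base[of y p] base[of x p] x \<open>t = 1\<close> by (simp add: f_def)
    qed
  next
    case False
    then have nB: "cone_pt \<beta> (x, t) \<notin> ?B" using x by (auto simp: cone_pt_eq_rim_iff)
    let ?q = "SOME q. q \<in> circle \<times> {0..1} \<and> cone_pt \<beta> q = cone_pt \<beta> (x, t)"
    have "?q \<in> circle \<times> {0..1} \<and> cone_pt \<beta> ?q = cone_pt \<beta> (x, t)"
      by (rule someI[where x = "(x, t)"]) (use x in auto)
    then obtain y s where y: "?q = (y, s)" "y \<in> circle" "s = t" "t = 0 \<or> y = x"
      using x False by (cases ?q) (auto simp: cone_pt_eq_iff)
    then show ?thesis using nB apex[of y x p] x by (auto simp: f_def)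
  qed
  have cA: "continuous_on (?A \<times> P) f"
  proof -
    have im: "?A \<times> P = (\<lambda>q. (cone_pt \<beta> (fst q), snd q)) ` ((circle \<times> {0..1}) \<times> P)"
      by (auto simp: image_iff) force
    show ?thesis unfolding im
    proof (rule continuous_on_compact_image)
      show "compact ((circle \<times> {0..1::real}) \<times> P)" by (intro compact_Times P) auto
      show "continuous_on ((circle \<times> {0..1}) \<times> P) (\<lambda>q. (cone_pt \<beta> (fst q), snd q))"
        by (intro continuous_intros continuous_on_compose2[OF continuous_on_cone_pt[OF \<beta>]]) auto
      show "continuous_on ((circle \<times> {0..1}) \<times> P) (\<lambda>x. f (cone_pt \<beta> (fst x), snd x))"
        using \<Phi> by (rule continuous_on_eq) (auto simp: fA)
    qed
  qed
  have cB: "continuous_on (?B \<times> P) f"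
  proof (rule continuous_on_eq)
    show "continuous_on (?B \<times> P) (\<lambda>y. \<Psi> (fst (fst y), snd y))"
      by (rule continuous_on_compose2[OF \<Psi>]) (auto intro!: continuous_intros simp: rim_def)
  qed (auto simp: fB, auto simp: rim_def)
  have "compact ?A" "compact ?B"
    by (intro compact_continuous_image continuous_on_cone_pt[OF \<beta>] continuous_on_rim compact_Times; simp)+
  then have "continuous_on (?A \<times> P \<union> ?B \<times> P) f"
    by (intro continuous_on_closed_Un cA cB compact_imp_closed compact_Times P)
  then have "continuous_on (cone_set \<beta> \<times> P) f"
    by (simp add: cone_set_def Sigma_Un_distrib1)
  then show thesis using that fA fB by blast
qed

lemma cone_set_cases:
  assumes "y \<in> cone_set \<beta>"
  obtains x t where "x \<in> circle" "t \<in> {0..1}" "y = cone_pt \<beta> (x, t)" | u where "u \<in> circle" "y = rim u"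
  using assms by (auto simp: cone_set_def)

lemma cone_pt_1: "cone_pt \<beta> (x, 1) = rim (\<beta> x)"
  by (simp add: cone_pt_def rim_def)

text \<open>The comparison maps \<open>mid\<close> run through the whole cone line on the inner half
  and through the homotopy on the outer half. The composite of both runs through the cone line at
  speed 4, which is the value of \<open>1 + 3 * \<tau>\<close> at the end of the homotopy
  \<open>G\<close>.\<close>

lemma cone_set_homotopic:
  assumes \<beta>: "continuous_on circle \<beta>" "\<beta> ` circle \<subseteq> circle" and \<gamma>: "continuous_on circle \<gamma>" "\<gamma> ` circle \<subseteq> circle"
    and H: "continuous_on (circle \<times> {0..1}) H" "H ` (circle \<times> {0..1}) \<subseteq> circle"
    and H0: "\<And>x. x \<in> circle \<Longrightarrow> H (x, 0::real) = \<beta> x" and H1: "\<And>x. x \<in> circle \<Longrightarrow> H (x, 1) = \<gamma> x"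
    and "TC_le (cone_set \<gamma>) n"
  shows "TC_le (cone_set \<beta>) n"
proof -
  define mid where "mid \<delta> h q = (if 2 * snd q \<le> 1 then cone_pt \<delta> (fst q, 2 * snd q) else rim (h (fst q, 2 * snd q - 1)))"
    for \<delta> and h :: "complex \<times> real \<Rightarrow> complex" and q :: "complex \<times> real"
  have mid_cont: "continuous_on (circle \<times> {0..1}) (mid \<delta> h)"
    if d: "continuous_on circle \<delta>" and h: "continuous_on (circle \<times> {0..1}) h" and e: "\<And>x. x \<in> circle \<Longrightarrow> h (x, 0) = \<delta> x" for \<delta> h
  proof -
    have U: "circle \<times> {0..1} = circle \<times> {0..1/2} \<union> circle \<times> {1/2..1::real}" by auto
    show ?thesis unfolding U mid_def
    proof (rule continuous_on_cases)
      show "closed (circle \<times> {0..1/2::real})" "closed (circle \<times> {1/2..1::real})"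
        by (intro closed_Times; simp)+
      show "continuous_on (circle \<times> {0..1 / 2}) (\<lambda>q. cone_pt \<delta> (fst q, 2 * snd q))"
        by (rule continuous_on_compose2[OF continuous_on_cone_pt[OF d]]) (auto intro!: continuous_intros)
      show "continuous_on (circle \<times> {1 / 2..1}) (\<lambda>q. rim (h (fst q, 2 * snd q - 1)))"
        by (intro continuous_on_compose2[OF continuous_on_rim[of UNIV]] continuous_on_compose2[OF h]) (auto intro!: continuous_intros)
      show "\<forall>q. q \<in> circle \<times> {0..1 / 2} \<and> \<not> 2 * snd q \<le> 1 \<or> q \<in> circle \<times> {1 / 2..1} \<and> 2 * snd q \<le> 1 \<longrightarrow>
        cone_pt \<delta> (fst q, 2 * snd q) = rim (h (fst q, 2 * snd q - 1))"
      proof (intro allI impI)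
        fix q :: "complex \<times> real"
        assume "q \<in> circle \<times> {0..1 / 2} \<and> \<not> 2 * snd q \<le> 1 \<or> q \<in> circle \<times> {1 / 2..1} \<and> 2 * snd q \<le> 1"
        then have "fst q \<in> circle" "2 * snd q = 1" by auto
        then show "cone_pt \<delta> (fst q, 2 * snd q) = rim (h (fst q, 2 * snd q - 1))"
          by (simp add: cone_pt_1 e)
      qed
    qed
  qed
  let ?Hr = "\<lambda>q. H (fst q, 1 - snd q)"
  have Hr: "continuous_on (circle \<times> {0..1}) ?Hr"
    by (rule continuous_on_compose2[OF H(1)]) (auto intro!: continuous_intros)
  have Hin: "H (x, t) \<in> circle" if "x \<in> circle" "t \<in> {0..1}" for x t using H(2) that by blast
  obtain f where f: "continuous_on (cone_set \<beta> \<times> {0}) f"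
    "\<And>x t p. x \<in> circle \<Longrightarrow> t \<in> {0..1} \<Longrightarrow> p \<in> {0::real} \<Longrightarrow> f (cone_pt \<beta> (x, t), p) = mid \<gamma> ?Hr (x, t)"
    "\<And>u p. u \<in> circle \<Longrightarrow> p \<in> {0::real} \<Longrightarrow> f (rim u, p) = rim u"
  proof (rule cone_set_extend[OF \<beta>(1), where P = "{0::real}" and \<Phi> = "\<lambda>q. mid \<gamma> ?Hr (fst q)" and \<Psi> = "\<lambda>q. rim (fst q)"])
    show "continuous_on ((circle \<times> {0..1}) \<times> {0::real}) (\<lambda>q. mid \<gamma> ?Hr (fst q))"
      by (rule continuous_on_compose2[OF mid_cont[OF \<gamma>(1) Hr]]) (auto intro!: continuous_intros simp: H1)
    show "continuous_on (circle \<times> {0::real}) (\<lambda>q. rim (fst q))"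
      by (rule continuous_on_compose2[OF continuous_on_rim[of UNIV]]) (auto intro!: continuous_intros)
  qed (auto simp: mid_def H0 cone_pt_def)
  obtain g where g: "continuous_on (cone_set \<gamma> \<times> {0}) g"
    "\<And>x t p. x \<in> circle \<Longrightarrow> t \<in> {0..1} \<Longrightarrow> p \<in> {0::real} \<Longrightarrow> g (cone_pt \<gamma> (x, t), p) = mid \<beta> H (x, t)"
    "\<And>u p. u \<in> circle \<Longrightarrow> p \<in> {0::real} \<Longrightarrow> g (rim u, p) = rim u"
  proof (rule cone_set_extend[OF \<gamma>(1), where P = "{0::real}" and \<Phi> = "\<lambda>q. mid \<beta> H (fst q)" and \<Psi> = "\<lambda>q. rim (fst q)"])
    show "continuous_on ((circle \<times> {0..1}) \<times> {0::real}) (\<lambda>q. mid \<beta> H (fst q))"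
      by (rule continuous_on_compose2[OF mid_cont[OF \<beta>(1) H(1)]]) (auto intro!: continuous_intros simp: H0)
    show "continuous_on (circle \<times> {0::real}) (\<lambda>q. rim (fst q))"
      by (rule continuous_on_compose2[OF continuous_on_rim[of UNIV]]) (auto intro!: continuous_intros)
  qed (auto simp: mid_def H1 cone_pt_def)
  text \<open>The homotopy runs out along the cone line of \<open>x\<close>, then along \<open>H (x, _)\<close> and back again.\<close>
  define G where "G q = (let x = fst (fst q); t = snd (fst q); \<tau> = snd q in
     if t * (1 + 3 * \<tau>) \<le> 1 then cone_pt \<beta> (x, t * (1 + 3 * \<tau>))
     else rim (H (x, min (t * (1 + 3 * \<tau>) - 1) (2 - 2 * t))))" for q :: "(complex \<times> real) \<times> real"
  have minI: "min (t * (1 + 3 * p) - 1) (2 - 2 * t) \<le> 1"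
    if "t \<in> {0..1}" "p \<in> {0..1}" for t p :: real
  proof -
    have "t * (1 + 3 * p) \<le> t * 4" using that by (intro mult_left_mono) auto
    then show ?thesis by (simp add: min_def)
  qed
  obtain K where K: "continuous_on (cone_set \<beta> \<times> {0..1}) K"
    "\<And>x t p. x \<in> circle \<Longrightarrow> t \<in> {0..1} \<Longrightarrow> p \<in> {0..1::real} \<Longrightarrow> K (cone_pt \<beta> (x, t), p) = G ((x, t), p)"
    "\<And>u p. u \<in> circle \<Longrightarrow> p \<in> {0..1::real} \<Longrightarrow> K (rim u, p) = rim u"
  proof (rule cone_set_extend[OF \<beta>(1), where P = "{0..1::real}" and \<Phi> = G and \<Psi> = "\<lambda>q. rim (fst q)"])
    let ?D = "(circle \<times> {0..1::real}) \<times> {0..1::real}"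
    let ?r = "\<lambda>q::(complex \<times> real) \<times> real. snd (fst q) * (1 + 3 * snd q)"
    have c: "continuous_on UNIV ?r" by (intro continuous_intros)
    have U: "?D = ?D \<inter> ?r -` {..1} \<union> ?D \<inter> ?r -` {1..}" by auto
    have cl: "closed ?D" by (intro closed_Times; simp)
    show "continuous_on ?D G"
      unfolding G_def Let_def
      apply (subst U)
    proof (rule continuous_on_cases)
      show "closed (?D \<inter> ?r -` {..1})" "closed (?D \<inter> ?r -` {1..})"
        by (intro closed_Int cl closed_vimage c closed_atMost closed_atLeast)+
      show "continuous_on (?D \<inter> ?r -` {..1}) (\<lambda>q. cone_pt \<beta> (fst (fst q), ?r q))"
        by (rule continuous_on_compose2[OF continuous_on_cone_pt[OF \<beta>(1)]]) (auto intro!: continuous_intros)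
      show "continuous_on (?D \<inter> ?r -` {1..}) (\<lambda>q. rim (H (fst (fst q), min (?r q - 1) (2 - 2 * snd (fst q)))))"
        by (intro continuous_on_compose2[OF continuous_on_rim[of UNIV]] continuous_on_compose2[OF H(1)])
          (auto intro!: continuous_intros continuous_on_min minI simp del: min_le_iff_disj)
      show "\<forall>q. q \<in> ?D \<inter> ?r -` {..1} \<and> \<not> ?r q \<le> 1 \<or> q \<in> ?D \<inter> ?r -` {1..} \<and> ?r q \<le> 1 \<longrightarrow>
        cone_pt \<beta> (fst (fst q), ?r q) = rim (H (fst (fst q), min (?r q - 1) (2 - 2 * snd (fst q))))"
      proof (intro allI impI)
        fix q
        assume "q \<in> ?D \<inter> ?r -` {..1} \<and> \<not> ?r q \<le> 1 \<or> q \<in> ?D \<inter> ?r -` {1..} \<and> ?r q \<le> 1"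
        then have q: "fst (fst q) \<in> circle" "?r q = 1" "snd (fst q) \<le> 1" by auto
        then have "min (?r q - 1) (2 - 2 * snd (fst q)) = 0" by simp
        then show "cone_pt \<beta> (fst (fst q), ?r q) = rim (H (fst (fst q), min (?r q - 1) (2 - 2 * snd (fst q))))"
          using q by (simp only: cone_pt_1 H0)
      qed
    qed
    show "continuous_on (circle \<times> {0..1::real}) (\<lambda>q. rim (fst q))"
      by (rule continuous_on_compose2[OF continuous_on_rim[of UNIV]]) (auto intro!: continuous_intros)
    show "G ((x, 1), p) = rim (fst (\<beta> x, p))" if "x \<in> circle" "p \<in> {0..1}" for x p
    proof (cases "p = 0")
      case True
      then show ?thesis by (simp add: G_def cone_pt_1)
    next
      case False
      then have "\<not> 1 + 3 * p \<le> 1" using that by auto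
      then show ?thesis using that by (simp add: G_def H0 min_def)
    qed
  qed (auto simp: G_def cone_pt_def)
  show ?thesis
  proof (rule TC_le_dominated[where f = "\<lambda>y. f (y, 0)" and g = "\<lambda>y. g (y, 0)" and H = K])
    show "continuous_on (cone_set \<beta>) (\<lambda>y. f (y, 0))" "continuous_on (cone_set \<gamma>) (\<lambda>y. g (y, 0))"
      by (intro continuous_on_compose2[OF f(1)] continuous_on_compose2[OF g(1)] continuous_intros; auto)+
    have pt: "cone_pt \<delta> (x, t) \<in> cone_set \<delta>" if "x \<in> circle" "t \<in> {0..1}" for \<delta> x t
      using that by (auto simp: cone_set_def)
    have rm: "rim u \<in> cone_set \<delta>" if "u \<in> circle" for \<delta> u
      using that by (auto simp: cone_set_def)
    show "(\<lambda>y. f (y, 0)) ` cone_set \<beta> \<subseteq> cone_set \<gamma>"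
    proof (intro image_subsetI)
      fix y assume "y \<in> cone_set \<beta>"
      then show "f (y, 0) \<in> cone_set \<gamma>"
        by (cases rule: cone_set_cases) (auto simp: f mid_def intro!: pt rm Hin)
    qed
    show "(\<lambda>y. g (y, 0)) ` cone_set \<gamma> \<subseteq> cone_set \<beta>"
    proof (intro image_subsetI)
      fix y assume "y \<in> cone_set \<gamma>"
      then show "g (y, 0) \<in> cone_set \<beta>"
        by (cases rule: cone_set_cases) (auto simp: g mid_def intro!: pt rm Hin)
    qed
    show "continuous_on (cone_set \<beta> \<times> {0..1}) K" by (rule K)
    show "K ` (cone_set \<beta> \<times> {0..1}) \<subseteq> cone_set \<beta>"
    proof
      fix z assume "z \<in> K ` (cone_set \<beta> \<times> {0..1})"
      then obtain y p where z: "z = K (y, p)" "y \<in> cone_set \<beta>" "p \<in> {0..1}" by auto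
      from z(2) show "z \<in> cone_set \<beta>"
      proof (cases rule: cone_set_cases)
        case (1 x t)
        then show ?thesis
          using z minI[of t p] by (auto simp: K G_def Let_def simp del: min_le_iff_disj intro!: pt rm Hin)
      next
        case (2 u)
        then show ?thesis using z by (auto simp: K intro!: rm)
      qed
    qed
    fix y assume "y \<in> cone_set \<beta>"
    then show "K (y, 0) = y"
      by (cases rule: cone_set_cases) (auto simp: K G_def)
    from \<open>y \<in> cone_set \<beta>\<close> show "K (y, 1) = g (f (y, 0), 0)"
    proof (cases rule: cone_set_cases)
      case (1 x t)
      show ?thesis
      \<comment> \<open>At \<open>t = 1 / 2\<close> the bounds \<open>4 * t - 1\<close> and
        \<open>2 - 2 * t\<close> coincide: this is where the composite turns back along
        \<open>H\<close>.\<close>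
      proof (cases "2 * t \<le> 1")
        case True
        have "f (y, 0) = cone_pt \<gamma> (x, 2 * t)" using 1 True by (simp add: f mid_def)
        then have "g (f (y, 0), 0) = mid \<beta> H (x, 2 * t)" using 1 True g(2)[of x "2 * t" 0] by simp
        then show ?thesis using 1 True by (simp add: K G_def mid_def min_def mult.commute)
      next
        case False
        have "f (y, 0) = rim (H (x, 2 - 2 * t))" using 1 False by (simp add: f mid_def)
        then have "g (f (y, 0), 0) = rim (H (x, 2 - 2 * t))" using 1 False g(3)[OF Hin[of x "2 - 2 * t"], of 0] by simp
        moreover have "min (t * 4 - 1) (2 - 2 * t) = 2 - 2 * t" using False by simp
        ultimately show ?thesis using 1 False by (simp add: K G_def)
      qed
    next
      case (2 u)
      then show ?thesis by (simp add: K f g)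
    qed
  qed (rule assms)
qed

section \<open>Degrees of maps of the circle\<close>

definition frag_eval :: "('a \<Rightarrow> real) \<Rightarrow> ('a \<Rightarrow>\<^sub>0 int) \<Rightarrow> real" where
  "frag_eval L c = (\<Sum>s\<in>Poly_Mapping.keys c. of_int (poly_mapping.lookup c s) * L s)"

lemma frag_eval_superset:
  assumes "finite A" "Poly_Mapping.keys c \<subseteq> A"
  shows "frag_eval L c = (\<Sum>s\<in>A. of_int (poly_mapping.lookup c s) * L s)"
  unfolding frag_eval_def by (rule sum.mono_neutral_left[OF assms]) (auto simp: in_keys_iff)

lemma frag_eval_diff: "frag_eval L (a - b) = frag_eval L a - frag_eval L b"
proof -
  let ?A = "Poly_Mapping.keys a \<union> Poly_Mapping.keys b"
  have "Poly_Mapping.keys (a - b) \<subseteq> ?A" by (rule keys_diff)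
  then show ?thesis
    by (simp add: frag_eval_superset[of ?A] lookup_minus left_diff_distrib sum_subtractf)
qed

lemma frag_eval_of [simp]: "frag_eval L (frag_of s) = L s"
  by (simp add: frag_eval_def)

lemma frag_eval_0 [simp]: "frag_eval L 0 = 0"
  by (simp add: frag_eval_def)

lemma frag_eval_uminus: "frag_eval L (- a) = - frag_eval L a"
  using frag_eval_diff[of L 0 a] by simp

lemma frag_eval_add: "frag_eval L (a + b) = frag_eval L a + frag_eval L b"
  using frag_eval_diff[of L a "- b"] by (simp add: frag_eval_uminus)

text \<open>Two angle functions differ by a continuous function whose values are multiples of
  \<open>2 * pi\<close>, hence by a constant.\<close>

lemma cis_lift_increment_unique:
  assumes "continuous_on {0..1} \<theta>" "continuous_on {0..1} \<phi>" "\<And>u. u \<in> {0..1::real} \<Longrightarrow> cis (\<theta> u) = cis (\<phi> u)"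
  shows "\<theta> 1 - \<theta> 0 = \<phi> 1 - \<phi> 0"
proof -
  let ?\<delta> = "\<lambda>u. \<theta> u - \<phi> u"
  have int: "\<exists>k::int. ?\<delta> u = 2 * pi * k" if "u \<in> {0..1}" for u
  proof -
    have c: "cis (?\<delta> u) = 1" using assms(3)[OF that] by (simp flip: cis_divide)
    have "cos (?\<delta> u) = 1" using arg_cong[OF c, of Re] by simp
    then obtain k :: int where "?\<delta> u = of_int k * 2 * pi" using cos_one_2pi_int by blast
    then show ?thesis by (intro exI[of _ k]) simp
  qed
  have "?\<delta> constant_on {0..1}"
  proof (rule continuous_discrete_range_constant)
    show "connected {0..1::real}" "continuous_on {0..1} ?\<delta>"
      using assms by (auto intro: continuous_intros)
    fix x :: real assume x: "x \<in> {0..1}"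
    show "\<exists>e>0. \<forall>y. y \<in> {0..1} \<and> ?\<delta> y \<noteq> ?\<delta> x \<longrightarrow> e \<le> norm (?\<delta> y - ?\<delta> x)"
    proof (intro exI[of _ "2 * pi"] conjI allI impI)
      fix y assume y: "y \<in> {0..1} \<and> ?\<delta> y \<noteq> ?\<delta> x"
      obtain k l :: int where kl: "?\<delta> x = 2 * pi * k" "?\<delta> y = 2 * pi * l" using int x y by blast
      then have "\<bar>real_of_int (l - k)\<bar> \<ge> 1" using y by (simp del: of_int_diff) linarith
      then have "2 * pi * 1 \<le> 2 * pi * \<bar>real_of_int (l - k)\<bar>" by (intro mult_left_mono) auto
      also have "\<dots> = norm (?\<delta> y - ?\<delta> x)"
        unfolding kl by (simp add: abs_mult flip: right_diff_distrib)
      finally show "2 * pi \<le> norm (?\<delta> y - ?\<delta> x)" by simp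
    qed simp
  qed
  then have "?\<delta> 1 = ?\<delta> 0" unfolding constant_on_def by force
  then show ?thesis by simp
qed

definition edge :: "real \<Rightarrow> nat \<Rightarrow> real" where
  "edge u = (\<lambda>i. if i = 0 then 1 - u else if i = 1 then u else 0)"

definition angle_lift :: "((nat \<Rightarrow> real) \<Rightarrow> nat \<Rightarrow> real) \<Rightarrow> (real \<Rightarrow> real) \<Rightarrow> bool" where
  "angle_lift s \<theta> \<longleftrightarrow> continuous_on {0..1} \<theta> \<and> (\<forall>u\<in>{0..1}. plane (s (edge u)) = cis (\<theta> u))"

definition turning :: "((nat \<Rightarrow> real) \<Rightarrow> nat \<Rightarrow> real) \<Rightarrow> real" where
  "turning s = (SOME r. \<exists>\<theta>. angle_lift s \<theta> \<and> r = \<theta> 1 - \<theta> 0)"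

lemma turning_eq: "angle_lift s \<theta> \<Longrightarrow> turning s = \<theta> 1 - \<theta> 0"
  unfolding turning_def
  by (rule some_equality) (auto simp: angle_lift_def intro!: cis_lift_increment_unique)

lemma edge_in: "u \<in> {0..1} \<Longrightarrow> edge u \<in> standard_simplex 1"
  by (auto simp: standard_simplex_def edge_def)

definition tri :: "real \<times> real \<Rightarrow> nat \<Rightarrow> real" where
  "tri p = (\<lambda>i. if i = 0 then 1 - fst p - snd p else if i = 1 then fst p else if i = 2 then snd p else 0)"

abbreviation "tri_dom \<equiv> {p :: real \<times> real. 0 \<le> fst p \<and> 0 \<le> snd p \<and> fst p + snd p \<le> 1}"

lemma atMost_2: "{..2::nat} = {0, 1, 2}" by auto

lemma tri_in: "p \<in> tri_dom \<Longrightarrow> tri p \<in> standard_simplex 2"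
  by (auto simp: standard_simplex_def tri_def atMost_2)

lemma continuous_map_tri: "continuous_map (top_of_set tri_dom) (subtopology (powertop_real UNIV) (standard_simplex 2)) tri"
  unfolding continuous_map_in_subtopology continuous_map_componentwise_UNIV
proof
  show "\<forall>k. continuous_map (top_of_set tri_dom) euclideanreal (\<lambda>x. tri x k)"
  proof
    fix k :: nat
    consider "k = 0" | "k = 1" | "k = 2" | "k > 2" by linarith
    then show "continuous_map (top_of_set tri_dom) euclideanreal (\<lambda>x. tri x k)"
      by cases (simp_all add: tri_def continuous_intros)
  qed
  show "tri \<in> topspace (top_of_set tri_dom) \<rightarrow> standard_simplex 2"
    using tri_in by simp
qed

text \<open>A triangle is contractible, so one angle function exists on all of it; its increments
  along the three edges cancel.\<close>

lemma turning_boundary: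
  assumes "singular_simplex 2 (nsphere 1) T"
  shows "frag_eval turning (chain_boundary 2 (frag_of T)) = 0"
proof -
  have T: "continuous_map (subtopology (powertop_real UNIV) (standard_simplex 2)) (nsphere 1) T"
    using assms by (simp add: singular_simplex_def)
  have "continuous_map (top_of_set tri_dom) (top_of_set circle) (plane \<circ> (T \<circ> tri))"
    by (intro continuous_map_compose[OF continuous_map_compose[OF continuous_map_tri T] continuous_map_plane])
  then have c: "continuous_on tri_dom (\<lambda>p. plane (T (tri p)))" and im: "\<And>p. p \<in> tri_dom \<Longrightarrow> plane (T (tri p)) \<in> circle"
    by (auto simp: continuous_map_in_subtopology comp_def)
  have conv: "convex tri_dom"
  proof (rule convexI)
    fix x y :: "real \<times> real" and u v :: real
    assume *: "x \<in> tri_dom" "y \<in> tri_dom" "0 \<le> u" "0 \<le> v" "u + v = 1"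
    then have "u * (fst x + snd x) + v * (fst y + snd y) \<le> 1"
      by (intro convex_bound_le) auto
    then show "u *\<^sub>R x + v *\<^sub>R y \<in> tri_dom"
      using * by (simp add: algebra_simps)
  qed
  obtain g where g: "continuous_on tri_dom g" "\<And>p. p \<in> tri_dom \<Longrightarrow> plane (T (tri p)) = exp (g p)"
    by (rule continuous_logarithm_on_contractible[OF c convex_imp_contractible[OF conv]]) (use im in force)+
  define \<theta> where "\<theta> p = Im (g p)" for p
  have \<theta>: "continuous_on tri_dom \<theta>" unfolding \<theta>_def by (intro continuous_intros g)
  have cis: "plane (T (tri p)) = cis (\<theta> p)" if "p \<in> tri_dom" for p
  proof -
    have "norm (exp (g p)) = 1" using im[OF that] g(2)[OF that] by simp
    then have "Re (g p) = 0" by simp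
    then show ?thesis unfolding g(2)[OF that] \<theta>_def by (subst exp_eq_polar) simp
  qed
  have f0: "simplical_face 0 (edge u) = tri (1 - u, u)" for u
    by (auto simp: simplical_face_def edge_def tri_def fun_eq_iff)
  have f1: "simplical_face 1 (edge u) = tri (0, u)" for u
    by (auto simp: simplical_face_def edge_def tri_def fun_eq_iff)
  have f2: "simplical_face 2 (edge u) = tri (u, 0)" for u
    by (auto simp: simplical_face_def edge_def tri_def fun_eq_iff)
  have "angle_lift (singular_face 2 0 T) (\<lambda>u. \<theta> (1 - u, u))"
    "angle_lift (singular_face 2 1 T) (\<lambda>u. \<theta> (0, u))"
    "angle_lift (singular_face 2 2 T) (\<lambda>u. \<theta> (u, 0))"
    unfolding angle_lift_def singular_face_def
    using edge_in f0 f1 f2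
    by (auto intro!: continuous_on_compose2[OF \<theta>] continuous_intros simp: cis)
  note turn = this[THEN turning_eq]
  have b: "chain_boundary 2 (frag_of T) =
     frag_of (singular_face 2 0 T) - frag_of (singular_face 2 1 T) + frag_of (singular_face 2 2 T)"
    by (simp add: chain_boundary_of atMost_2)
  show ?thesis unfolding b frag_eval_add frag_eval_diff frag_eval_of turn by simp
qed

text \<open>Makes the turning an invariant of homology classes, used to see that the standard loop
  is not a boundary.\<close>

lemma turning_relboundary:
  assumes "singular_relboundary 1 (nsphere 1) {} c"
  shows "frag_eval turning c = 0"
proof -
  obtain d where d: "singular_chain 2 (nsphere 1) d" "chain_boundary 2 d = c"
    using assms unfolding singular_boundary by (auto simp: numeral_2_eq_2)
  have "Poly_Mapping.keys d \<subseteq> singular_simplex_set 2 (nsphere 1)" using d(1) by (simp add: singular_chain_def)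
  then have "frag_eval turning (chain_boundary 2 d) = 0"
  proof (induction d rule: frag_induction)
    case zero
    then show ?case by simp
  next
    case (one x)
    then show ?case by (simp add: turning_boundary)
  next
    case (diff a b)
    then show ?case by (simp add: chain_boundary_diff frag_eval_diff)
  qed
  then show ?thesis using d by simp
qed

section \<open>Standard loops and the degree of power maps\<close>

definition loop_simplex :: "int \<Rightarrow> (nat \<Rightarrow> real) \<Rightarrow> nat \<Rightarrow> real" where
  "loop_simplex m = restrict (\<lambda>x. coords (cis (2 * pi * (of_int m * x 1)))) (standard_simplex 1)"

lemma continuous_map_coords_cis:
  assumes "continuous_map X euclideanreal f"
  shows "continuous_map X (nsphere 1) (\<lambda>x. coords (cis (f x)))"
proof -
  have "continuous_map euclideanreal (top_of_set circle) cis"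
    by (auto simp: continuous_map_in_subtopology intro!: continuous_intros)
  then have "continuous_map X (nsphere 1) (coords \<circ> (cis \<circ> f))"
    by (intro continuous_map_compose[OF continuous_map_compose[OF assms] continuous_map_coords])
  then show ?thesis by (simp add: comp_def)
qed

lemma singular_simplex_coords_cis:
  assumes "continuous_map (powertop_real UNIV) euclideanreal f"
  shows "singular_simplex p (nsphere 1) (restrict (\<lambda>x. coords (cis (f x))) (standard_simplex p))"
  unfolding singular_simplex_def
proof
  have "continuous_map (subtopology (powertop_real UNIV) (standard_simplex p)) (nsphere 1) (\<lambda>x. coords (cis (f x)))"
    by (intro continuous_map_coords_cis continuous_map_from_subtopology assms)
  then show "continuous_map (subtopology (powertop_real UNIV) (standard_simplex p)) (nsphere 1)
     (restrict (\<lambda>x. coords (cis (f x))) (standard_simplex p))"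
    by (rule continuous_map_eq) auto
qed auto

lemma loop_simplex_singular: "singular_simplex 1 (nsphere 1) (loop_simplex m)"
  unfolding loop_simplex_def
  by (intro singular_simplex_coords_cis continuous_map_real_mult continuous_map_const[THEN iffD2] continuous_map_product_projection) auto

lemma loop_simplex_cycle: "singular_relcycle 1 (nsphere 1) {} (frag_of (loop_simplex m))"
proof -
  have "singular_face 1 0 (loop_simplex m) = singular_face 1 1 (loop_simplex m)"
  proof
    fix x
    show "singular_face 1 0 (loop_simplex m) x = singular_face 1 1 (loop_simplex m) x"
    proof (cases "x \<in> standard_simplex 0")
      case True
      then have x: "x = (\<lambda>j. if j = 0 then 1 else 0)" by (simp add: standard_simplex_0)
      have f: "simplical_face 0 x = edge 1" "simplical_face 1 x = edge 0"
        unfolding x by (auto simp: simplical_face_def edge_def fun_eq_iff)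
      have "cis (2 * pi * of_int m) = 1"
        by (metis cis_2pi cis_multiple_2pi Ints_of_int)
      then show ?thesis
        using True edge_in[of 0] edge_in[of 1] by (simp add: singular_face_def f[unfolded One_nat_def] loop_simplex_def) (simp add: edge_def)
    qed (simp add: singular_face_def)
  qed
  moreover have "{..1::nat} = {0, 1}" by auto
  ultimately have "chain_boundary 1 (frag_of (loop_simplex m)) = 0"
    by (simp add: chain_boundary_of)
  then show ?thesis
    by (simp add: singular_cycle singular_chain_of loop_simplex_singular[unfolded One_nat_def])
qed

lemma turning_loop: "turning (loop_simplex m) = 2 * pi * of_int m"
proof -
  have "angle_lift (loop_simplex m) (\<lambda>u. 2 * pi * (of_int m * u))"
    unfolding angle_lift_def using edge_in
    by (auto simp: loop_simplex_def intro!: continuous_intros) (simp add: edge_def)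
  from turning_eq[OF this] show ?thesis by simp
qed

text \<open>The 2-simplex \<open>T\<close> has the angles 0, \<open>m\<close> and
  \<open>m + k\<close>, in turns, at its vertices. Its faces are the three loops; the one opposite
  to the first vertex starts at angle \<open>m\<close>, a whole number of turns.\<close>

lemma loop_simplex_add:
  "homologous_rel 1 (nsphere 1) {} (frag_of (loop_simplex (m + k))) (frag_of (loop_simplex m) + frag_of (loop_simplex k))"
proof -
  define T where "T = restrict (\<lambda>x. coords (cis (2 * pi * (of_int m * x 1 + of_int (m + k) * x 2)))) (standard_simplex 2)"
  have T: "singular_simplex 2 (nsphere 1) T"
    unfolding T_def
    by (intro singular_simplex_coords_cis continuous_map_real_mult continuous_map_add continuous_map_const[THEN iffD2] continuous_map_product_projection) auto
  have per: "cis (2 * pi * (of_int m + t)) = cis (2 * pi * t)" for t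
  proof -
    have "cis (2 * pi * of_int m) = 1" by (metis cis_2pi cis_multiple_2pi Ints_of_int)
    then show ?thesis by (simp add: distrib_left flip: cis_mult)
  qed
  have sf: "simplical_face j x \<in> standard_simplex 2" if "x \<in> standard_simplex 1" "j \<le> 2" for j x
    using simplical_face_in_standard_simplex[of 2 j x] that by simp
  have f0: "singular_face 2 0 T = loop_simplex k"
  proof
    fix x
    show "singular_face 2 0 T x = loop_simplex k x"
    proof (cases "x \<in> standard_simplex 1")
      case True
      have "{..1::nat} = {0,1}" by auto
      then have "x 0 = 1 - x 1" using True by (simp add: standard_simplex_def)
      then have "of_int m * x 0 + of_int (m + k) * x 1 = of_int m + of_int k * x 1"
        by (simp only: of_int_add) (simp add: algebra_simps)
      then show ?thesis
        using True sf[of x 0] per[of "of_int k * x 1"]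
        by (simp add: singular_face_def T_def loop_simplex_def simplical_face_def)
    qed (simp add: singular_face_def loop_simplex_def)
  qed
  have f1: "singular_face 2 1 T = loop_simplex (m + k)"
    using sf[of _ 1] by (auto simp: singular_face_def T_def loop_simplex_def simplical_face_def fun_eq_iff restrict_def)
  have f2: "singular_face 2 2 T = loop_simplex m"
    using sf[of _ 2] by (auto simp: singular_face_def T_def loop_simplex_def simplical_face_def fun_eq_iff restrict_def)
  have "chain_boundary 2 (- frag_of T) =
     - (frag_of (singular_face 2 0 T) - frag_of (singular_face 2 1 T) + frag_of (singular_face 2 2 T))"
    by (simp add: chain_boundary_minus chain_boundary_of atMost_2)
  also have "\<dots> = frag_of (loop_simplex (m + k)) - (frag_of (loop_simplex m) + frag_of (loop_simplex k))"
    unfolding f0 f1 f2 by simp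
  finally have "singular_relboundary 1 (nsphere 1) {} (frag_of (loop_simplex (m + k)) - (frag_of (loop_simplex m) + frag_of (loop_simplex k)))"
    unfolding singular_boundary using T
    by (metis One_nat_def Suc_1 singular_chain_minus singular_chain_of)
  then show ?thesis by (simp add: homologous_rel_def)
qed

definition power_map :: "int \<Rightarrow> (nat \<Rightarrow> real) \<Rightarrow> nat \<Rightarrow> real" where
  "power_map n = coords \<circ> (\<lambda>z. z powi n) \<circ> plane"

lemma continuous_on_powi_circle: "continuous_on circle (\<lambda>z::complex. z powi n)"
  by (intro continuous_intros) auto

lemma powi_circle: "(\<lambda>z::complex. z powi n) ` circle \<subseteq> circle"
  by (auto simp: norm_power_int)

lemma continuous_map_conjugated:
  assumes "continuous_on circle \<beta>" "\<beta> ` circle \<subseteq> circle"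
  shows "continuous_map (nsphere 1) (nsphere 1) (coords \<circ> \<beta> \<circ> plane)"
proof -
  have "continuous_map (top_of_set circle) (top_of_set circle) \<beta>"
    using assms by (auto simp: continuous_map_in_subtopology)
  then show ?thesis
    by (intro continuous_map_compose[OF continuous_map_plane] continuous_map_compose[OF _ continuous_map_coords])
qed

lemma continuous_map_power_map: "continuous_map (nsphere 1) (nsphere 1) (power_map n)"
  unfolding power_map_def by (rule continuous_map_conjugated[OF continuous_on_powi_circle powi_circle])

lemma power_map_loop_simplex: "chain_map 1 (power_map n) (frag_of (loop_simplex 1)) = frag_of (loop_simplex n)"
proof -
  have "simplex_map 1 (power_map n) (loop_simplex 1) = loop_simplex n"
  proof
    fix x
    have "cis (2 * pi * t) powi n = cis (2 * pi * (of_int n * t))" for t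
      by (simp add: cis_power_int mult_ac)
    then show "simplex_map 1 (power_map n) (loop_simplex 1) x = loop_simplex n x"
      by (simp add: simplex_map_def loop_simplex_def power_map_def restrict_def)
  qed
  then show ?thesis by simp
qed

abbreviation "H1 \<equiv> homology_group 1 (nsphere 1)"
abbreviation "hclass \<equiv> homologous_rel_set 1 (nsphere 1) {}"

lemma hclass_add:
  assumes "singular_relcycle 1 (nsphere 1) {} a" "singular_relcycle 1 (nsphere 1) {} b"
  shows "hclass (a + b) = hclass a \<otimes>\<^bsub>H1\<^esub> hclass b"
proof -
  have "hclass \<in> hom (relcycle_group 1 (nsphere 1) {}) H1"
    using normal.r_coset_hom_Mod[OF normal_subgroup_singular_relboundary_relcycle[of 1 "nsphere 1" "{}"]]
    unfolding right_coset_singular_relboundary relative_homology_group_def by simp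
  from hom_mult[OF this, of a b] show ?thesis using assms by simp
qed

lemma hclass_loop_add:
  "hclass (frag_of (loop_simplex (m + k))) = hclass (frag_of (loop_simplex m)) \<otimes>\<^bsub>H1\<^esub> hclass (frag_of (loop_simplex k))"
proof -
  have "hclass (frag_of (loop_simplex (m + k))) = hclass (frag_of (loop_simplex m) + frag_of (loop_simplex k))"
    using loop_simplex_add by (simp add: homologous_rel_set_eq)
  also have "\<dots> = hclass (frag_of (loop_simplex m)) \<otimes>\<^bsub>H1\<^esub> hclass (frag_of (loop_simplex k))"
    by (rule hclass_add[OF loop_simplex_cycle loop_simplex_cycle])
  finally show ?thesis .
qed

lemma hclass_in: "hclass (frag_of (loop_simplex m)) \<in> carrier H1"
  using carrier_relative_homology_group[of 1 "nsphere 1" "{}"] loop_simplex_cycle[of m] by auto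

lemma hclass_loop_power: "hclass (frag_of (loop_simplex n)) = hclass (frag_of (loop_simplex 1)) [^]\<^bsub>H1\<^esub> n"
proof -
  interpret group H1 by simp
  let ?c = "\<lambda>m. hclass (frag_of (loop_simplex m))"
  have 0: "?c 0 = \<one>\<^bsub>H1\<^esub>"
    using hclass_loop_add[of 0 0] hclass_in[of 0] by (metis add_0 r_cancel_one')
  have up: "?c (i + 1) = ?c i \<otimes>\<^bsub>H1\<^esub> ?c 1" for i by (rule hclass_loop_add)
  have pw: "?c 1 [^]\<^bsub>H1\<^esub> (i + 1) = ?c 1 [^]\<^bsub>H1\<^esub> i \<otimes>\<^bsub>H1\<^esub> ?c 1" for i :: int
    using int_pow_mult[OF hclass_in, of 1 i 1] int_pow_1[OF hclass_in] by simp
  show ?thesis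
  proof (induction n rule: int_induct[where k = 0])
    case base
    then show ?case by (simp only: 0 int_pow_0)
  next
    case (step1 i)
    then show ?case by (simp only: up pw)
  next
    case (step2 i)
    have "?c (i - 1) \<otimes>\<^bsub>H1\<^esub> ?c 1 = ?c 1 [^]\<^bsub>H1\<^esub> (i - 1) \<otimes>\<^bsub>H1\<^esub> ?c 1"
      using up[of "i - 1"] pw[of "i - 1"] step2 by simp
    then show ?case
      using hclass_in int_pow_closed by (metis right_cancel)
  qed
qed

text \<open>By \<open>Brouwer_degree2_iff\<close> the effect on one nontrivial class determines the
  degree. The class of the simple loop is nontrivial because its turning is
  \<open>2 * pi\<close>.\<close>

lemma Brouwer_degree2_power_map: "Brouwer_degree2 1 (power_map n) = n"
proof -
  let ?x = "hclass (frag_of (loop_simplex 1))"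
  have red: "reduced_homology_group (int 1) (nsphere 1) = homology_group (int 1) (nsphere 1)"
    by (rule un_reduced_homology_group) simp
  have x: "?x \<in> carrier (reduced_homology_group (int 1) (nsphere 1))"
    unfolding red using hclass_in[of 1] by simp
  have "hom_induced (int 1) (nsphere 1) {} (nsphere 1) {} (power_map n) ?x = hclass (chain_map 1 (power_map n) (frag_of (loop_simplex 1)))"
    by (rule hom_induced_chain_map[OF continuous_map_power_map _ loop_simplex_cycle]) auto
  also have "\<dots> = ?x [^]\<^bsub>H1\<^esub> n"
    unfolding power_map_loop_simplex by (rule hclass_loop_power)
  finally have "hom_induced (int 1) (nsphere 1) {} (nsphere 1) {} (power_map n) ?x = ?x [^]\<^bsub>reduced_homology_group (int 1) (nsphere 1)\<^esub> n"
    unfolding red by simp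
  then have "?x = \<one>\<^bsub>reduced_homology_group (int 1) (nsphere 1)\<^esub> \<or> Brouwer_degree2 1 (power_map n) = n"
    using Brouwer_degree2_iff[OF continuous_map_power_map x] by blast
  moreover have "?x \<noteq> \<one>\<^bsub>reduced_homology_group (int 1) (nsphere 1)\<^esub>"
  proof
    assume "?x = \<one>\<^bsub>reduced_homology_group (int 1) (nsphere 1)\<^esub>"
    then have "?x = singular_relboundary_set 1 (nsphere 1) {}"
      unfolding red one_relative_homology_group .
    then have "singular_relboundary 1 (nsphere 1) {} (frag_of (loop_simplex 1))"
      by (simp only: homologous_rel_set_eq_relboundary)
    from turning_relboundary[OF this] show False by (simp add: turning_loop)
  qed
  ultimately show ?thesis by blast
qed

section \<open>Maps of the circle up to homotopy\<close>

text \<open>The angle of \<open>\<beta>\<close> along one turn is interpolated linearly with that of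
  \<open>z powi n\<close>. Both increase by \<open>2 * pi * n\<close>, so every intermediate
  function closes up.\<close>

lemma circle_map_homotopic_power:
  assumes \<beta>: "continuous_on circle \<beta>" "\<beta> ` circle \<subseteq> circle"
  obtains n :: int and H where "continuous_on (circle \<times> {0..1}) H" "H ` (circle \<times> {0..1}) \<subseteq> circle"
    "\<And>x. x \<in> circle \<Longrightarrow> H (x, 0::real) = \<beta> x" "\<And>x. x \<in> circle \<Longrightarrow> H (x, 1) = x powi n"
proof -
  let ?e = "\<lambda>s::real. cis (2 * pi * s)"
  have e: "?e s \<in> circle" for s by simp
  have c: "continuous_on {0..1} (\<lambda>s. \<beta> (?e s))"
    by (rule continuous_on_compose2[OF \<beta>(1)]) (auto intro!: continuous_intros)
  have bn: "norm (\<beta> (?e s)) = 1" for s using \<beta>(2) e by force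
  have b0: "\<beta> (?e s) \<noteq> 0" for s using bn[of s] by auto
  have con: "contractible {0..1::real}" by (intro convex_imp_contractible) simp
  obtain g where g: "continuous_on {0..1} g" "\<And>s. s \<in> {0..1::real} \<Longrightarrow> \<beta> (?e s) = exp (g s)"
    using continuous_logarithm_on_contractible[OF c con] b0 by metis
  define \<theta> where "\<theta> s = Im (g s)" for s
  have \<theta>: "continuous_on {0..1} \<theta>" unfolding \<theta>_def by (intro continuous_intros g)
  have cis: "\<beta> (?e s) = cis (\<theta> s)" if "s \<in> {0..1}" for s
  proof -
    have "norm (exp (g s)) = 1" using bn[of s] g(2)[OF that] by simp
    then have "Re (g s) = 0" by simp
    then show ?thesis unfolding g(2)[OF that] \<theta>_def by (subst exp_eq_polar) simp
  qed
  have "cis (\<theta> 1) = cis (\<theta> 0)" using cis[of 0] cis[of 1] by simp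
  then have c1: "cis (\<theta> 1 - \<theta> 0) = 1" by (simp flip: cis_divide)
  have "cos (\<theta> 1 - \<theta> 0) = 1" using arg_cong[OF c1, of Re] by simp
  then obtain n :: int where n: "\<theta> 1 - \<theta> 0 = of_int n * 2 * pi" using cos_one_2pi_int by blast
  define A where "A s t = cis ((1 - t) * \<theta> s + t * (2 * pi * of_int n * s))" for s t
  have A01: "A 1 t = A 0 t" for t
  proof -
    have "(1 - t) * \<theta> 1 + t * (2 * pi * of_int n * 1) = (1 - t) * \<theta> 0 + t * (2 * pi * of_int n * 0) + of_int n * 2 * pi"
    proof -
      have "\<theta> 1 = \<theta> 0 + of_int n * 2 * pi" using n by simp
      then show ?thesis by (simp add: algebra_simps)
    qed
    moreover have "cis (of_int n * 2 * pi) = 1" by (metis cis_multiple_2pi Ints_of_int mult.assoc mult.commute)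
    ultimately show ?thesis unfolding A_def by (simp flip: cis_mult)
  qed
  \<comment> \<open>The inverse \<open>sc\<close> of the parametrisation jumps at the point 1;
    continuity of \<open>H\<close> therefore comes from descent along the quotient map
    \<open>?q\<close>.\<close>
  define sc where "sc z = Arg2pi z / (2 * pi)" for z
  have sc: "sc z \<in> {0..<1}" "?e (sc z) = z" if "z \<in> circle" for z
    using that Arg2pi[of z] by (auto simp: sc_def is_Arg_def cis_conv_exp)
  define H where "H q = A (sc (fst q)) (snd q)" for q
  have Hq: "H (?e s, t) = A s t" if s: "s \<in> {0..1}" for s t
  proof (cases "s = 1")
    case True
    have "sc (?e s) = 0" using True Arg2pi_of_real[of 1] by (simp add: sc_def)
    then show ?thesis using A01 True by (simp add: H_def)
  next
    case False
    have "sc (?e s) = s"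
      using s False Arg2pi_unique[of 1 "2 * pi * s" "?e s"] by (simp add: sc_def cis_conv_exp)
    then show ?thesis by (simp add: H_def)
  qed
  let ?q = "\<lambda>p. (?e (fst p), snd p)"
  have img: "circle \<times> {0..1} = ?q ` ({0..1::real} \<times> {0..1::real})"
  proof
    show "circle \<times> {0..1} \<subseteq> ?q ` ({0..1::real} \<times> {0..1::real})"
    proof
      fix p assume "p \<in> circle \<times> {0..1::real}"
      then have "p = ?q (sc (fst p), snd p)" "(sc (fst p), snd p) \<in> {0..1} \<times> {0..1}"
        using sc[of "fst p"] by (auto simp: prod_eq_iff)
      then show "p \<in> ?q ` ({0..1::real} \<times> {0..1::real})" by blast
    qed
  qed auto
  have contA: "continuous_on ({0..1::real} \<times> {0..1::real}) (\<lambda>p. A (fst p) (snd p))"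
    unfolding A_def by (intro continuous_intros continuous_on_compose2[OF \<theta>]) auto
  show thesis
  proof
    show "continuous_on (circle \<times> {0..1}) H"
      unfolding img
    proof (rule continuous_on_compact_image)
      show "compact ({0..1::real} \<times> {0..1::real})" by (intro compact_Times) auto
      show "continuous_on ({0..1} \<times> {0..1}) ?q" by (intro continuous_intros)
      show "continuous_on ({0..1} \<times> {0..1}) (\<lambda>x. H (?q x))"
        using contA by (rule continuous_on_eq) (auto simp: Hq)
    qed
    show "H ` (circle \<times> {0..1}) \<subseteq> circle" by (auto simp: H_def A_def)
    fix x :: complex assume x: "x \<in> circle"
    show "H (x, 0) = \<beta> x"
      using sc[OF x] cis[of "sc x"] by (simp add: H_def A_def)
    have "A (sc x) 1 = ?e (sc x) powi n" by (simp add: A_def cis_power_int mult_ac)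
    then show "H (x, 1) = x powi n"
      using sc[OF x] by (simp add: H_def)
  qed
qed

lemma circle_map_homotopic_degree:
  assumes \<alpha>: "continuous_map (nsphere 1) (nsphere 1) \<alpha>"
  obtains H where "continuous_on (circle \<times> {0..1}) H" "H ` (circle \<times> {0..1}) \<subseteq> circle"
    "\<And>x. x \<in> circle \<Longrightarrow> H (x, 0::real) = circle_map \<alpha> x"
    "\<And>x. x \<in> circle \<Longrightarrow> H (x, 1) = x powi (Brouwer_degree2 1 \<alpha>)"
proof -
  obtain n :: int and H where H: "continuous_on (circle \<times> {0..1}) H" "H ` (circle \<times> {0..1}) \<subseteq> circle"
    "\<And>x. x \<in> circle \<Longrightarrow> H (x, 0::real) = circle_map \<alpha> x" "\<And>x. x \<in> circle \<Longrightarrow> H (x, 1) = x powi n"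
    by (rule circle_map_homotopic_power[OF continuous_on_circle_map[OF \<alpha>]]) (rule that)
  have "homotopic_with (\<lambda>x. True) (nsphere 1) (nsphere 1) \<alpha> (power_map n)"
    unfolding homotopic_with_def
  proof (intro exI conjI ballI allI)
    let ?h = "\<lambda>p. coords (H (plane (snd p), fst p))"
    have 1: "continuous_map (prod_topology (top_of_set {0..1}) (nsphere 1)) (top_of_set (circle \<times> {0..1})) (\<lambda>p. (plane (snd p), fst p))"
      unfolding prod_topology_subtopology_eu[symmetric]
      using continuous_map_compose[OF continuous_map_snd continuous_map_plane]
      by (intro continuous_map_pairedI continuous_map_fst) (simp add: comp_def)
    have 2: "continuous_map (top_of_set (circle \<times> {0..1})) (top_of_set circle) H"
      using H by (auto simp: continuous_map_in_subtopology)
    have "continuous_map (prod_topology (top_of_set {0..1}) (nsphere 1)) (nsphere 1) (coords \<circ> (H \<circ> (\<lambda>p. (plane (snd p), fst p))))"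
      by (intro continuous_map_compose[OF continuous_map_compose[OF 1 2] continuous_map_coords])
    then have 3: "continuous_map (prod_topology (top_of_set {0..1}) (nsphere 1)) (nsphere 1) ?h"
      by (simp add: comp_def)
    \<comment> \<open>\<open>homotopic_with\<close> prescribes the end values at all points of the
      type, hence the cases outside the sphere.\<close>
    let ?k = "\<lambda>p. if snd p \<in> topspace (nsphere 1) then ?h p else if fst p = 0 then \<alpha> (snd p) else power_map n (snd p)"
    show "continuous_map (prod_topology (top_of_set {0..1}) (nsphere 1)) (nsphere 1) ?k"
      by (rule continuous_map_eq[OF 3]) auto
    fix x
    show "?k (0, x) = \<alpha> x"
    proof (cases "x \<in> topspace (nsphere 1)")
      case True
      then have "\<alpha> x \<in> topspace (nsphere 1)" using \<alpha> by (auto simp: continuous_map_def)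
      then show ?thesis using True H(3)[OF plane_in[OF True]] by (simp add: circle_map_def coords_plane)
    next
      case False
      then show ?thesis by simp
    qed
    show "?k (1, x) = power_map n x"
      using H(4)[OF plane_in, of x] by (auto simp: power_map_def)
  qed auto
  then have "Brouwer_degree2 1 \<alpha> = n"
    using Brouwer_degree2_homotopic Brouwer_degree2_power_map by metis
  then show thesis using that H by simp
qed

theorem TC_le_cone_set_degree:
  assumes \<alpha>: "continuous_map (nsphere 1) (nsphere 1) \<alpha>"
  shows "TC_le (cone_set (circle_map \<alpha>)) k \<longleftrightarrow> TC_le (cone_set (\<lambda>z. z powi (Brouwer_degree2 1 \<alpha>))) k"
proof -
  let ?d = "Brouwer_degree2 1 \<alpha>"
  obtain H where H: "continuous_on (circle \<times> {0..1}) H" "H ` (circle \<times> {0..1}) \<subseteq> circle"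
    "\<And>x. x \<in> circle \<Longrightarrow> H (x, 0::real) = circle_map \<alpha> x"
    "\<And>x. x \<in> circle \<Longrightarrow> H (x, 1) = x powi ?d"
    by (rule circle_map_homotopic_degree[OF \<alpha>]) (rule that)
  let ?Hr = "\<lambda>q. H (fst q, 1 - snd q)"
  have r: "continuous_on (circle \<times> {0..1}) ?Hr" "?Hr ` (circle \<times> {0..1}) \<subseteq> circle"
    using H(2) by (auto intro!: continuous_on_compose2[OF H(1)] continuous_intros simp: image_subset_iff)
  note c = continuous_on_circle_map[OF \<alpha>] and p = continuous_on_powi_circle powi_circle
  show ?thesis
  proof
    assume "TC_le (cone_set (circle_map \<alpha>)) k"
    then show "TC_le (cone_set (\<lambda>z. z powi ?d)) k"
      by (rule cone_set_homotopic[OF p c r, rotated 2]) (use H(3,4) in auto)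
  next
    assume "TC_le (cone_set (\<lambda>z. z powi ?d)) k"
    then show "TC_le (cone_set (circle_map \<alpha>)) k"
      by (rule cone_set_homotopic[OF c p H(1,2), rotated 2]) (use H(3,4) in auto)
  qed
qed

section \<open>Planners from contractible strata\<close>

definition contracts :: "'a::topological_space set \<Rightarrow> 'a set \<Rightarrow> 'a \<Rightarrow> bool" where
  "contracts Y V b \<longleftrightarrow> (\<exists>c. continuous_on (V \<times> {0..1}) c \<and> c ` (V \<times> {0..1}) \<subseteq> Y \<and>
     (\<forall>x\<in>V. c (x, 0::real) = x \<and> c (x, 1) = b))"

lemma contractsI:
  fixes c :: "'a::topological_space \<times> real \<Rightarrow> 'a"
  assumes "continuous_on (V \<times> {0..1}) c" "\<And>x t. x \<in> V \<Longrightarrow> t \<in> {0..1} \<Longrightarrow> c (x, t) \<in> Y"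
    "\<And>x. x \<in> V \<Longrightarrow> c (x, 0) = x" "\<And>x. x \<in> V \<Longrightarrow> c (x, 1) = b"
  shows "contracts Y V b"
  using assms unfolding contracts_def by blast

lemma contracts_subset: "contracts Y V b \<Longrightarrow> W \<subseteq> V \<Longrightarrow> contracts Y W b"
  unfolding contracts_def
proof (elim exE conjE, intro exI conjI ballI)
  fix c :: "'a \<times> real \<Rightarrow> 'a" and x
  assume *: "W \<subseteq> V" "continuous_on (V \<times> {0..1}) c" "c ` (V \<times> {0..1}) \<subseteq> Y" "\<forall>x\<in>V. c (x, 0) = x \<and> c (x, 1) = b"
  show "continuous_on (W \<times> {0..1}) c" using *(1) by (intro continuous_on_subset[OF *(2)]) auto
  show "c ` (W \<times> {0..1}) \<subseteq> Y" using *(1,3) by auto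
  assume "x \<in> W"
  then show "c (x, 0) = x" "c (x, 1) = b" using * by auto
qed

lemma contracts_step:
  fixes c :: "'a::topological_space \<times> real \<Rightarrow> 'a"
  assumes c: "continuous_on (V \<times> {0..1}) c" "\<And>x t. x \<in> V \<Longrightarrow> t \<in> {0..1} \<Longrightarrow> c (x, t) \<in> Y"
    "\<And>x. x \<in> V \<Longrightarrow> c (x, 0) = x" "\<And>x. x \<in> V \<Longrightarrow> c (x, 1) \<in> W"
    and "contracts Y W b"
  shows "contracts Y V b"
proof -
  obtain k where k: "continuous_on (W \<times> {0..1}) k" "k ` (W \<times> {0..1}) \<subseteq> Y"
     "\<And>x. x \<in> W \<Longrightarrow> k (x, 0::real) = x" "\<And>x. x \<in> W \<Longrightarrow> k (x, 1) = b"
    using assms(5) unfolding contracts_def by blast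
  let ?k = "\<lambda>q. k (c (fst q, 1), snd q)"
  have k': "continuous_on (V \<times> {0..1}) ?k"
    using c(4) by (intro continuous_on_compose2[OF k(1)] continuous_intros continuous_on_compose2[OF c(1)]) auto
  have j: "join_homotopy c ?k ` (V \<times> {0..1}) \<subseteq> Y"
    using c(2,4) k(2) by (intro join_homotopy_image) (auto simp: image_subset_iff)
  show ?thesis
  proof (rule contractsI)
    show "continuous_on (V \<times> {0..1}) (join_homotopy c ?k)"
      using c(4) k(3) by (intro continuous_on_join_homotopy c(1) k') auto
    show "join_homotopy c ?k (x, t) \<in> Y" if "x \<in> V" "t \<in> {0..1}" for x t using j that by blast
  qed (use c(3,4) k(4) in auto)
qed

lemma contracts_rebase:
  assumes V: "contracts Y V b" and "path_component Y b b'"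
  shows "contracts Y V b'"
proof (cases "V = {}")
  case True
  then show ?thesis unfolding contracts_def by auto
next
  case False
  obtain c where c: "continuous_on (V \<times> {0..1}) c" "c ` (V \<times> {0..1}) \<subseteq> Y"
     "\<And>x. x \<in> V \<Longrightarrow> c (x, 0::real) = x" "\<And>x. x \<in> V \<Longrightarrow> c (x, 1) = b"
    using V unfolding contracts_def by blast
  obtain g where g: "path g" "path_image g \<subseteq> Y" "pathstart g = b" "pathfinish g = b'"
    using assms(2) unfolding path_component_def by blast
  show ?thesis
  proof (rule contracts_step[OF c(1)])
    show "c (x, 1) \<in> {b}" if "x \<in> V" for x using c(4) that by simp
    show "contracts Y {b} b'"
    proof (rule contractsI)
      show "continuous_on ({b} \<times> {0..1}) (\<lambda>q. g (snd q))"
        using g(1) unfolding path_def by (rule continuous_on_compose2) (auto intro: continuous_intros)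
    qed (use g in \<open>auto simp: path_image_def pathstart_def pathfinish_def\<close>)
  qed (use c in auto)
qed

lemma continuous_on_disjoint_open_Union:
  fixes f :: "'i \<Rightarrow> 'a::topological_space \<Rightarrow> 'b::topological_space"
  assumes "\<And>i. i \<in> I \<Longrightarrow> openin (top_of_set X) (T i)" "\<And>i. i \<in> I \<Longrightarrow> continuous_on (T i) (f i)"
    and "X = (\<Union>i\<in>I. T i)" "\<And>i x. i \<in> I \<Longrightarrow> x \<in> T i \<Longrightarrow> g x = f i x"
  shows "continuous_on X g"
proof -
  have "continuous_map (top_of_set X) euclidean g"
  proof (rule pasting_lemma[of I "top_of_set X" T _ f])
    show "continuous_map (subtopology (top_of_set X) (T i)) euclidean (f i)" if "i \<in> I" for i
      using assms(2)[OF that] openin_imp_subset[OF assms(1)[OF that]]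
      by (simp add: subtopology_subtopology Int_absorb1)
    show "f i x = f j x" if "i \<in> I" "j \<in> I" "x \<in> topspace (top_of_set X) \<inter> T i \<inter> T j" for i j x
      using assms(4)[OF that(1), of x] assms(4)[OF that(2), of x] that(3) by auto
    show "\<exists>j. j \<in> I \<and> x \<in> T j \<and> g x = f j x" if "x \<in> topspace (top_of_set X)" for x
      using that assms(3,4) by fastforce
  qed (rule assms(1))
  then show ?thesis by simp
qed

lemma contracts_disjoint_Un:
  assumes "contracts Y V b" "contracts Y W b" "openin (top_of_set Y) V" "openin (top_of_set Y) W" "V \<inter> W = {}"
  shows "contracts Y (V \<union> W) b"
proof -
  obtain c where c: "continuous_on (V \<times> {0..1}) c" "c ` (V \<times> {0..1}) \<subseteq> Y"
     "\<And>x. x \<in> V \<Longrightarrow> c (x, 0::real) = x" "\<And>x. x \<in> V \<Longrightarrow> c (x, 1) = b"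
    using assms(1) unfolding contracts_def by blast
  obtain k where k: "continuous_on (W \<times> {0..1}) k" "k ` (W \<times> {0..1}) \<subseteq> Y"
     "\<And>x. x \<in> W \<Longrightarrow> k (x, 0::real) = x" "\<And>x. x \<in> W \<Longrightarrow> k (x, 1) = b"
    using assms(2) unfolding contracts_def by blast
  define h where "h q = (if fst q \<in> V then c q else k q)" for q
  have hV: "h (x, t) = c (x, t)" if "x \<in> V" for x t using that by (simp add: h_def)
  have hW: "h (x, t) = k (x, t)" if "x \<in> W" for x t using that assms(5) by (auto simp: h_def)
  have VW: "V \<subseteq> Y" "W \<subseteq> Y" using assms(3,4) by (auto dest: openin_imp_subset)
  show ?thesis
  proof (rule contractsI)
    show "continuous_on ((V \<union> W) \<times> {0..1}) h"
    proof (rule continuous_on_disjoint_open_Union[where I = UNIV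
          and T = "\<lambda>i::bool. (if i then V else W) \<times> {0..1}" and f = "\<lambda>i. if i then c else k"])
      fix i :: bool
      have "openin (top_of_set (V \<union> W)) (if i then V else W)"
        using openin_subset_trans[OF assms(3), of "V \<union> W"] openin_subset_trans[OF assms(4), of "V \<union> W"] VW by auto
      then show "openin (top_of_set ((V \<union> W) \<times> {0..1})) ((if i then V else W) \<times> {0..1::real})"
        by (intro openin_Times) auto
      show "continuous_on ((if i then V else W) \<times> {0..1}) (if i then c else k)" using c(1) k(1) by auto
      show "h x = (if i then c else k) x" if "x \<in> (if i then V else W) \<times> {0..1}" for x
        using that hV hW by (cases x) (auto split: if_splits)
    qed (auto simp: UNIV_bool)
    show "h (x, t) \<in> Y" if "x \<in> V \<union> W" "t \<in> {0..1}" for x t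
      using that hV hW c(2) k(2) by auto
  qed (use hV hW c k in auto)
qed

lemma motion_planner_subset: "motion_planner Y U h \<Longrightarrow> W \<subseteq> U \<Longrightarrow> motion_planner Y W h"
  unfolding motion_planner_def
proof (intro conjI ballI; elim conjE)
  assume *: "W \<subseteq> U" "continuous_on (U \<times> {0..1}) h" "h ` (U \<times> {0..1}) \<subseteq> Y"
    "\<forall>p\<in>U. h (p, 0) = fst p \<and> h (p, 1) = snd p"
  show "continuous_on (W \<times> {0..1}) h" using *(1) by (intro continuous_on_subset[OF *(2)]) auto
  show "h ` (W \<times> {0..1}) \<subseteq> Y" using *(1,3) by auto
  fix p assume "p \<in> W"
  then show "h (p, 0) = fst p" "h (p, 1) = snd p" using *(1,4) by auto
qed

text \<open>Contract the first point to \<open>b\<close>, then run the contraction of the second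
  point backwards.\<close>

lemma motion_planner_Times:
  assumes "contracts Y V b" "contracts Y W b"
  shows "\<exists>h. motion_planner Y (V \<times> W) h"
proof -
  obtain c where c: "continuous_on (V \<times> {0..1}) c" "c ` (V \<times> {0..1}) \<subseteq> Y"
     "\<And>x. x \<in> V \<Longrightarrow> c (x, 0::real) = x" "\<And>x. x \<in> V \<Longrightarrow> c (x, 1) = b"
    using assms(1) unfolding contracts_def by blast
  obtain k where k: "continuous_on (W \<times> {0..1}) k" "k ` (W \<times> {0..1}) \<subseteq> Y"
     "\<And>x. x \<in> W \<Longrightarrow> k (x, 0::real) = x" "\<And>x. x \<in> W \<Longrightarrow> k (x, 1) = b"
    using assms(2) unfolding contracts_def by blast
  let ?c = "\<lambda>q. c (fst (fst q), snd q)" and ?k = "\<lambda>q. k (snd (fst q), 1 - snd q)"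
  have "motion_planner Y (V \<times> W) (join_homotopy ?c ?k)"
    unfolding motion_planner_def
  proof (intro conjI ballI)
    show "continuous_on ((V \<times> W) \<times> {0..1}) (join_homotopy ?c ?k)"
    proof (rule continuous_on_join_homotopy)
      show "continuous_on ((V \<times> W) \<times> {0..1}) ?c" "continuous_on ((V \<times> W) \<times> {0..1}) ?k"
        by (rule continuous_on_compose2[OF c(1)] continuous_on_compose2[OF k(1)]; force intro!: continuous_intros)+
    qed (use c(4) k(4) in auto)
    show "join_homotopy ?c ?k ` ((V \<times> W) \<times> {0..1}) \<subseteq> Y"
      using c(2) k(2) by (intro join_homotopy_image) (auto simp: image_subset_iff)
  qed (use c(3) k(3) in auto)
  then show ?thesis by blast
qed

lemma motion_planner_disjoint_Union:
  assumes op: "\<And>i. i \<in> I \<Longrightarrow> openin (top_of_set (Y \<times> Y)) (N i)" and dis: "\<And>i j. i \<in> I \<Longrightarrow> j \<in> I \<Longrightarrow> i \<noteq> j \<Longrightarrow> N i \<inter> N j = {}"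
    and pl: "\<And>i. i \<in> I \<Longrightarrow> \<exists>h. motion_planner Y (N i) h"
  shows "\<exists>h. motion_planner Y (\<Union>i\<in>I. N i) h"
proof -
  obtain h where h: "\<And>i. i \<in> I \<Longrightarrow> motion_planner Y (N i) (h i)" using pl by metis
  have hh: "continuous_on (N i \<times> {0..1}) (h i)" "h i ` (N i \<times> {0..1}) \<subseteq> Y"
    "p \<in> N i \<Longrightarrow> h i (p, 0) = fst p" "p \<in> N i \<Longrightarrow> h i (p, 1) = snd p" if "i \<in> I" for i p
    using h[OF that] unfolding motion_planner_def by blast+
  define g where "g q = h (THE i. i \<in> I \<and> fst q \<in> N i) q" for q
  have g: "g q = h i q" if "i \<in> I" "fst q \<in> N i" for i q
  proof -
    have "(THE i. i \<in> I \<and> fst q \<in> N i) = i"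
      using that dis by (intro the_equality) auto
    then show ?thesis by (simp add: g_def)
  qed
  have sub: "(\<Union>i\<in>I. N i) \<subseteq> Y \<times> Y" using op by (auto dest: openin_imp_subset)
  have "motion_planner Y (\<Union>i\<in>I. N i) g"
    unfolding motion_planner_def
  proof (intro conjI ballI)
    show "continuous_on ((\<Union>i\<in>I. N i) \<times> {0..1}) g"
    proof (rule continuous_on_disjoint_open_Union[where I = I and T = "\<lambda>i. N i \<times> {0..1}" and f = h])
      fix i assume i: "i \<in> I"
      have "openin (top_of_set (\<Union>i\<in>I. N i)) (N i)"
        using i sub by (intro openin_subset_trans[OF op[OF i]]) auto
      then show "openin (top_of_set ((\<Union>i\<in>I. N i) \<times> {0..1})) (N i \<times> {0..1::real})"
        by (intro openin_Times) auto
      show "continuous_on (N i \<times> {0..1}) (h i)" by (rule hh(1)[OF i])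
      show "g x = h i x" if "x \<in> N i \<times> {0..1}" for x using that g[OF i] by auto
    qed auto
    show "g ` ((\<Union>i\<in>I. N i) \<times> {0..1}) \<subseteq> Y"
      using g hh(2) by (fastforce simp: image_subset_iff)
    fix p assume "p \<in> (\<Union>i\<in>I. N i)"
    then obtain i where "i \<in> I" "p \<in> N i" by auto
    then show "g (p, 0) = fst p" "g (p, 1) = snd p" using g[of i "(p, _)"] hh(3,4) by auto
  qed
  then show ?thesis by blast
qed

text \<open>Stratify \<open>Y \<times> Y\<close> by the sum of the levels of the two points.  The neighbourhoods of the pieces
  with the same sum of levels are made disjoint by comparing the functions \<open>r\<close>.\<close>

theorem TC_le_strata:
  fixes Y :: "'a::topological_space set" and r :: "nat \<Rightarrow> 'a \<Rightarrow> real"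
  assumes V: "\<And>i. i \<le> m \<Longrightarrow> openin (top_of_set Y) (V i)" "\<And>i. i \<le> m \<Longrightarrow> contracts Y (V i) b"
    and r: "\<And>i. i \<le> m \<Longrightarrow> continuous_on Y (r i)"
    and level: "\<And>x. x \<in> Y \<Longrightarrow> \<exists>i\<le>m. x \<in> V i \<and> (i \<ge> 1 \<longrightarrow> r i x > 0) \<and> (\<forall>j. i < j \<and> j \<le> m \<longrightarrow> r j x = 0)"
  shows "TC_le Y (2 * m)"
proof -
  define A where "A a b = {p \<in> Y \<times> Y. r b (snd p) > r a (fst p)}" for a b
  define B where "B a b = {p \<in> Y \<times> Y. r a (fst p) > r b (snd p)}" for a b
  have opA: "openin (top_of_set (Y \<times> Y)) (A a b)" "openin (top_of_set (Y \<times> Y)) (B a b)" if "a \<le> m" "b \<le> m" for a b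
  proof -
    have c: "continuous_on (Y \<times> Y) (\<lambda>p. r b (snd p) - r a (fst p))"
      by (intro continuous_intros continuous_on_compose2[OF r[OF that(1)]] continuous_on_compose2[OF r[OF that(2)]]) auto
    have "A a b = (Y \<times> Y) \<inter> (\<lambda>p. r b (snd p) - r a (fst p)) -` {0<..}"
      "B a b = (Y \<times> Y) \<inter> (\<lambda>p. r b (snd p) - r a (fst p)) -` {..<0}"
      by (auto simp: A_def B_def)
    then show "openin (top_of_set (Y \<times> Y)) (A a b)" "openin (top_of_set (Y \<times> Y)) (B a b)"
      using continuous_openin_preimage_gen[OF c] by auto
  qed
  define J where "J k = {(i, j). i \<le> m \<and> j \<le> m \<and> i + j = k}" for k
  \<comment> \<open>For two pieces with the same sum of levels, \<open>S ij q\<close> and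
    \<open>S q ij\<close> impose opposite strict inequalities between the same two
    functions.\<close>
  define S where "S ij q = (if fst ij < fst q then A (fst q) (snd ij) else if fst q < fst ij then B (fst ij) (snd q) else Y \<times> Y)"
    for ij q :: "nat \<times> nat"
  define N where "N ij = (V (fst ij) \<times> V (snd ij)) \<inter> ((\<Inter>q\<in>J (fst ij + snd ij). S ij q) \<inter> Y \<times> Y)" for ij
  have finJ: "finite (J k)" for k
    by (rule finite_subset[of _ "{..m} \<times> {..m}"]) (auto simp: J_def)
  have Nop: "openin (top_of_set (Y \<times> Y)) (N ij)" if "ij \<in> J k" for ij k
  proof -
    have "openin (top_of_set (Y \<times> Y)) (V (fst ij) \<times> V (snd ij))"
      using that V(1) by (intro openin_Times) (auto simp: J_def)
    moreover have "openin (top_of_set (Y \<times> Y)) ((\<Inter>q\<in>J (fst ij + snd ij). S ij q) \<inter> topspace (top_of_set (Y \<times> Y)))"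
    proof (rule openin_INT[OF finJ])
      fix q assume "q \<in> J (fst ij + snd ij)"
      then have "fst q \<le> m" "snd q \<le> m" "fst ij \<le> m" "snd ij \<le> m" using that by (auto simp: J_def)
      then show "openin (top_of_set (Y \<times> Y)) (S ij q)"
        using opA by (auto simp: S_def)
    qed
    ultimately show ?thesis unfolding N_def by (simp add: openin_Int)
  qed
  have Ndis: "N ij \<inter> N q = {}" if "ij \<in> J k" "q \<in> J k" "ij \<noteq> q" for ij q k
  proof -
    have *: "N ij \<inter> N q = {}" if "ij \<in> J k" "q \<in> J k" "fst ij < fst q" for ij q
    proof (rule ccontr)
      assume "N ij \<inter> N q \<noteq> {}"
      then obtain p where p: "p \<in> N ij" "p \<in> N q" by blast
      have k: "fst ij + snd ij = k" "fst q + snd q = k" using that by (auto simp: J_def)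
      have "p \<in> S ij q" using p(1) that(2) k by (auto simp: N_def)
      moreover have "p \<in> S q ij" using p(2) that(1) k by (auto simp: N_def)
      ultimately show False using that(3) by (auto simp: S_def A_def B_def)
    qed
    have "fst ij \<noteq> fst q" using that by (auto simp: J_def prod_eq_iff)
    then show ?thesis using *[OF that(1,2)] *[OF that(2,1)] by (cases "fst ij < fst q") auto
  qed
  have Npl: "\<exists>h. motion_planner Y (N ij) h" if ij: "ij \<in> J k" for ij k
  proof -
    obtain h where "motion_planner Y (V (fst ij) \<times> V (snd ij)) h"
      using motion_planner_Times[OF V(2) V(2), of "fst ij" "snd ij"] ij by (auto simp: J_def)
    then have "motion_planner Y (N ij) h" by (rule motion_planner_subset) (auto simp: N_def)
    then show ?thesis by blast
  qed
  define W where "W k = (\<Union>ij\<in>J k. N ij)" for k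
  have "openin (top_of_set (Y \<times> Y)) (W k) \<and> (\<exists>h. motion_planner Y (W k) h)" for k
    unfolding W_def using Nop Ndis Npl
    by (intro conjI openin_Union motion_planner_disjoint_Union) auto
  moreover have "(\<Union>k\<le>2 * m. W k) = Y \<times> Y"
  proof
    show "(\<Union>k\<le>2 * m. W k) \<subseteq> Y \<times> Y" by (auto simp: W_def N_def)
    show "Y \<times> Y \<subseteq> (\<Union>k\<le>2 * m. W k)"
    proof
      fix p assume p: "p \<in> Y \<times> Y"
      obtain i where i: "i \<le> m" "fst p \<in> V i" "i \<ge> 1 \<longrightarrow> r i (fst p) > 0" "\<forall>j. i < j \<and> j \<le> m \<longrightarrow> r j (fst p) = 0"
        using level[of "fst p"] p by (auto simp: mem_Times_iff)
      obtain j where j: "j \<le> m" "snd p \<in> V j" "j \<ge> 1 \<longrightarrow> r j (snd p) > 0" "\<forall>i. j < i \<and> i \<le> m \<longrightarrow> r i (snd p) = 0"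
        using level[of "snd p"] p by (auto simp: mem_Times_iff)
      have "p \<in> S (i, j) q" if "q \<in> J (i + j)" for q
      proof -
        have q: "fst q \<le> m" "snd q \<le> m" "fst q + snd q = i + j" using that by (auto simp: J_def)
        show ?thesis
        proof (cases rule: linorder_cases[of i "fst q"])
          case less
          \<comment> \<open>The level sums agree and \<open>i < fst q\<close>, so \<open>j\<close>
            exceeds \<open>snd q\<close>. Thus \<open>r j\<close> is positive at the second point,
            while \<open>r (fst q)\<close> vanishes at the first one, whose level is lower.\<close>
          then have "j \<ge> 1" using q by linarith
          then have "r j (snd p) > r (fst q) (fst p)" using less i(4) j(3) q by auto
          then show ?thesis using less p by (simp add: S_def A_def)
        next
          case equal
          then show ?thesis using p by (simp add: S_def)
        next
          case greater
          then have "i \<ge> 1" "j < snd q" using q by linarith+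
          then have "r i (fst p) > r (snd q) (snd p)" using i(3) j(4) q by auto
          then show ?thesis using greater p by (simp add: S_def B_def)
        qed
      qed
      then have "p \<in> N (i, j)" using p i j by (auto simp: N_def mem_Times_iff)
      moreover have "(i, j) \<in> J (i + j)" "i + j \<le> 2 * m" using i j by (auto simp: J_def)
      ultimately show "p \<in> (\<Union>k\<le>2 * m. W k)" unfolding W_def by blast
    qed
  qed
  ultimately show ?thesis unfolding TC_le_def by blast
qed

section \<open>Disc coordinates and contractible pieces of the cone\<close>

text \<open>At the origin \<open>sgn z ^ n\<close> may jump, but it is bounded and damped by the
  factor \<open>norm z\<close>.\<close>

lemma continuous_on_radial_power: "continuous_on S (\<lambda>z::complex. of_real (norm z) * sgn z ^ n)"
proof -
  have "isCont (\<lambda>z::complex. of_real (norm z) * sgn z ^ n) z" for z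
  proof (cases "z = 0")
    case False
    then show ?thesis by (intro continuous_intros)
  next
    case True
    have "((\<lambda>z::complex. of_real (norm z) * sgn z ^ n) \<longlongrightarrow> 0) (at 0)"
    proof (rule Lim_null_comparison)
      show "\<forall>\<^sub>F z::complex in at 0. norm (of_real (norm z) * sgn z ^ n) \<le> norm z"
        by (rule always_eventually) (auto simp: norm_mult norm_power norm_sgn intro!: mult_left_le power_le_one)
      show "(norm \<longlongrightarrow> 0) (at (0::complex))" by (rule tendsto_norm_zero[OF tendsto_ident_at])
    qed
    then show ?thesis unfolding isCont_def True by simp
  qed
  then show ?thesis by (simp add: continuous_at_imp_continuous_on)
qed

text \<open>The points of the cone of a power map in terms of the single complex coordinate
  \<open>t * x\<close>; \<open>disc_polar\<close> is the comparison.\<close>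

definition disc :: "nat \<Rightarrow> complex \<Rightarrow> complex \<times> complex \<times> real" where
  "disc n z = (of_real (norm z) * sgn z ^ n, of_real (1 - norm z) * z, norm z)"

lemma continuous_on_disc: "continuous_on S (disc n)"
  unfolding disc_def by (intro continuous_intros continuous_on_radial_power)

lemma disc_polar:
  assumes "x \<in> circle" "t \<ge> 0"
  shows "disc n (of_real t * x) = cone_pt (\<lambda>z. z ^ n) (x, t)"
proof (cases "t = 0")
  case False
  have "sgn x = x" "norm x = 1" using assms by (auto simp: sgn_div_norm)
  then show ?thesis using assms False
    by (simp add: disc_def cone_pt_def norm_mult sgn_mult sgn_of_real mult_ac del: of_real_diff)
qed (simp add: disc_def cone_pt_def)

lemma disc_in_cone_set:
  assumes "norm z \<le> 1"
  shows "disc n z \<in> cone_set (\<lambda>z. z ^ n)"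
proof -
  define x where "x = (if z = 0 then 1 else sgn z)"
  have x: "x \<in> circle" "z = of_real (norm z) * x"
    by (auto simp: x_def norm_sgn) (simp add: sgn_div_norm scaleR_conv_of_real)
  then have "disc n z = cone_pt (\<lambda>z. z ^ n) (x, norm z)" using disc_polar[of x "norm z" n] by simp
  then show ?thesis using x assms by (auto simp: cone_set_def)
qed

lemma rim_in_cone_set: "norm u = 1 \<Longrightarrow> rim u \<in> cone_set \<beta>"
  by (simp add: cone_set_def)

lemma disc_unit: "norm z = 1 \<Longrightarrow> disc n z = rim (z ^ n)"
  by (simp add: disc_def rim_def sgn_div_norm)

text \<open>For \<open>n = 0\<close> the closed disc meets the rim in \<open>rim 1\<close> only, so
  the rim is kept as a case of its own.\<close>

lemma cone_set_disc_cases: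
  assumes "y \<in> cone_set (\<lambda>z. z ^ n)"
  obtains z where "norm z < 1" "y = disc n z" | u where "norm u = 1" "y = rim u"
  using assms
proof (cases rule: cone_set_cases)
  case (1 x t)
  then have y: "y = disc n (of_real t * x)" by (simp add: disc_polar)
  show ?thesis
  proof (cases "t = 1")
    case True
    with 1 show ?thesis by (intro that(2)[of "x ^ n"]) (auto simp: cone_pt_1 norm_power)
  next
    case False
    with 1 show ?thesis by (intro that(1)[OF _ y]) (auto simp: norm_mult)
  qed
next
  case (2 u)
  then show ?thesis by (intro that(2)) auto
qed

text \<open>Off the rim the disc coordinate is the middle component divided by
  \<open>1 - norm z\<close>. It moves straight to the boundary point 1, whose image
  \<open>rim 1\<close> serves as the base point of all strata.\<close>

lemma contracts_open_disc:
  "contracts (cone_set (\<lambda>z. z ^ n)) {y \<in> cone_set (\<lambda>z. z ^ n). snd (snd y) < 1} (rim 1)"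
proof (rule contractsI)
  let ?Y = "cone_set (\<lambda>z. z ^ n)"
  let ?w = "\<lambda>q::(complex \<times> complex \<times> real) \<times> real. of_real (1 - snd q) * (fst (snd (fst q)) / of_real (1 - snd (snd (fst q)))) + of_real (snd q)"
  let ?c = "\<lambda>q. disc n (?w q)"
  show "continuous_on ({y \<in> ?Y. snd (snd y) < 1} \<times> {0..1}) ?c"
    by (intro continuous_on_compose2[OF continuous_on_disc[of UNIV]] continuous_intros) auto
  fix y assume "y \<in> {y \<in> ?Y. snd (snd y) < 1}"
  then obtain z where z: "norm z < 1" "y = disc n z"
    by (auto elim!: cone_set_disc_cases simp: rim_def)
  have "of_real (1 - norm z) \<noteq> (0::complex)" using z(1) by (simp del: of_real_diff)
  then have w: "?w (y, t) = of_real (1 - t) * z + of_real t" for t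
    using z by (simp add: disc_def del: of_real_diff)
  show "?c (y, t) \<in> ?Y" if "t \<in> {0..1}" for t
  proof -
    have "norm (of_real (1 - t) * z + of_real t) \<le> (1 - t) * norm z + t"
      using that by (intro norm_triangle_le) (simp add: norm_mult del: of_real_diff)
    also have "\<dots> \<le> (1 - t) * 1 + t" using that z(1) by (intro add_right_mono mult_left_mono) auto
    finally show ?thesis unfolding w by (intro disc_in_cone_set) simp
  qed
  show "?c (y, 0) = y" unfolding w using z by simp
  show "?c (y, 1) = rim 1" unfolding w by (simp add: disc_unit)
qed

text \<open>Rotate \<open>u\<close> to \<open>- w\<close> through the principal argument of
  \<open>- u / w\<close>, whose branch cut is met only at \<open>u = w\<close>.\<close>

lemma contracts_arc:
  assumes w: "norm w = 1"
  shows "contracts (cone_set \<beta>) (rim ` (circle - {w})) (rim (- w))"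
proof (rule contractsI)
  let ?c = "\<lambda>q::(complex \<times> complex \<times> real) \<times> real. rim (- w * cis ((1 - snd q) * Arg (- fst (fst q) / w)))"
  have w0: "w \<noteq> 0" using w by auto
  have np: "- u / w \<notin> \<real>\<^sub>\<le>\<^sub>0" if "norm u = 1" "u \<noteq> w" for u
  proof
    assume "- u / w \<in> \<real>\<^sub>\<le>\<^sub>0"
    then obtain r where r: "- u / w = of_real r" "r \<le> 0" by (rule nonpos_Reals_cases)
    then have "norm (- u / w) = - r" by simp
    then have "r = -1" using that w by (simp add: norm_divide)
    then show False using r w0 that by (simp add: field_simps)
  qed
  show "continuous_on (rim ` (circle - {w}) \<times> {0..1}) ?c"
    using np w0 by (intro continuous_on_compose2[OF continuous_on_rim[of UNIV]] continuous_intros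
        continuous_on_cis) (auto simp: rim_def)
  fix y assume "y \<in> rim ` (circle - {w})"
  then obtain u where "u \<in> circle - {w}" and yu: "y = rim u" by blast
  then have u: "norm u = 1" "u \<noteq> w" by auto
  show "?c (y, t) \<in> cone_set \<beta>" for t using w by (intro rim_in_cone_set) (simp add: norm_mult)
  have "cis (Arg (- u / w)) = - u / w"
    using u w0 w by (subst cis_Arg) (auto simp: sgn_div_norm norm_divide)
  then show "?c (y, 0) = y" using w0 yu by (simp add: rim_def)
  show "?c (y, 1) = rim (- w)" by simp
qed

lemma path_component_rim:
  assumes "norm u = 1" "norm v = 1"
  shows "path_component (cone_set \<beta>) (rim u) (rim v)"
proof (rule path_component_of_subset)
  show "rim ` circle \<subseteq> cone_set \<beta>" by (auto simp: cone_set_def)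
  have "path_connected (rim ` circle)"
    by (intro path_connected_continuous_image continuous_on_rim path_connected_sphere) simp
  then show "path_component (rim ` circle) (rim u) (rim v)"
    using assms by (auto simp: path_connected_component)
qed

text \<open>The points away from the apex whose radial projection to the rim differs from
  \<open>w\<close>.\<close>

definition slit :: "nat \<Rightarrow> complex \<Rightarrow> (complex \<times> complex \<times> real) set" where
  "slit n w = {y \<in> cone_set (\<lambda>z. z ^ n). snd (snd y) > 0 \<and> fst y / of_real (snd (snd y)) \<noteq> w}"

text \<open>Push radially onto the rim, then contract the arc that omits \<open>w\<close>.\<close>

lemma contracts_slit:
  assumes w: "norm w = 1"
  shows "contracts (cone_set (\<lambda>z. z ^ n)) (slit n w) (rim 1)"
proof (rule contracts_rebase[OF contracts_step])
  let ?Y = "cone_set (\<lambda>z. z ^ n)"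
  let ?t = "\<lambda>q::(complex \<times> complex \<times> real) \<times> real. (1 - snd q) * snd (snd (fst q)) + snd q"
  let ?s = "\<lambda>q::(complex \<times> complex \<times> real) \<times> real. ?t q / snd (snd (fst q))"
  \<comment> \<open>The radius \<open>t\<close> becomes \<open>(1 - \<tau>) * t + \<tau>\<close>,
    whose distance from 1 is \<open>(1 - \<tau>) * (1 - t)\<close>; this accounts for the extra
    factor in the middle component.\<close>
  let ?c = "\<lambda>q. (of_real (?s q) * fst (fst q), of_real (?s q * (1 - snd q)) * fst (snd (fst q)), ?t q)"
  show "continuous_on (slit n w \<times> {0..1}) ?c"
    by (intro continuous_intros) (auto simp: slit_def)
  fix y assume y: "y \<in> slit n w"
  then have Y: "y \<in> ?Y" and t0: "snd (snd y) > 0" and nw: "fst y / of_real (snd (snd y)) \<noteq> w"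
    by (auto simp: slit_def)
  show "?c (y, 0) = y" using t0 by (simp add: prod_eq_iff)
  have na: "norm (fst y / of_real (snd (snd y))) = 1"
    using Y t0 by (cases rule: cone_set_disc_cases)
       (auto simp: disc_def rim_def norm_mult norm_power norm_sgn norm_divide)
  have "?c (y, 1) = rim (fst y / of_real (snd (snd y)))"
    by (simp add: rim_def)
  then show "?c (y, 1) \<in> rim ` (circle - {w})" using na nw by auto
  show "?c (y, \<tau>) \<in> ?Y" if "\<tau> \<in> {0..1}" for \<tau>
    using Y
  proof (cases rule: cone_set_disc_cases)
    case (1 z)
    then have t: "snd (snd y) = norm z" "z \<noteq> 0" using t0 by (auto simp: disc_def)
    let ?t' = "(1 - \<tau>) * norm z + \<tau>"
    have t1: "?t' \<le> (1 - \<tau>) * 1 + \<tau>" using that 1(1) by (intro add_right_mono mult_left_mono) auto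
    have t2: "?t' > 0" using that t(2) by (cases "\<tau> = 1") (auto intro!: add_pos_nonneg)
    have s: "sgn (of_real (?t' / norm z) * z) = sgn z"
      using t2 t(2) by (simp add: sgn_mult sgn_of_real del: of_real_divide of_real_add of_real_mult)
    have nn: "norm (of_real (?t' / norm z) * z) = ?t'"
      using t2 t(2) by (simp add: norm_mult del: of_real_divide of_real_add of_real_mult)
    have "?c (y, \<tau>) = disc n (of_real (?t' / norm z) * z)"
      unfolding disc_def[of n "_ * _"] s nn 
      using t(2) by (simp add: 1(2) disc_def field_simps)
    then show ?thesis using nn t1 by (simp add: disc_in_cone_set)
  next
    case (2 u)
    then show ?thesis by (simp add: rim_def[of u]) (use 2 rim_in_cone_set[of u] in \<open>simp add: rim_def\<close>)
  qed
next
  show "contracts (cone_set (\<lambda>z. z ^ n)) (rim ` (circle - {w})) (rim (- w))" by (rule contracts_arc[OF w])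
  show "path_component (cone_set (\<lambda>z. z ^ n)) (rim (- w)) (rim 1)" using w by (intro path_component_rim) auto
qed

lemma openin_Collect_continuous:
  fixes f g :: "'a::topological_space \<Rightarrow> real"
  assumes "continuous_on S f" "continuous_on S g"
  shows "openin (top_of_set S) {x \<in> S. f x < g x}"
proof -
  have "{x \<in> S. f x < g x} = S \<inter> (\<lambda>x. g x - f x) -` {0<..}" by auto
  then show ?thesis
    using continuous_openin_preimage_gen[of S "\<lambda>x. g x - f x" "{0<..}"] assms
    by (auto intro: continuous_intros)
qed

lemma openin_slit: "openin (top_of_set (cone_set (\<lambda>z. z ^ n))) (slit n w)"
proof -
  let ?Y = "cone_set (\<lambda>z. z ^ n)"
  have "slit n w = {y \<in> ?Y. 0 < snd (snd y)} \<inter> {y \<in> ?Y. 0 < norm (fst y - w * of_real (snd (snd y)))}"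
    by (auto simp: slit_def field_simps)
  moreover have "openin (top_of_set ?Y) {y \<in> ?Y. 0 < snd (snd y)}"
    "openin (top_of_set ?Y) {y \<in> ?Y. 0 < norm (fst y - w * of_real (snd (snd y)))}"
    by (intro openin_Collect_continuous continuous_intros)+
  ultimately show ?thesis by (simp only: openin_Int)
qed

text \<open>The strata are the point \<open>rim 1\<close>, the rest of the rim and the open disc;
  the slits are neighbourhoods of the first two.\<close>

lemma TC_le_4_cone_set: "TC_le (cone_set (\<lambda>z. z ^ n)) 4"
proof -
  let ?Y = "cone_set (\<lambda>z. z ^ n)"
  let ?V = "\<lambda>i::nat. if i = 0 then slit n (-1) else if i = 1 then slit n 1 else {y \<in> ?Y. snd (snd y) < 1}"
  let ?r = "\<lambda>i::nat. if i = 1 then (\<lambda>y. norm (y - rim 1)) else (\<lambda>y. 1 - snd (snd y))"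
  have "TC_le ?Y (2 * 2)"
  proof (rule TC_le_strata[where V = ?V and r = ?r and b = "rim 1"])
    show "openin (top_of_set ?Y) (?V i)" for i
      by (auto intro!: openin_slit openin_Collect_continuous continuous_intros)
    show "contracts ?Y (?V i) (rim 1)" for i
      by (auto intro!: contracts_slit contracts_open_disc)
    show "continuous_on ?Y (?r i)" for i by (auto intro!: continuous_intros)
    fix y assume y: "y \<in> ?Y"
    show "\<exists>i\<le>2. y \<in> ?V i \<and> (i \<ge> 1 \<longrightarrow> ?r i y > 0) \<and> (\<forall>j. i < j \<and> j \<le> 2 \<longrightarrow> ?r j y = 0)"
      using y
    proof (cases rule: cone_set_disc_cases)
      case (1 z)
      then show ?thesis using y by (intro exI[of _ 2]) (auto simp: disc_def)
    next
      case (2 u)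
      then have u1: "u = 1 \<or> rim u \<noteq> rim 1" by simp
      have j: "j = 2" if "1 < j" "j \<le> 2" for j :: nat using that by simp
      have j': "j = 1 \<or> j = 2" if "0 < j" "j \<le> 2" for j :: nat using that by auto
      show ?thesis
      proof (cases "u = 1")
        case True
        then show ?thesis using y 2 by (intro exI[of _ 0]) (auto simp: slit_def rim_def dest!: j')
      next
        case False
        then show ?thesis using y 2 u1 by (intro exI[of _ 1]) (auto simp: slit_def rim_def dest!: j)
      qed
    qed
  qed
  then show ?thesis by simp
qed

text \<open>For the constant attaching map the rim without \<open>rim 1\<close> is open, since on
  the disc the first component equals the radius. It joins the open disc in a single stratum, and
  two strata are left.\<close>

lemma TC_le_2_wedge: "TC_le (cone_set (\<lambda>z. z ^ 0)) 2"
proof -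
  let ?Y = "cone_set (\<lambda>z. z ^ 0)"
  let ?D = "{y \<in> ?Y. snd (snd y) < 1}" and ?C = "{y \<in> ?Y. 0 < norm (fst y - of_real (snd (snd y)))}"
  let ?V = "\<lambda>i::nat. if i = 0 then slit 0 (-1) else ?D \<union> ?C"
  let ?r = "\<lambda>i::nat. \<lambda>y. norm (y - rim 1)"
  have op: "openin (top_of_set ?Y) ?D" "openin (top_of_set ?Y) ?C"
    by (intro openin_Collect_continuous continuous_intros)+
  have C: "\<exists>u. norm u = 1 \<and> u \<noteq> 1 \<and> y = rim u" if y: "y \<in> ?C" for y
  proof -
    from y have "y \<in> ?Y" by simp
    then show ?thesis
    proof (cases rule: cone_set_disc_cases)
      case (1 z)
      then show ?thesis using y by (simp add: disc_def)
    next
      case (2 u)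
      then show ?thesis using y by (intro exI[of _ u]) (auto simp: rim_def)
    qed
  qed
  have "TC_le ?Y (2 * 1)"
  proof (rule TC_le_strata[where V = ?V and r = ?r and b = "rim 1"])
    show "openin (top_of_set ?Y) (?V i)" for i
      using op openin_slit[of 0] by (auto intro!: openin_Un)
    have "contracts ?Y (?D \<union> ?C) (rim 1)"
    proof (rule contracts_disjoint_Un[OF contracts_open_disc _ op])
      show "contracts ?Y ?C (rim 1)"
      proof (rule contracts_subset[OF contracts_slit[of 1]])
        show "?C \<subseteq> slit 0 1"
        proof
          fix y assume y: "y \<in> ?C"
          then show "y \<in> slit 0 1" using C[OF y] by (auto simp: slit_def rim_def)
        qed
      qed simp
      have "snd (snd y) = 1" if "y \<in> ?C" for y using C[OF that] by (auto simp: rim_def)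
      then show "?D \<inter> ?C = {}" by fastforce
    qed
    then show "contracts ?Y (?V i) (rim 1)" for i using contracts_slit[of "-1" 0] by auto
    show "continuous_on ?Y (?r i)" for i by (auto intro!: continuous_intros)
    fix y assume y: "y \<in> ?Y"
    show "\<exists>i\<le>1. y \<in> ?V i \<and> (i \<ge> 1 \<longrightarrow> ?r i y > 0) \<and> (\<forall>j. i < j \<and> j \<le> 1 \<longrightarrow> ?r j y = 0)"
    proof (cases "y = rim 1")
      case True
      then show ?thesis using y by (intro exI[of _ 0]) (auto simp: slit_def rim_def)
    next
      case False
      have "y \<in> ?D \<union> ?C" using y
        by (cases rule: cone_set_disc_cases) (use y False in \<open>auto simp: disc_def rim_def\<close>)
      then show ?thesis using False by (intro exI[of _ 1]) auto
    qed
  qed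
  then show ?thesis by simp
qed

text \<open>For \<open>n = 1\<close> the first component is the disc coordinate, so the cone
  contracts radially.\<close>

lemma TC_le_0_disc: "TC_le (cone_set (\<lambda>z. z ^ 1)) 0"
proof -
  let ?Y = "cone_set (\<lambda>z. z ^ 1)"
  have fst: "norm (fst y) \<le> 1 \<and> y = disc 1 (fst y)" if y: "y \<in> ?Y" for y
    using y
  proof (cases rule: cone_set_disc_cases)
    case (1 z)
    then have "fst y = z" by (cases "z = 0") (auto simp: disc_def sgn_div_norm scaleR_conv_of_real)
    then show ?thesis using 1 by simp
  next
    case (2 u)
    then show ?thesis by (simp add: disc_unit rim_def)
  qed
  have "contracts ?Y ?Y (disc 1 0)"
  proof (rule contractsI)
    let ?c = "\<lambda>q::(complex \<times> complex \<times> real) \<times> real. disc 1 (of_real (1 - snd q) * fst (fst q))"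
    show "continuous_on (?Y \<times> {0..1}) ?c"
      by (intro continuous_on_compose2[OF continuous_on_disc[of UNIV]] continuous_intros) auto
    show "?c (y, t) \<in> ?Y" if "y \<in> ?Y" "t \<in> {0..1}" for y t
      using fst[OF that(1)] that(2)
      by (intro disc_in_cone_set) (auto simp: norm_mult mult_le_one simp del: of_real_diff)
  qed (use fst in auto)
  then obtain h where "motion_planner ?Y (?Y \<times> ?Y) h" using motion_planner_Times by blast
  then show ?thesis unfolding TC_le_def by (intro exI[of _ "\<lambda>_. ?Y \<times> ?Y"]) auto
qed

section \<open>The projective plane\<close>

definition outer :: "real^'n \<Rightarrow> real^'n \<Rightarrow> real^'n^'n" where
  "outer x y = (\<chi> i j. x $ i * y $ j)"

text \<open>Real projective space, with a line encoded as the orthogonal projection onto it.\<close>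

definition lines :: "(real^'n^'n) set" where
  "lines = {outer x x | x. norm x = 1}"

lemma outer_row: "outer x y $ i = (x $ i) *\<^sub>R y"
  by (simp add: outer_def vec_eq_iff)

lemma norm_outer: "norm (outer x y) = norm x * norm y"
proof -
  have "norm (outer x y) = L2_set (\<lambda>i. norm y * norm (x $ i)) UNIV"
    unfolding norm_vec_def[of "outer x y"] by (simp add: outer_row mult.commute)
  also have "\<dots> = norm y * norm x"
    by (simp add: L2_set_right_distrib[symmetric] norm_vec_def[of x])
  finally show ?thesis by simp
qed

text \<open>Comparing entries gives \<open>x \<bullet> y = 1\<close> or
  \<open>x \<bullet> y = -1\<close>, the equality cases of the Cauchy-Schwarz inequality.\<close>

lemma outer_eq_imp:
  assumes "outer x x = outer y y" "norm x = 1" "norm y = 1"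
  shows "y = x \<or> y = - x"
proof -
  have e: "x $ i * x $ j = y $ i * y $ j" for i j
    using assms(1) by (simp add: outer_def vec_eq_iff)
  have "(x \<bullet> y)\<^sup>2 = (\<Sum>i\<in>UNIV. \<Sum>j\<in>UNIV. (x $ i * y $ i) * (x $ j * y $ j))"
    by (simp add: inner_vec_def power2_eq_square sum_product)
  also have "\<dots> = (\<Sum>i\<in>UNIV. \<Sum>j\<in>UNIV. (y $ i * y $ i) * (y $ j * y $ j))"
  proof (intro sum.cong refl)
    fix i j
    have "(x $ i * y $ i) * (x $ j * y $ j) = (x $ i * x $ j) * (y $ i * y $ j)" by simp
    then show "(x $ i * y $ i) * (x $ j * y $ j) = (y $ i * y $ i) * (y $ j * y $ j)" using e[of i j] by simp
  qed
  also have "\<dots> = (y \<bullet> y)\<^sup>2"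
    by (simp add: inner_vec_def power2_eq_square sum_product)
  finally have "(x \<bullet> y)\<^sup>2 = 1" using assms(3) by (simp add: dot_square_norm)
  have xx: "x \<bullet> x = 1" "y \<bullet> y = 1" using assms(2,3) by (simp_all add: norm_eq_1)
  from \<open>(x \<bullet> y)\<^sup>2 = 1\<close> consider "x \<bullet> y = 1" | "x \<bullet> y = -1" by (auto simp: power2_eq_1_iff)
  then show ?thesis
  proof cases
    case 1
    have "(x - y) \<bullet> (x - y) = x \<bullet> x - 2 * (x \<bullet> y) + y \<bullet> y"
      by (simp only: inner_diff inner_commute[of y x])
    then have "(x - y) \<bullet> (x - y) = 0" unfolding 1 xx by simp
    then show ?thesis by simp
  next
    case 2
    have "(x + y) \<bullet> (x + y) = x \<bullet> x + 2 * (x \<bullet> y) + y \<bullet> y"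
      by (simp only: inner_add inner_commute[of y x])
    then have "(x + y) \<bullet> (x + y) = 0" unfolding 2 xx by simp
    then show ?thesis by (simp add: eq_neg_iff_add_eq_0 add.commute)
  qed
qed

text \<open>The value \<open>\<beta> x y\<close> depends on the signs of \<open>x\<close> and
  \<open>y\<close>, but \<open>\<beta> x y *\<^sub>R outer x y\<close> does not;
  \<open>pairing\<close> is the latter as a function of the two lines.\<close>

definition pairing :: "(real^'n \<Rightarrow> real^'n \<Rightarrow> real) \<Rightarrow> (real^'n^'n) \<times> (real^'n^'n) \<Rightarrow> real^'n^'n" where
  "pairing \<beta> p = (\<chi> i j. \<beta> (fst p $ i) (snd p $ j))"

lemma pairing_outer:
  assumes "bilinear \<beta>"
  shows "pairing \<beta> (outer x x, outer y y) = \<beta> x y *\<^sub>R outer x y"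
  unfolding pairing_def fst_conv snd_conv outer_row[of x x] outer_row[of y y]
  by (simp add: vec_eq_iff bilinear_lmul[OF assms] bilinear_rmul[OF assms] outer_def mult_ac)

lemma continuous_on_pairing:
  assumes "bilinear \<beta>"
  shows "continuous_on S (pairing \<beta>)"
proof -
  have "bounded_bilinear \<beta>" using assms by (simp add: bilinear_conv_bounded_bilinear)
  then show ?thesis unfolding pairing_def
    by (intro continuous_on_vec_lambda bounded_bilinear.continuous_on[of \<beta>] continuous_intros)
qed

text \<open>A form that does not vanish on \<open>(x, y)\<close> orients the lines spanned by \<open>x\<close> and \<open>y\<close> relative to
  each other; the segment between representatives of equal orientation avoids \<open>0\<close> as \<open>\<beta> x x \<ge> 0\<close>.\<close>

lemma motion_planner_lines:
  fixes \<beta> :: "real^'n \<Rightarrow> real^'n \<Rightarrow> real"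
  assumes \<beta>: "bilinear \<beta>" "\<And>x. \<beta> x x \<ge> 0"
  shows "\<exists>h. motion_planner lines {p \<in> lines \<times> lines. pairing \<beta> p \<noteq> 0} h"
proof -
  let ?U = "{p \<in> lines \<times> lines. pairing \<beta> p \<noteq> 0}"
  define E where "E p = pairing \<beta> p /\<^sub>R norm (pairing \<beta> p)" for p
  \<comment> \<open>This is \<open>outer w w\<close> for
    \<open>w = (1 - t) *\<^sub>R x + (t * s) *\<^sub>R y\<close>, where \<open>s\<close> is the sign
    of \<open>\<beta> x y\<close>. It is expanded so that only quantities independent of the choice
    of \<open>x\<close> and \<open>y\<close> occur.\<close>
  define N where "N q = (1 - snd q)\<^sup>2 *\<^sub>R fst (fst q) + (snd q)\<^sup>2 *\<^sub>R snd (fst q)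
     + (snd q * (1 - snd q)) *\<^sub>R (E (fst q) + (\<chi> i j. E (fst q) $ j $ i))" for q
  define h where "h q = N q /\<^sub>R norm (N q)" for q :: "((real^'n^'n) \<times> (real^'n^'n)) \<times> real"
  have N: "\<exists>w. w \<noteq> 0 \<and> N (p, t) = outer w w" if p: "p \<in> ?U" for p t
  proof -
    obtain x y where xy: "p = (outer x x, outer y y)" "norm x = 1" "norm y = 1"
      using p by (auto simp: lines_def)
    have b0: "\<beta> x y \<noteq> 0" using p xy by (auto simp: pairing_outer[OF \<beta>(1)])
    define s where "s = sgn (\<beta> x y)"
    have s: "s * s = 1" "s * \<beta> x y > 0" using b0 by (auto simp: s_def sgn_real_def)
    have "E p = s *\<^sub>R outer x y"
      using xy b0 by (simp add: E_def pairing_outer[OF \<beta>(1)] norm_outer s_def sgn_div_norm divide_inverse)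
    then have "N (p, t) = outer ((1 - t) *\<^sub>R x + (t * s) *\<^sub>R y) ((1 - t) *\<^sub>R x + (t * s) *\<^sub>R y)"
    proof -
      have *: "(1 - t)\<^sup>2 * (a * b) + t\<^sup>2 * (c * d) + t * (1 - t) * (s * (a * d) + s * (b * c))
        = ((1 - t) * a + t * s * c) * ((1 - t) * b + t * s * d)" for a b c d
      proof -
        have "((1 - t) * a + t * s * c) * ((1 - t) * b + t * s * d)
          = (1 - t)\<^sup>2 * (a * b) + t\<^sup>2 * (c * d) * (s * s) + t * (1 - t) * (s * (a * d) + s * (b * c))"
          by (simp add: algebra_simps power2_eq_square)
        then show ?thesis using s(1) by simp
      qed
      assume "E p = s *\<^sub>R outer x y"
      then show ?thesis
        unfolding N_def fst_conv snd_conv using * by (simp add: xy(1) vec_eq_iff outer_def)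
    qed
    moreover have "(1 - t) *\<^sub>R x + (t * s) *\<^sub>R y \<noteq> 0"
    proof
      assume 0: "(1 - t) *\<^sub>R x + (t * s) *\<^sub>R y = 0"
      have "0 = \<beta> ((1 - t) *\<^sub>R x + (t * s) *\<^sub>R y) (s *\<^sub>R y)"
        by (simp only: 0) (simp add: bilinear_lzero[OF \<beta>(1)])
      also have "\<dots> = (1 - t) * (s * \<beta> x y) + t * \<beta> y y * (s * s)"
        unfolding bilinear_ladd[OF \<beta>(1)] bilinear_lmul[OF \<beta>(1)] bilinear_rmul[OF \<beta>(1)]
        by (simp add: algebra_simps)
      finally have e1: "(1 - t) * (s * \<beta> x y) + t * \<beta> y y = 0" using s(1) by simp
      have "0 = \<beta> x ((1 - t) *\<^sub>R x + (t * s) *\<^sub>R y)"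
        by (simp only: 0) (simp add: bilinear_rzero[OF \<beta>(1)])
      also have "\<dots> = (1 - t) * \<beta> x x + t * (s * \<beta> x y)"
        by (simp add: bilinear_radd[OF \<beta>(1)] bilinear_lmul[OF \<beta>(1)] bilinear_rmul[OF \<beta>(1)])
      finally have e2: "(1 - t) * \<beta> x x + t * (s * \<beta> x y) = 0" by simp
      show False
      \<comment> \<open>For \<open>0 < t\<close> and \<open>t \<le> 1\<close> the left side of
        \<open>e2\<close> is positive. The time is unrestricted here; at all other times norms
        decide, as \<open>\<bar>1 - t\<bar> = \<bar>t\<bar>\<close> holds at \<open>1 / 2\<close>
        only.\<close>
      proof (cases "t > 0 \<and> t < 1 \<or> t = 1")
        case True
        then show False using e2 \<beta>(2)[of x] s(2) 
          by (metis add_nonneg_pos diff_ge_0_iff_ge less_eq_real_def less_irrefl mult_nonneg_nonneg mult_pos_pos zero_less_one)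
      next
        case False
        have "(1 - t) *\<^sub>R x = - ((t * s) *\<^sub>R y)"
          using 0 by (simp add: eq_neg_iff_add_eq_0)
        then have "norm ((1 - t) *\<^sub>R x) = norm (- ((t * s) *\<^sub>R y))" by (rule arg_cong)
        then have "\<bar>1 - t\<bar> = \<bar>t\<bar>"
          using xy(2,3) s(1) b0 by (simp add: abs_mult s_def abs_sgn_eq)
        then show False using False by linarith
      qed
    qed
    ultimately show ?thesis by blast
  qed
  have "motion_planner lines ?U h"
    unfolding motion_planner_def
  proof (intro conjI ballI)
    have cE: "continuous_on ?U E"
      unfolding E_def by (intro continuous_intros continuous_on_pairing \<beta>(1)) auto
    have "continuous_on (?U \<times> {0..1}) N"
      unfolding N_def
      by (intro continuous_intros continuous_on_vec_lambda continuous_on_compose2[OF cE]) auto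
    moreover have "N q \<noteq> 0" if "q \<in> ?U \<times> {0..1}" for q
    proof -
      have "fst q \<in> ?U" using that by (simp only: mem_Times_iff)
      from N[OF this, of "snd q"] obtain w where "w \<noteq> 0" "N q = outer w w" by auto
      then have "norm (N q) \<noteq> 0" by (simp add: norm_outer)
      then show ?thesis by auto
    qed
    ultimately show "continuous_on (?U \<times> {0..1}) h"
      unfolding h_def by (intro continuous_intros) auto
    show "h ` (?U \<times> {0..1}) \<subseteq> lines"
    proof
      fix l assume "l \<in> h ` (?U \<times> {0..1})"
      then obtain p t where "p \<in> ?U" "l = h (p, t)" by blast
      then obtain w where w: "w \<noteq> 0" "N (p, t) = outer w w" using N by blast
      then have "l = outer (w /\<^sub>R norm w) (w /\<^sub>R norm w)"
        unfolding \<open>l = h (p, t)\<close> h_def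
        by (simp add: norm_outer) (simp add: outer_def vec_eq_iff)
      then show "l \<in> lines" unfolding lines_def using w(1) by auto
    qed
    fix p assume p: "p \<in> ?U"
    then obtain x y where xy: "p = (outer x x, outer y y)" "norm x = 1" "norm y = 1"
      by (auto simp: lines_def)
    then show "h (p, 0) = fst p" "h (p, 1) = snd p"
      by (simp_all add: h_def N_def norm_outer)
  qed
  then show ?thesis by blast
qed

text \<open>The squared norms of inner and cross product add up to 1 for unit vectors, by
  \<open>norm_cross_dot\<close>. The components of the cross product are alternating, so
  \<open>\<beta> x x \<ge> 0\<close> holds for them as well.\<close>

lemma TC_le_lines: "TC_le (lines :: (real^3^3) set) 3"
proof -
  let ?\<beta> = "\<lambda>i::nat. if i = 0 then (\<bullet>) else (\<lambda>x y :: real^3. cross3 x y $ of_nat i)"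
  let ?U = "\<lambda>i. {p \<in> lines \<times> lines. pairing (?\<beta> i) p \<noteq> 0}"
  have "bilinear (\<lambda>x y :: real^3. cross3 x y $ k)" for k
    by (simp add: bilinear_def linear_iff cross_add_left cross_add_right cross_mult_left cross_mult_right)
  moreover have "bilinear ((\<bullet>) :: real^3 \<Rightarrow> real^3 \<Rightarrow> real)"
    by (simp add: bilinear_def linear_iff inner_add)
  ultimately have bil: "bilinear (?\<beta> i)" for i by simp
  have "openin (top_of_set (lines \<times> lines)) (?U i) \<and> (\<exists>h. motion_planner lines (?U i) h)" for i
  proof
    have "?U i = lines \<times> lines \<inter> pairing (?\<beta> i) -` (- {0})" by auto
    then show "openin (top_of_set (lines \<times> lines)) (?U i)"
      using continuous_openin_preimage_gen[OF continuous_on_pairing[OF bil[of i]], of "- {0}" "lines \<times> lines"]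
      by (simp only: open_Compl finite.intros finite_imp_closed)
    show "\<exists>h. motion_planner lines (?U i) h"
      by (rule motion_planner_lines[OF bil]) simp
  qed
  moreover have "(\<Union>i\<le>3. ?U i) = lines \<times> lines"
  proof
    show "lines \<times> lines \<subseteq> (\<Union>i\<le>3. ?U i)"
    proof
      fix p :: "(real^3^3) \<times> (real^3^3)" assume p: "p \<in> lines \<times> lines"
      then obtain x y where xy: "p = (outer x x, outer y y)" "norm x = 1" "norm y = 1"
        by (auto simp: lines_def)
      have "\<exists>i\<le>3. ?\<beta> i x y \<noteq> 0"
      proof (cases "x \<bullet> y = 0")
        case True
        then have "cross3 x y \<noteq> 0" using norm_cross_dot[of x y] xy by auto
        then obtain k where k: "cross3 x y $ k \<noteq> 0" by (auto simp: vec_eq_iff)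
        have "k = of_nat 1 \<or> k = of_nat 2 \<or> k = of_nat 3" using exhaust_3[of k] by simp
        then obtain i where "i \<in> {1, 2, 3::nat}" "k = of_nat i" by blast
        then show ?thesis using k by (intro exI[of _ i]) auto
      qed auto
      then obtain i where i: "i \<le> 3" "?\<beta> i x y \<noteq> 0" by blast
      have "norm (outer x y) = 1" using xy by (simp add: norm_outer)
      then have "pairing (?\<beta> i) p \<noteq> 0" using i(2) xy(1) pairing_outer[OF bil[of i], of x y] by auto
      then show "p \<in> (\<Union>i\<le>3. ?U i)" using i(1) p by blast
    qed
  qed auto
  ultimately show ?thesis unfolding TC_le_def by (intro exI[of _ ?U]) auto
qed

section \<open>The cone of the squaring map as the projective plane\<close>

definition lift :: "complex \<Rightarrow> real^3" where
  "lift z = vector [Re z, Im z, sqrt (1 - (norm z)\<^sup>2)]"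

lemma lift_nth [simp]: "lift z $ 1 = Re z" "lift z $ 2 = Im z" "lift z $ 3 = sqrt (1 - (norm z)\<^sup>2)"
  by (simp_all add: lift_def)

lemma norm_lift:
  assumes "norm z \<le> 1"
  shows "norm (lift z) = 1"
proof -
  have "(norm z)\<^sup>2 \<le> 1" using assms by (simp add: power_le_one)
  then have "lift z \<bullet> lift z = (Re z)\<^sup>2 + (Im z)\<^sup>2 + (1 - (norm z)\<^sup>2)"
    by (simp add: inner_vec_def sum_3 power2_eq_square[symmetric])
  then have "lift z \<bullet> lift z = 1" unfolding cmod_power2 by simp
  then show ?thesis by (simp add: norm_eq_1)
qed

lemma continuous_on_outer_lift: "continuous_on S (\<lambda>z. outer (lift z) (lift z))"
proof -
  have *: "continuous_on S (\<lambda>z. lift z $ i)" for i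
  proof -
    have "continuous_on S (\<lambda>z. lift z $ 1)" "continuous_on S (\<lambda>z. lift z $ 2)" "continuous_on S (\<lambda>z. lift z $ 3)"
      unfolding lift_nth by (intro continuous_intros)+
    then show ?thesis using exhaust_3[of i] by metis
  qed
  then show ?thesis unfolding outer_def by (intro continuous_on_vec_lambda continuous_on_mult *)
qed

lemma lines_eq_image: "lines = (\<lambda>z. outer (lift z) (lift z)) ` cball 0 1"
proof
  show "(\<lambda>z. outer (lift z) (lift z)) ` cball 0 1 \<subseteq> lines"
    using norm_lift by (auto simp: lines_def)
  have up: "outer x x \<in> (\<lambda>z. outer (lift z) (lift z)) ` cball 0 1" if "norm x = 1" "x $ 3 \<ge> 0" for x
  proof -
    let ?z = "Complex (x $ 1) (x $ 2)"
    have "(x $ 1)\<^sup>2 + (x $ 2)\<^sup>2 + (x $ 3)\<^sup>2 = 1"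
      using that(1) by (simp add: norm_eq_1 inner_vec_def sum_3 power2_eq_square)
    then have z: "1 - (norm ?z)\<^sup>2 = (x $ 3)\<^sup>2" by (simp add: cmod_power2)
    then have "(norm ?z)\<^sup>2 \<le> 1" by (smt (verit) zero_le_power2)
    then have "norm ?z \<le> 1" by (simp add: power_le_one_iff)
    moreover have "lift ?z = x" using z that(2) by (simp add: vec_eq_iff forall_3)
    ultimately show ?thesis by (intro image_eqI[of _ _ ?z]) auto
  qed
  show "lines \<subseteq> (\<lambda>z. outer (lift z) (lift z)) ` cball 0 1"
  proof
    fix l :: "real^3^3" assume "l \<in> lines"
    then obtain x where x: "l = outer x x" "norm x = 1" by (auto simp: lines_def)
    have "outer (- x) (- x) = outer x x" by (simp add: outer_def)
    then show "l \<in> (\<lambda>z. outer (lift z) (lift z)) ` cball 0 1"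
      using up[of x] up[of "- x"] x by (cases "x $ 3 \<ge> 0") auto
  qed
qed

text \<open>Every rim point has an \<open>n\<close>-th root on the unit circle.\<close>

lemma cone_set_eq_disc_image:
  assumes "n > 0"
  shows "cone_set (\<lambda>z. z ^ n) = disc n ` cball 0 1"
proof
  show "disc n ` cball 0 1 \<subseteq> cone_set (\<lambda>z. z ^ n)" by (auto intro: disc_in_cone_set)
  show "cone_set (\<lambda>z. z ^ n) \<subseteq> disc n ` cball 0 1"
  proof
    fix y assume "y \<in> cone_set (\<lambda>z. z ^ n)"
    then show "y \<in> disc n ` cball 0 1"
    proof (cases rule: cone_set_disc_cases)
      case (2 u)
      have n0: "n \<noteq> 0" using assms by simp
      obtain w where w: "u = w ^ n" by (rule exists_complex_root[OF n0])
      then have "norm w ^ n = 1 ^ n" using 2 by (simp add: norm_power)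
      then have "norm w = 1" by (rule power_eq_imp_eq_base) (use n0 in auto)
      then show ?thesis using w 2 by (intro image_eqI[of _ _ w]) (auto simp: disc_unit)
    qed auto
  qed
qed

lemma disc_eq_iff:
  assumes "norm z \<le> 1" "norm w \<le> 1"
  shows "disc n z = disc n w \<longleftrightarrow> z = w \<or> norm z = 1 \<and> norm w = 1 \<and> z ^ n = w ^ n"
proof
  assume *: "disc n z = disc n w"
  then have nn: "norm z = norm w" by (simp add: disc_def)
  show "z = w \<or> norm z = 1 \<and> norm w = 1 \<and> z ^ n = w ^ n"
  proof (cases "norm z = 1")
    case True
    then show ?thesis using * nn by (simp add: disc_unit)
  next
    case False
    then have "of_real (1 - norm z) \<noteq> (0::complex)" by (simp del: of_real_diff)
    then show ?thesis using * nn by (simp add: disc_def del: of_real_diff)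
  qed
qed (auto simp: disc_unit)

text \<open>Both spaces are quotients of the disc by the antipodal identification on its boundary;
  for lines the disc is the upper hemisphere.\<close>

lemma TC_le_3_square_cone: "TC_le (cone_set (\<lambda>z. z ^ 2)) 3"
proof -
  let ?Y = "cone_set (\<lambda>z. z ^ 2)" and ?D = "cball (0::complex) 1" and ?g = "\<lambda>z. outer (lift z) (lift z)"
  have "top_of_set ?Y homeomorphic_space top_of_set (lines :: (real^3^3) set)"
  proof (rule quotient_maps_homeomorphic)
    have comp: "compact_space (top_of_set ?D)" by (simp add: compact_space_subtopology)
    show "quotient_map (top_of_set ?D) (top_of_set ?Y) (disc 2)"
      using continuous_on_disc[of ?D 2] cone_set_eq_disc_image[of 2]
      by (intro continuous_imp_quotient_map comp) (auto simp: Hausdorff_space_subtopology)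
    show "quotient_map (top_of_set ?D) (top_of_set lines) ?g"
      using continuous_on_outer_lift[of ?D] lines_eq_image
      by (intro continuous_imp_quotient_map comp) (auto simp: Hausdorff_space_subtopology)
    fix z w assume "z \<in> topspace (top_of_set ?D)" "w \<in> topspace (top_of_set ?D)"
    then have zw: "norm z \<le> 1" "norm w \<le> 1" by auto
    have "?g z = ?g w \<longleftrightarrow> lift z = lift w \<or> lift z = - lift w"
      using outer_eq_imp[of "lift w" "lift z"] norm_lift zw by (auto simp: outer_def)
    also have "lift z = lift w \<longleftrightarrow> z = w" by (metis complex_eq_iff lift_nth(1,2))
    also have "lift z = - lift w \<longleftrightarrow> norm z = 1 \<and> norm w = 1 \<and> z = - w"
    proof
      assume l: "lift z = - lift w"
      have "sqrt (1 - (norm z)\<^sup>2) \<ge> 0" "sqrt (1 - (norm w)\<^sup>2) \<ge> 0" using zw by (auto simp: power_le_one)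
      moreover have "lift z $ 1 = - lift w $ 1" "lift z $ 2 = - lift w $ 2" "lift z $ 3 = - lift w $ 3" using l by simp_all
      ultimately have "sqrt (1 - (norm z)\<^sup>2) = 0" "sqrt (1 - (norm w)\<^sup>2) = 0" "z = - w"
        unfolding lift_nth complex_eq_iff uminus_complex.simps by linarith+
      then show "norm z = 1 \<and> norm w = 1 \<and> z = - w" by (simp add: abs_square_eq_1)
    qed (auto simp: vec_eq_iff forall_3)
    finally show "disc 2 z = disc 2 w \<longleftrightarrow> ?g z = ?g w"
      unfolding disc_eq_iff[OF zw] by (auto simp: power2_eq_iff)
  qed
  then obtain f g where "homeomorphic_maps (top_of_set ?Y) (top_of_set (lines :: (real^3^3) set)) f g"
    unfolding homeomorphic_space_def by blast
  then have "homeomorphism ?Y (lines :: (real^3^3) set) f g"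
    by (intro homeomorphismI) (auto simp: homeomorphic_maps_def)
  then have "?Y homeomorphic (lines :: (real^3^3) set)"
    unfolding homeomorphic_def by blast
  then show ?thesis using TC_le_lines by (rule TC_le_homeomorphic)
qed

section \<open>Cochains on labelled grids\<close>

text \<open>The alternating sum over omitted vertices. The recursion treats a list as a cone: the
  boundary of a cone is its base minus the cone over the boundary of the base.\<close>

fun cobd :: "('v list \<Rightarrow> int) \<Rightarrow> 'v list \<Rightarrow> int" where
  "cobd \<phi> [] = 0"
| "cobd \<phi> (x # xs) = \<phi> xs - cobd (\<lambda>l. \<phi> (x # l)) xs"

text \<open>A position is a vertex of a grid on the product of two discs, in polar coordinates
  (angle, radius, angle, radius).  Its label records a member of the open cover and the
  value there, as an exponent, of a function into the roots of unity.\<close>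

datatype pos = Pos nat nat nat nat

datatype label = Label (idx: nat) (grp: int)

fun inc :: "nat \<Rightarrow> pos \<Rightarrow> pos" where
  "inc e (Pos a b c d) =
     (if e = 0 then Pos (Suc a) b c d else if e = 1 then Pos a (Suc b) c d
      else if e = 2 then Pos a b (Suc c) d else Pos a b c (Suc d))"

lemma inc_commute: "inc e (inc f p) = inc f (inc e p)"
  by (cases p) simp

fun corners :: "nat list \<Rightarrow> pos \<Rightarrow> pos set" where
  "corners [] p = {p}"
| "corners (e # E) p = corners E p \<union> corners E (inc e p)"

locale labelled_grid =
  fixes \<l> :: "pos \<Rightarrow> label"
begin

definition apex :: "nat list \<Rightarrow> pos \<Rightarrow> label" where
  "apex E p = (SOME v. v \<in> \<l> ` corners E p \<and> (\<forall>w \<in> \<l> ` corners E p. idx v \<le> idx w))"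

definition diff :: "nat \<Rightarrow> ((label list \<Rightarrow> int) \<Rightarrow> pos \<Rightarrow> int) \<Rightarrow> (label list \<Rightarrow> int) \<Rightarrow> pos \<Rightarrow> int" where
  "diff e F \<phi> p = F \<phi> (inc e p) - F \<phi> p"

text \<open>The value of an ordered cochain on the cube at \<open>p\<close> with edge directions \<open>e\<close>, \<open>f\<close> and so on,
  triangulated by coning off a corner of least index.  The cone point depends on the labels only,
  hence the triangulations of adjacent cubes match and \<^term>\<open>cobd\<close> satisfies Stokes' formula.\<close>

definition ev0 :: "(label list \<Rightarrow> int) \<Rightarrow> pos \<Rightarrow> int" where "ev0 \<phi> p = \<phi> [\<l> p]"
definition ev1 where "ev1 e \<phi> p = diff e ev0 (\<lambda>l. \<phi> (apex [e] p # l)) p"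
definition ev2 where "ev2 e f \<phi> p =
  (let \<psi> = (\<lambda>l. \<phi> (apex [e,f] p # l)) in diff e (ev1 f) \<psi> p - diff f (ev1 e) \<psi> p)"
definition ev3 where "ev3 e f g \<phi> p =
  (let \<psi> = (\<lambda>l. \<phi> (apex [e,f,g] p # l))
   in diff e (ev2 f g) \<psi> p - diff f (ev2 e g) \<psi> p + diff g (ev2 e f) \<psi> p)"
definition ev4 where "ev4 e f g h \<phi> p =
  (let \<psi> = (\<lambda>l. \<phi> (apex [e,f,g,h] p # l))
   in diff e (ev3 f g h) \<psi> p - diff f (ev3 e g h) \<psi> p + diff g (ev3 e f h) \<psi> p - diff h (ev3 e f g) \<psi> p)"

lemmas ev_defs = ev0_def ev1_def ev2_def ev3_def ev4_def diff_def Let_def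

text \<open>The form with a factor \<open>c\<close> covers differences, for \<open>c = 1\<close>, as
  well as correction terms that are multiples of the modulus.\<close>

lemma ev0_lin: "ev0 (\<lambda>l. \<phi> l - c * \<psi> l) p = ev0 \<phi> p - c * ev0 \<psi> p"
  by (simp add: ev_defs)
lemma ev1_lin: "ev1 e (\<lambda>l. \<phi> l - c * \<psi> l) p = ev1 e \<phi> p - c * ev1 e \<psi> p"
  by (simp add: ev1_def diff_def ev0_lin algebra_simps)
lemma ev2_lin: "ev2 e f (\<lambda>l. \<phi> l - c * \<psi> l) p = ev2 e f \<phi> p - c * ev2 e f \<psi> p"
  by (simp add: ev2_def diff_def ev1_lin Let_def algebra_simps)
lemma ev3_lin: "ev3 e f g (\<lambda>l. \<phi> l - c * \<psi> l) p = ev3 e f g \<phi> p - c * ev3 e f g \<psi> p"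
  by (simp add: ev3_def diff_def ev2_lin Let_def algebra_simps)

lemma ev0_diff: "ev0 (\<lambda>l. \<phi> l - \<psi> l) p = ev0 \<phi> p - ev0 \<psi> p"
  using ev0_lin[of \<phi> 1 \<psi>] by simp
lemma ev1_diff: "ev1 e (\<lambda>l. \<phi> l - \<psi> l) p = ev1 e \<phi> p - ev1 e \<psi> p"
  using ev1_lin[of e \<phi> 1 \<psi>] by simp
lemma ev2_diff: "ev2 e f (\<lambda>l. \<phi> l - \<psi> l) p = ev2 e f \<phi> p - ev2 e f \<psi> p"
  using ev2_lin[of e f \<phi> 1 \<psi>] by simp
lemma ev3_diff: "ev3 e f g (\<lambda>l. \<phi> l - \<psi> l) p = ev3 e f g \<phi> p - ev3 e f g \<psi> p"
  using ev3_lin[of e f g \<phi> 1 \<psi>] by simp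

lemma ev0_cobd: "ev0 (cobd \<phi>) p = \<phi> []"
  by (simp add: ev_defs)
text \<open>In each dimension the recursion of \<open>cobd\<close> at the cone point leaves the
  claimed boundary minus a sum of coboundaries one dimension lower. By the previous Stokes formula
  these are mixed second differences, which cancel in pairs because \<open>inc\<close>
  commutes.\<close>

lemma stokes1: "ev1 e (cobd \<phi>) p = diff e ev0 \<phi> p"
  by (simp add: ev1_def diff_def ev0_diff ev0_cobd)
lemma stokes2: "ev2 e f (cobd \<phi>) p = diff e (ev1 f) \<phi> p - diff f (ev1 e) \<phi> p"
  by (simp add: ev2_def diff_def ev1_diff stokes1 inc_commute[of f e])
lemma stokes3: "ev3 e f g (cobd \<phi>) p = diff e (ev2 f g) \<phi> p - diff f (ev2 e g) \<phi> p + diff g (ev2 e f) \<phi> p"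
  by (simp add: ev3_def diff_def ev2_diff stokes2 inc_commute[of f e] inc_commute[of g e] inc_commute[of g f])
lemma stokes4: "ev4 e f g h (cobd \<phi>) p =
  diff e (ev3 f g h) \<phi> p - diff f (ev3 e g h) \<phi> p + diff g (ev3 e f h) \<phi> p - diff h (ev3 e f g) \<phi> p"
  by (simp add: ev4_def diff_def ev3_diff stokes3 inc_commute[of f e] inc_commute[of g e] inc_commute[of g f]
     inc_commute[of h e] inc_commute[of h f] inc_commute[of h g])

lemma apex_in: "apex E p \<in> \<l> ` corners E p"
  and apex_least: "w \<in> \<l> ` corners E p \<Longrightarrow> idx (apex E p) \<le> idx w"
proof -
  let ?S = "\<l> ` corners E p"
  have ne: "?S \<noteq> {}" by (induction E arbitrary: p) auto
  then obtain x where "x \<in> ?S" by blast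
  then have "\<exists>v. v \<in> ?S \<and> (\<forall>w. w \<in> ?S \<longrightarrow> idx v \<le> idx w)"
    using ex_has_least_nat[of "\<lambda>v. v \<in> ?S" x idx] by blast
  then have ex: "\<exists>v. v \<in> ?S \<and> (\<forall>w \<in> ?S. idx v \<le> idx w)"
    by blast
  have "apex E p \<in> ?S \<and> (\<forall>w \<in> ?S. idx (apex E p) \<le> idx w)"
    unfolding apex_def using someI_ex[OF ex] .
  then show "apex E p \<in> \<l> ` corners E p"
    and "w \<in> \<l> ` corners E p \<Longrightarrow> idx (apex E p) \<le> idx w" by auto
qed

definition chains :: "nat list \<Rightarrow> pos \<Rightarrow> label list set" where
  "chains E p = {l. length l = Suc (length E) \<and> set l \<subseteq> \<l> ` corners E p \<and> sorted (map idx l)}"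

text \<open>A cone point of least index keeps the list sorted. Therefore evaluation on a cube sees
  only index-sorted lists of labels of its corners, which is the content of the congruence rules
  below.\<close>

lemma apex_chains:
  assumes "l \<in> chains F q" "corners F q \<subseteq> corners E p" "length E = Suc (length F)"
  shows "apex E p # l \<in> chains E p"
  using assms apex_in[of E p] apex_least[of _ E p] unfolding chains_def by force

lemma ev0_cong:
  assumes "\<And>l. l \<in> chains [] p \<Longrightarrow> \<phi> l = \<psi> l"
  shows "ev0 \<phi> p = ev0 \<psi> p"
  using assms by (simp add: ev0_def chains_def)
lemma ev1_cong:
  assumes "\<And>l. l \<in> chains [e] p \<Longrightarrow> \<phi> l = \<psi> l"
  shows "ev1 e \<phi> p = ev1 e \<psi> p"
  unfolding ev1_def diff_def
  by (intro arg_cong2[of _ _ _ _ "(-)"] ev0_cong) (auto intro!: assms apex_chains)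
lemma ev2_cong:
  assumes "\<And>l. l \<in> chains [e,f] p \<Longrightarrow> \<phi> l = \<psi> l"
  shows "ev2 e f \<phi> p = ev2 e f \<psi> p"
  unfolding ev2_def diff_def Let_def
  by (intro arg_cong2[of _ _ _ _ "(-)"] ev1_cong) (auto intro!: assms apex_chains simp: inc_commute)
lemma ev3_cong:
  assumes "\<And>l. l \<in> chains [e,f,g] p \<Longrightarrow> \<phi> l = \<psi> l"
  shows "ev3 e f g \<phi> p = ev3 e f g \<psi> p"
  unfolding ev3_def diff_def Let_def
  by (intro arg_cong2[of _ _ _ _ "(-)"] arg_cong2[of _ _ _ _ "(+)"] ev2_cong) (auto intro!: assms apex_chains simp: inc_commute)
lemma ev4_cong:
  assumes "\<And>l. l \<in> chains [e,f,g,h] p \<Longrightarrow> \<phi> l = \<psi> l"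
  shows "ev4 e f g h \<phi> p = ev4 e f g h \<psi> p"
  unfolding ev4_def diff_def Let_def
  by (intro arg_cong2[of _ _ _ _ "(-)"] arg_cong2[of _ _ _ _ "(+)"] ev3_cong) (auto intro!: assms apex_chains simp: inc_commute)

lemma ev0_zero [simp]: "ev0 (\<lambda>l. 0) p = 0" by (simp add: ev_defs)
lemma ev1_zero [simp]: "ev1 e (\<lambda>l. 0) p = 0" by (simp add: ev1_def diff_def)
lemma ev2_zero [simp]: "ev2 e f (\<lambda>l. 0) p = 0" by (simp add: ev2_def diff_def)
lemma ev3_zero [simp]: "ev3 e f g (\<lambda>l. 0) p = 0" by (simp add: ev3_def diff_def)
lemma ev4_zero [simp]: "ev4 e f g h (\<lambda>l. 0) p = 0" by (simp add: ev4_def diff_def)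


text \<open>The cone point is a choice among the vertices of least index; it commutes with a
  symmetry once the index determines the label.\<close>

lemma apex_transport:
  assumes "\<l> ` corners E p' = \<sigma> ` \<l> ` corners E p"
    and "\<And>v. idx (\<sigma> v) = idx v"
    and uniq: "\<And>v w. \<lbrakk>v \<in> \<l> ` corners E p'; w \<in> \<l> ` corners E p'; idx v = idx w\<rbrakk> \<Longrightarrow> v = w"
  shows "apex E p' = \<sigma> (apex E p)"
proof (rule uniq)
  show 1: "apex E p' \<in> \<l> ` corners E p'" by (rule apex_in)
  show 2: "\<sigma> (apex E p) \<in> \<l> ` corners E p'" using apex_in[of E p] assms(1) by blast
  obtain w where w: "w \<in> \<l> ` corners E p" "apex E p' = \<sigma> w"
    using 1 assms(1) by auto
  show "idx (apex E p') = idx (\<sigma> (apex E p))"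
    using apex_least[OF 2] apex_least[OF w(1)] w(2) assms(2) by (metis antisym)
qed

end

section \<open>Consistent grids and their symmetries\<close>

definition cube :: "pos \<Rightarrow> pos set" where "cube = corners [0, 1, 2, 3]"

text \<open>The axiom records that the root of unity attached to one member of the cover does not
  vary within a small cube.\<close>

locale consistent_grid = labelled_grid +
  assumes consistent: "\<lbrakk>q \<in> cube p; q' \<in> cube p; idx (\<l> q) = idx (\<l> q')\<rbrakk> \<Longrightarrow> \<l> q = \<l> q'"
begin

text \<open>\<open>P\<close> is a region closed under the directions in \<open>D\<close>, typically
  a face of the grid, on which the translation \<open>\<tau>\<close> acts on labels through
  \<open>\<sigma>\<close>.\<close>

definition equivariant :: "nat set \<Rightarrow> (pos \<Rightarrow> bool) \<Rightarrow> (pos \<Rightarrow> pos) \<Rightarrow> (label \<Rightarrow> label) \<Rightarrow> bool" where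
  "equivariant D P \<tau> \<sigma> \<longleftrightarrow> (\<forall>e p. \<tau> (inc e p) = inc e (\<tau> p)) \<and> (\<forall>e\<in>D. \<forall>p. P p \<longrightarrow> P (inc e p)) \<and>
     (\<forall>p. P p \<longrightarrow> \<l> (\<tau> p) = \<sigma> (\<l> p)) \<and> (\<forall>v. idx (\<sigma> v) = idx v)"

lemma equivariant_corners:
  assumes "equivariant D P \<tau> \<sigma>" "set E \<subseteq> D" "P p"
  shows "\<l> ` corners E (\<tau> p) = \<sigma> ` \<l> ` corners E p"
  using assms(2,3)
proof (induction E arbitrary: p)
  case Nil
  then show ?case using assms(1) by (auto simp: equivariant_def)
next
  case (Cons e E)
  have "P (inc e p)" using assms(1) Cons.prems by (auto simp: equivariant_def)
  moreover have "inc e (\<tau> p) = \<tau> (inc e p)" using assms(1) by (simp add: equivariant_def)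
  ultimately show ?case using Cons by (simp add: image_Un)
qed

lemma equivariant_apex:
  assumes "equivariant D P \<tau> \<sigma>" "set E \<subseteq> D" "P p" "corners E (\<tau> p) \<subseteq> cube (\<tau> p)"
  shows "apex E (\<tau> p) = \<sigma> (apex E p)"
  using assms(1,4)
  by (intro apex_transport equivariant_corners[OF assms(1-3)]) (auto simp: equivariant_def intro: consistent)

lemma ev0_equivariant: "equivariant D P \<tau> \<sigma> \<Longrightarrow> P p \<Longrightarrow> ev0 \<phi> (\<tau> p) = ev0 (\<phi> \<circ> map \<sigma>) p"
  by (simp add: ev0_def equivariant_def)

lemma diff_equivariant:
  assumes "equivariant D P \<tau> \<sigma>" "e \<in> D" "P p"
    and "\<And>q. P q \<Longrightarrow> F \<phi> (\<tau> q) = F (\<phi> \<circ> map \<sigma>) q"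
  shows "diff e F \<phi> (\<tau> p) = diff e F (\<phi> \<circ> map \<sigma>) p"
proof -
  have "inc e (\<tau> p) = \<tau> (inc e p)" "P (inc e p)"
    using assms by (auto simp: equivariant_def)
  then show ?thesis using assms by (simp add: diff_def)
qed

lemma ev1_equivariant:
  assumes "equivariant D P \<tau> \<sigma>" "P p" "e \<in> D" "e < 4"
  shows "ev1 e \<phi> (\<tau> p) = ev1 e (\<phi> \<circ> map \<sigma>) p"
proof -
  have "corners [e] q \<subseteq> cube q" for q using assms by (cases q) (auto simp: cube_def)
  then have "apex [e] (\<tau> p) = \<sigma> (apex [e] p)" using assms by (intro equivariant_apex[OF assms(1) _ assms(2)]) auto
  then show ?thesis
    using assms by (simp add: ev1_def diff_equivariant[OF assms(1)] ev0_equivariant[OF assms(1)] comp_def)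
qed

lemma ev2_equivariant:
  assumes "equivariant D P \<tau> \<sigma>" "P p" "{e, f} \<subseteq> D" "e < f" "f < 4"
  shows "ev2 e f \<phi> (\<tau> p) = ev2 e f (\<phi> \<circ> map \<sigma>) p"
proof -
  have "corners [e, f] q \<subseteq> cube q" for q using assms by (cases q) (auto simp: cube_def)
  then have "apex [e, f] (\<tau> p) = \<sigma> (apex [e, f] p)" using assms by (intro equivariant_apex[OF assms(1) _ assms(2)]) auto
  then show ?thesis
    using assms by (simp add: ev2_def diff_equivariant[OF assms(1)] ev1_equivariant[OF assms(1)] comp_def Let_def)
qed

lemma ev3_equivariant:
  assumes "equivariant D P \<tau> \<sigma>" "P p" "{e, f, g} \<subseteq> D" "e < f" "f < g" "g < 4"
  shows "ev3 e f g \<phi> (\<tau> p) = ev3 e f g (\<phi> \<circ> map \<sigma>) p"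
proof -
  have "corners [e, f, g] q \<subseteq> cube q" for q using assms by (cases q) (auto simp: cube_def)
  then have "apex [e, f, g] (\<tau> p) = \<sigma> (apex [e, f, g] p)" using assms by (intro equivariant_apex[OF assms(1) _ assms(2)]) auto
  then show ?thesis
    using assms by (simp add: ev3_def diff_equivariant[OF assms(1)] ev2_equivariant[OF assms(1)] comp_def Let_def)
qed

definition constant_along :: "nat \<Rightarrow> nat set \<Rightarrow> (pos \<Rightarrow> bool) \<Rightarrow> bool" where
  "constant_along e D P \<longleftrightarrow> (\<forall>f\<in>D. \<forall>p. P p \<longrightarrow> P (inc f p)) \<and> (\<forall>p. P p \<longrightarrow> \<l> (inc e p) = \<l> p)"

lemma constant_along_equivariant: "constant_along e D P \<Longrightarrow> equivariant D P (inc e) id"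
  by (auto simp: equivariant_def constant_along_def inc_commute)

lemma ev1_const: "constant_along e D P \<Longrightarrow> P p \<Longrightarrow> ev1 e \<phi> p = 0"
  by (simp add: ev1_def diff_def ev0_def constant_along_def)

text \<open>A cell with a collapsed direction is degenerate: its two faces across that direction
  agree and cancel, and the other faces contain the direction and vanish by the case one dimension
  lower.\<close>

lemma ev2_const1:
  assumes "constant_along e D P" "P p" "{e, f} \<subseteq> D" "e < f" "f < 4"
  shows "ev2 e f \<phi> p = 0"
  using assms ev1_equivariant[OF constant_along_equivariant[OF assms(1)]] ev1_const[OF assms(1)]
  by (simp add: ev2_def diff_def Let_def) (simp add: constant_along_def)

lemma ev2_const2:
  assumes "constant_along f D P" "P p" "{e, f} \<subseteq> D" "e < f" "f < 4"
  shows "ev2 e f \<phi> p = 0"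
  using assms ev1_equivariant[OF constant_along_equivariant[OF assms(1)]] ev1_const[OF assms(1)]
  by (simp add: ev2_def diff_def Let_def) (simp add: constant_along_def)

lemma ev3_const1:
  assumes "constant_along e D P" "P p" "{e, f, g} \<subseteq> D" "e < f" "f < g" "g < 4"
  shows "ev3 e f g \<phi> p = 0"
  using assms ev2_equivariant[OF constant_along_equivariant[OF assms(1)]] ev2_const1[OF assms(1)]
  by (simp add: ev3_def diff_def Let_def) (simp add: constant_along_def)

lemma ev3_const3:
  assumes "constant_along g D P" "P p" "{e, f, g} \<subseteq> D" "e < f" "f < g" "g < 4"
  shows "ev3 e f g \<phi> p = 0"
  using assms ev2_equivariant[OF constant_along_equivariant[OF assms(1)]] ev2_const2[OF assms(1)]
  by (simp add: ev3_def diff_def Let_def) (simp add: constant_along_def)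

end

section \<open>Cochains of the cyclic group\<close>

locale cyclic_cochains =
  fixes d :: int
  assumes d_pos: "d > 0"
begin

definition sh :: "int \<Rightarrow> label \<Rightarrow> label" where
  "sh k v = Label (idx v) ((grp v + k) mod d)"

text \<open>In the cohomology of the cyclic group of order \<open>d\<close>, \<open>coh_a\<close> is the generator of degree 1
  modulo \<open>d\<close>, \<open>coh_u\<close> its integral Bockstein and \<open>coh_T\<close> their cup product.  Modulo \<open>d\<close> the
  latter is the coboundary of \<open>coh_gu\<close>, which is not invariant under \<open>sh\<close>.\<close>

fun coh_a :: "label list \<Rightarrow> int" where
  "coh_a [v, w] = (grp w - grp v) mod d"
| "coh_a _ = 0"

fun coh_u :: "label list \<Rightarrow> int" where
  "coh_u [v, w, x] = (coh_a [v, w] + coh_a [w, x] - coh_a [v, x]) div d"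
| "coh_u _ = 0"

fun coh_T :: "label list \<Rightarrow> int" where
  "coh_T [v, w, x, y] = coh_a [v, w] * coh_u [w, x, y]"
| "coh_T _ = 0"

fun coh_g :: "label list \<Rightarrow> int" where
  "coh_g [v] = grp v"
| "coh_g _ = 0"

fun coh_gu :: "label list \<Rightarrow> int" where
  "coh_gu [v, w, x] = grp v * coh_u [v, w, x]"
| "coh_gu _ = 0"

lemma coh_a_shift: "coh_a (map (sh k) l) = coh_a l"
  by (cases l rule: coh_a.cases) (auto simp: sh_def mod_simps)

lemma coh_u_shift: "coh_u (map (sh k) l) = coh_u l"
  using coh_a_shift[of k "[_,_]"] by (cases l rule: coh_u.cases) auto

lemma coh_T_shift: "coh_T (map (sh k) l) = coh_T l"
  using coh_a_shift[of k "[_,_]"] coh_u_shift[of k "[_,_,_]"] by (cases l rule: coh_T.cases) auto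

text \<open>Before reduction modulo \<open>d\<close> the three differences add up to 0, so the
  division in \<open>coh_u\<close> is exact.\<close>

lemma d_coh_u: "d * coh_u [v, w, x] = coh_a [v, w] + coh_a [w, x] - coh_a [v, x]"
proof -
  have "coh_a [v, w] + coh_a [w, x] - coh_a [v, x]
     = d * ((grp x - grp v) div d - (grp w - grp v) div d - (grp x - grp w) div d)"
    unfolding coh_a.simps minus_mult_div_eq_mod[symmetric] by (simp add: algebra_simps)
  then have "d dvd coh_a [v, w] + coh_a [w, x] - coh_a [v, x]"
    by (metis dvd_triv_left)
  then show ?thesis unfolding coh_u.simps by (rule dvd_mult_div_cancel)
qed

lemma cobd_a: "cobd coh_a [v, w, x] = d * coh_u [v, w, x]"
  by (simp only: d_coh_u) simp

lemma cobd_u: "cobd coh_u [v, w, x, y] = 0"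
proof -
  have "d * cobd coh_u [v, w, x, y] =
      d * coh_u [w, x, y] - d * coh_u [v, x, y] + d * coh_u [v, w, y] - d * coh_u [v, w, x]"
    by (simp del: coh_a.simps coh_u.simps add: algebra_simps)
  also have "\<dots> = 0" unfolding d_coh_u by simp
  finally show ?thesis using d_pos by simp
qed

lemma coh_u_degenerate [simp]: "coh_u [v, v, x] = 0" "coh_u [v, x, x] = 0"
  by simp_all

text \<open>The Leibniz rule: the coboundary of \<open>coh_a\<close> is \<open>d\<close> times
  \<open>coh_u\<close>, and \<open>coh_u\<close> is a cocycle.\<close>

lemma cobd_T: "cobd coh_T [v, w, x, y, z] = d * (coh_u [v, w, x] * coh_u [x, y, z])"
proof -
  have u: "coh_u [w, x, y] = coh_u [x,y,z] - coh_u [w,y,z] + coh_u [w,x,z]"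
    using cobd_u[of w x y z] by simp
  have "cobd coh_T [v, w, x, y, z] =
     (coh_a [w, x] - coh_a [v, x]) * coh_u [x,y,z] + coh_a [v,w] * (coh_u [w,y,z] - coh_u [w,x,z] + coh_u [w,x,y])"
    by (simp del: coh_a.simps coh_u.simps add: algebra_simps)
  also have "\<dots> = (coh_a [v, w] + coh_a [w, x] - coh_a [v, x]) * coh_u [x,y,z]"
    unfolding u by (simp del: coh_a.simps coh_u.simps add: algebra_simps)
  also have "\<dots> = d * (coh_u [v, w, x] * coh_u [x, y, z])"
    unfolding d_coh_u[symmetric] by simp
  finally show ?thesis .
qed

lemma coh_a_eq: "coh_a [v, w] = cobd coh_g [v, w] - d * ((grp w - grp v) div d)"
  by (simp add: minus_mult_div_eq_mod)

lemma coh_T_eq: "coh_T [v, w, x, y] = cobd coh_gu [v, w, x, y] - d * ((grp w - grp v) div d * coh_u [w, x, y])"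
proof -
  have u: "coh_u [v, w, x] = coh_u [w,x,y] - coh_u [v,x,y] + coh_u [v,w,y]"
    using cobd_u[of v w x y] by simp
  have "cobd coh_gu [v, w, x, y] = (grp w - grp v) * coh_u [w, x, y]"
    by (simp del: coh_a.simps coh_u.simps add: u algebra_simps)
  then show ?thesis
    unfolding coh_T.simps coh_a.simps by (simp del: coh_u.simps add: algebra_simps minus_mult_div_eq_mod[symmetric])
qed

text \<open>Modulo \<open>d\<close> the failure of invariance is \<open>k\<close> times
  \<open>coh_u\<close>; this defect is the source of the nonzero values on the cells.\<close>

lemma coh_gu_shift:
  "coh_gu (map (sh k) [v, w, x]) = coh_gu [v, w, x] + k * coh_u [v, w, x] - d * ((grp v + k) div d * coh_u [v, w, x])"
proof -
  have e: "(grp v + k) mod d = grp v + k - d * ((grp v + k) div d)" by (simp add: minus_mult_div_eq_mod)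
  have "coh_gu (map (sh k) [v, w, x]) = grp (sh k v) * coh_u (map (sh k) [v, w, x])" by simp
  also have "\<dots> = (grp v + k) mod d * coh_u [v, w, x]"
    unfolding coh_u_shift by (simp add: sh_def)
  finally show ?thesis unfolding e by (simp del: coh_u.simps add: algebra_simps)
qed

text \<open>Five vertices with four indices in increasing order have two adjacent equal labels.
  These lie in one factor of \<open>cobd_T\<close>, and a factor with adjacent equal vertices is
  0.\<close>

lemma cobd_T_degenerate:
  assumes "length l = 5" "sorted (map idx l)" "\<forall>v\<in>set l. idx v < 4"
    and "\<And>v w. v \<in> set l \<Longrightarrow> w \<in> set l \<Longrightarrow> idx v = idx w \<Longrightarrow> v = w"
  shows "cobd coh_T l = 0"
proof -
  obtain v w x y z where l: "l = [v, w, x, y, z]"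
    using assms(1) by (auto simp: length_Suc_conv eval_nat_numeral)
  have *: "idx v \<le> idx w" "idx w \<le> idx x" "idx x \<le> idx y" "idx y \<le> idx z" "idx z < 4"
    using assms(2,3) by (auto simp: l)
  have "idx v = idx w \<or> idx w = idx x \<or> idx x = idx y \<or> idx y = idx z"
    using * by linarith
  then consider "v = w" | "w = x" | "x = y" | "y = z"
    using assms(4)[of v w] assms(4)[of w x] assms(4)[of x y] assms(4)[of y z]
    by (metis l list.set_intros)
  then show ?thesis
    by cases (simp_all only: l cobd_T coh_u_degenerate mult_zero_left mult_zero_right)
qed

lemma coh_T_degenerate:
  assumes "length l = 4" "sorted (map idx l)" "\<forall>v\<in>set l. idx v < 3"
    and "\<And>v w. v \<in> set l \<Longrightarrow> w \<in> set l \<Longrightarrow> idx v = idx w \<Longrightarrow> v = w"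
  shows "coh_T l = 0"
proof -
  obtain v w x y where l: "l = [v, w, x, y]"
    using assms(1) by (auto simp: length_Suc_conv eval_nat_numeral)
  have *: "idx v \<le> idx w" "idx w \<le> idx x" "idx x \<le> idx y" "idx y < 3"
    using assms(2,3) by (auto simp: l)
  have "idx v = idx w \<or> idx w = idx x \<or> idx x = idx y"
    using * by linarith
  then have "v = w \<or> w = x \<or> x = y"
    using assms(4)[of v w] assms(4)[of w x] assms(4)[of x y] by (simp add: l) blast
  then show ?thesis unfolding l coh_T.simps by (auto simp del: coh_u.simps)
qed

end

section \<open>The grid on the product of two discs\<close>

fun shift0 :: "nat \<Rightarrow> pos \<Rightarrow> pos" where "shift0 m (Pos a b c d) = Pos (a + m) b c d"
fun shift2 :: "nat \<Rightarrow> pos \<Rightarrow> pos" where "shift2 m (Pos a b c d) = Pos a b (c + m) d"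
fun coord1 :: "pos \<Rightarrow> nat" where "coord1 (Pos a b c d) = b"
fun coord3 :: "pos \<Rightarrow> nat" where "coord3 (Pos a b c d) = d"

lemma shift0_inc: "shift0 m (inc e p) = inc e (shift0 m p)" by (cases p) simp
lemma shift2_inc: "shift2 m (inc e p) = inc e (shift2 m p)" by (cases p) simp
lemma coord1_inc: "e \<in> {0, 2, 3} \<Longrightarrow> coord1 (inc e p) = coord1 p" by (cases p) auto
lemma coord3_inc: "e \<in> {0, 1, 2} \<Longrightarrow> coord3 (inc e p) = coord3 p" by (cases p) auto

text \<open>The boundary circles, at radius \<open>M\<close>, are wrapped \<open>n\<close> times: a step by \<open>K\<close> of the angle is
  the deck transformation, by which the two factors shift the group element in opposite directions.
  The centre of a disc occurs once for every angle.\<close>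

locale cell_labelling = consistent_grid \<l> + cyclic_cochains "int n"
  for \<l> :: "pos \<Rightarrow> label" and n :: nat +
  fixes K M :: nat
  assumes grp_range: "0 \<le> grp (\<l> p)" "grp (\<l> p) < int n"
    and rotate0: "\<l> (Pos (s + K) M s' t') = sh 1 (\<l> (Pos s M s' t'))"
    and rotate2: "\<l> (Pos s t (s' + K) M) = sh (-1) (\<l> (Pos s t s' M))"
    and centre0: "\<l> (Pos s 0 s' t') = \<l> (Pos 0 0 s' t')"
    and centre2: "\<l> (Pos s t s' 0) = \<l> (Pos s t 0 0)"
    and period0: "\<l> (Pos (s + n * K) t s' t') = \<l> (Pos s t s' t')"
    and period2: "\<l> (Pos s t (s' + n * K) t') = \<l> (Pos s t s' t')"
begin

abbreviation "N \<equiv> n * K"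

lemma sh_sh: "sh i (sh j v) = sh (i + j) v"
  by (simp add: sh_def mod_simps algebra_simps)

lemma sh_0: "sh 0 (\<l> p) = \<l> p"
  using grp_range[of p] by (simp add: sh_def)

lemma rotate0_k: "\<l> (Pos (s + k * K) M s' t') = sh (int k) (\<l> (Pos s M s' t'))"
proof (induction k)
  case 0
  then show ?case by (simp add: sh_0)
next
  case (Suc k)
  have "s + Suc k * K = (s + k * K) + K" by simp
  then show ?case using Suc by (simp only: rotate0 sh_sh) simp
qed

lemma rotate2_k: "\<l> (Pos s t (s' + k * K) M) = sh (- int k) (\<l> (Pos s t s' M))"
proof (induction k)
  case 0
  then show ?case by (simp add: sh_0)
next
  case (Suc k)
  have "s' + Suc k * K = (s' + k * K) + K" by simp
  then show ?case using Suc by (simp only: rotate2 sh_sh) simp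
qed

lemma equivariant_rotate0: "equivariant {0,2,3} (\<lambda>p. coord1 p = M) (shift0 (k * K)) (sh (int k))"
  unfolding equivariant_def
proof (intro conjI allI ballI impI)
  fix p assume "coord1 p = M"
  then show "\<l> (shift0 (k * K) p) = sh (int k) (\<l> p)"
    by (cases p) (simp add: rotate0_k)
qed (simp_all only: shift0_inc coord1_inc, simp add: sh_def)

lemma equivariant_rotate2: "equivariant {0,1,2} (\<lambda>p. coord3 p = M) (shift2 (k * K)) (sh (- int k))"
  unfolding equivariant_def
proof (intro conjI allI ballI impI)
  fix p assume "coord3 p = M"
  then show "\<l> (shift2 (k * K) p) = sh (- int k) (\<l> p)"
    by (cases p) (simp add: rotate2_k)
qed (simp_all only: shift2_inc coord3_inc, simp add: sh_def)

lemma equivariant_period0: "equivariant UNIV (\<lambda>p. True) (shift0 N) id"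
  unfolding equivariant_def
proof (intro conjI allI ballI impI)
  fix p show "\<l> (shift0 N p) = id (\<l> p)"
    by (cases p) (simp add: period0)
qed (simp_all only: shift0_inc id_def)

lemma equivariant_period2: "equivariant UNIV (\<lambda>p. True) (shift2 N) id"
  unfolding equivariant_def
proof (intro conjI allI ballI impI)
  fix p show "\<l> (shift2 N p) = id (\<l> p)"
    by (cases p) (simp add: period2)
qed (simp_all only: shift2_inc id_def)

text \<open>At radius 0 the angle is collapsed, so cells over the centre that extend in this
  direction contribute nothing.\<close>

lemma constant_centre0: "constant_along 0 {0,2,3} (\<lambda>p. coord1 p = 0)"
  unfolding constant_along_def
proof (intro conjI allI ballI impI)
  fix p assume p: "coord1 p = 0"
  obtain a b c d where "p = Pos a b c d" by (cases p)
  with p show "\<l> (inc 0 p) = \<l> p"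
    using centre0[of "Suc a" c d] centre0[of a c d] by simp
qed (simp only: coord1_inc)

lemma constant_centre2: "constant_along 2 {0,1,2} (\<lambda>p. coord3 p = 0)"
  unfolding constant_along_def
proof (intro conjI allI ballI impI)
  fix p assume p: "coord3 p = 0"
  obtain a b c d where "p = Pos a b c d" by (cases p)
  with p show "\<l> (inc 2 p) = \<l> p"
    using centre2[of a b "Suc c"] centre2[of a b c] by simp
qed (simp only: coord3_inc)

lemma period_ev1: "e < 4 \<Longrightarrow> ev1 e \<phi> (Pos (s + N) t s' t') = ev1 e \<phi> (Pos s t s' t')"
    "e < 4 \<Longrightarrow> ev1 e \<phi> (Pos s t (s' + N) t') = ev1 e \<phi> (Pos s t s' t')"
  using ev1_equivariant[OF equivariant_period0, where p = "Pos s t s' t'" and \<phi> = \<phi> and e = e]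
    ev1_equivariant[OF equivariant_period2, where p = "Pos s t s' t'" and \<phi> = \<phi> and e = e] by (simp_all add: comp_def)

lemma period_ev2: "e < f \<Longrightarrow> f < 4 \<Longrightarrow> ev2 e f \<phi> (Pos (s + N) t s' t') = ev2 e f \<phi> (Pos s t s' t')"
    "e < f \<Longrightarrow> f < 4 \<Longrightarrow> ev2 e f \<phi> (Pos s t (s' + N) t') = ev2 e f \<phi> (Pos s t s' t')"
  using ev2_equivariant[OF equivariant_period0, where p = "Pos s t s' t'" and \<phi> = \<phi> and e = e and f = f]
    ev2_equivariant[OF equivariant_period2, where p = "Pos s t s' t'" and \<phi> = \<phi> and e = e and f = f] by (simp_all add: comp_def)

lemma period_ev3: "e < f \<Longrightarrow> f < g \<Longrightarrow> g < 4 \<Longrightarrow> ev3 e f g \<phi> (Pos (s + N) t s' t') = ev3 e f g \<phi> (Pos s t s' t')"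
    "e < f \<Longrightarrow> f < g \<Longrightarrow> g < 4 \<Longrightarrow> ev3 e f g \<phi> (Pos s t (s' + N) t') = ev3 e f g \<phi> (Pos s t s' t')"
  using ev3_equivariant[OF equivariant_period0, where p = "Pos s t s' t'" and \<phi> = \<phi> and e = e and f = f and g = g]
    ev3_equivariant[OF equivariant_period2, where p = "Pos s t s' t'" and \<phi> = \<phi> and e = e and f = f and g = g] by (simp_all add: comp_def)

text \<open>Cuts the full circle of \<open>N\<close> steps into \<open>n\<close> arcs, which are
  permuted by the deck transformations when they lie at radius \<open>M\<close>.\<close>

lemma sum_blocks: "(\<Sum>s<N. f s) = (\<Sum>k<n. \<Sum>s<K. f (s + k * K))" for f :: "nat \<Rightarrow> int"
proof -
  have "(\<Sum>s<N. f s) = (\<Sum>k<n. sum f {k * K..<k * K + K})"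
    by (rule sum.nat_group[symmetric])
  also have "\<dots> = (\<Sum>k<n. \<Sum>s<K. f (s + k * K))"
  proof (rule sum.cong[OF refl])
    fix k
    show "sum f {k * K..<k * K + K} = (\<Sum>s<K. f (s + k * K))"
      using sum.shift_bounds_nat_ivl[of f 0 "k * K" K] by (simp add: atLeast0LessThan add.commute)
  qed
  finally show ?thesis .
qed

lemma ev1_a: "int n dvd ev1 e coh_a p - (grp (\<l> (inc e p)) - grp (\<l> p))"
proof -
  define R where "R l = (grp (l ! Suc 0) - grp (l ! 0)) div int n" for l :: "label list"
  have "ev1 e coh_a p = ev1 e (\<lambda>l. cobd coh_g l - int n * R l) p"
  proof (rule ev1_cong)
    fix l assume "l \<in> chains [e] p"
    then obtain v w where "l = [v, w]"
      by (auto simp: chains_def length_Suc_conv eval_nat_numeral)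
    then show "coh_a l = cobd coh_g l - int n * R l"
      by (simp only: coh_a_eq R_def nth_Cons_0 One_nat_def nth_Cons_Suc)
  qed
  also have "\<dots> = grp (\<l> (inc e p)) - grp (\<l> p) - int n * ev1 e R p"
    by (simp only: ev1_lin stokes1) (simp add: diff_def ev0_def)
  finally show ?thesis by simp
qed

lemma ev2_u: "int n * ev2 e f coh_u p = diff e (ev1 f) coh_a p - diff f (ev1 e) coh_a p"
proof -
  have "ev2 e f (cobd coh_a) p = ev2 e f (\<lambda>l. 0 - (- int n) * coh_u l) p"
  proof (rule ev2_cong)
    fix l assume "l \<in> chains [e,f] p"
    then obtain v w x where "l = [v, w, x]"
      by (auto simp: chains_def length_Suc_conv eval_nat_numeral)
    then show "cobd coh_a l = 0 - (- int n) * coh_u l"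
      by (simp only: cobd_a)
  qed
  also have "\<dots> = int n * ev2 e f coh_u p" by (simp only: ev2_lin) simp
  finally show ?thesis by (simp add: stokes2)
qed

lemma ev3_T: "int n dvd ev3 e f g coh_T p -
   (diff e (ev2 f g) coh_gu p - diff f (ev2 e g) coh_gu p + diff g (ev2 e f) coh_gu p)"
proof -
  define R where "R l = (grp (l ! Suc 0) - grp (l ! 0)) div int n * coh_u (tl l)" for l :: "label list"
  have "ev3 e f g coh_T p = ev3 e f g (\<lambda>l. cobd coh_gu l - int n * R l) p"
  proof (rule ev3_cong)
    fix l assume "l \<in> chains [e,f,g] p"
    then obtain v w x y where "l = [v, w, x, y]"
      by (auto simp: chains_def length_Suc_conv eval_nat_numeral)
    then show "coh_T l = cobd coh_gu l - int n * R l"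
      by (simp only: coh_T_eq R_def nth_Cons_0 One_nat_def nth_Cons_Suc list.sel)
  qed
  also have "\<dots> = ev3 e f g (cobd coh_gu) p - int n * ev3 e f g R p"
    by (rule ev3_lin)
  finally show ?thesis by (simp add: stokes3)
qed

lemma ev2_gu_shift: "int n dvd ev2 e f (coh_gu \<circ> map (sh k)) p - (ev2 e f coh_gu p + k * ev2 e f coh_u p)"
proof -
  define R where "R l = (grp (l ! 0) + k) div int n * coh_u l" for l :: "label list"
  have "ev2 e f (coh_gu \<circ> map (sh k)) p = ev2 e f (\<lambda>l. (coh_gu l - (- k) * coh_u l) - int n * R l) p"
  proof (rule ev2_cong)
    fix l assume "l \<in> chains [e,f] p"
    then obtain v w x where "l = [v, w, x]"
      by (auto simp: chains_def length_Suc_conv eval_nat_numeral)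
    then show "(coh_gu \<circ> map (sh k)) l = (coh_gu l - (- k) * coh_u l) - int n * R l"
      using coh_gu_shift[of k v w x] by (simp add: R_def del: coh_u.simps coh_gu.simps)
  qed
  also have "\<dots> = ev2 e f coh_gu p + k * ev2 e f coh_u p - int n * ev2 e f R p"
    unfolding ev2_lin by simp
  finally show ?thesis by simp
qed

lemma rotate_ev1_0: "ev1 e coh_a (Pos (s + k * K) M s' t') = ev1 e coh_a (Pos s M s' t')" if "e \<in> {0,2,3}"
  using ev1_equivariant[OF equivariant_rotate0, of "Pos s M s' t'" e coh_a k] that
  by (auto simp: comp_def coh_a_shift)
lemma rotate_ev1_2: "ev1 e coh_a (Pos s t (s' + k * K) M) = ev1 e coh_a (Pos s t s' M)" if "e \<in> {0,1,2}"
  using ev1_equivariant[OF equivariant_rotate2, of "Pos s t s' M" e coh_a k] that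
  by (auto simp: comp_def coh_a_shift)
lemma rotate_ev3_0: "ev3 0 2 3 coh_T (Pos (s + k * K) M s' t') = ev3 0 2 3 coh_T (Pos s M s' t')"
  using ev3_equivariant[OF equivariant_rotate0, of "Pos s M s' t'" 0 2 3 coh_T k]
  by (simp add: comp_def coh_T_shift)
lemma rotate_ev3_2: "ev3 0 1 2 coh_T (Pos s t (s' + k * K) M) = ev3 0 1 2 coh_T (Pos s t s' M)"
  using ev3_equivariant[OF equivariant_rotate2, of "Pos s t s' M" 0 1 2 coh_T k]
  by (simp add: comp_def coh_T_shift)

lemma rotate_gu_0: "int n dvd ev2 e f coh_gu (Pos (s + k * K) M s' t') -
   (ev2 e f coh_gu (Pos s M s' t') + int k * ev2 e f coh_u (Pos s M s' t'))" if "{e,f} \<subseteq> {0,2,3}" "e < f"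
  using ev2_equivariant[OF equivariant_rotate0, of "Pos s M s' t'" e f coh_gu k] that
    ev2_gu_shift[of e f "int k" "Pos s M s' t'"] by auto
lemma rotate_gu_2: "int n dvd ev2 e f coh_gu (Pos s t (s' + k * K) M) -
   (ev2 e f coh_gu (Pos s t s' M) - int k * ev2 e f coh_u (Pos s t s' M))" if "{e,f} \<subseteq> {0,1,2}" "e < f"
  using ev2_equivariant[OF equivariant_rotate2, of "Pos s t s' M" e f coh_gu k] that
    ev2_gu_shift[of e f "- int k" "Pos s t s' M"] by auto

section \<open>Values of the cochains on the cells\<close>

text \<open>\<open>alpha\<close> and \<open>beta\<close> evaluate the degree 1 class on one arc in
  each factor, which becomes a closed loop in the cone. \<open>delta\<close> and
  \<open>epsilon\<close> evaluate its Bockstein on the two discs, \<open>cell_a\<close> and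
  \<open>cell_b\<close> the class in degree 3 on circle times disc and on disc times circle.\<close>

definition alpha where "alpha = (\<Sum>s<K. ev1 0 coh_a (Pos s M 0 M))"
definition beta where "beta = (\<Sum>s'<K. ev1 2 coh_a (Pos 0 M s' M))"
definition delta where "delta = (\<Sum>s<N. \<Sum>t<M. ev2 0 1 coh_u (Pos s t 0 M))"
definition epsilon where "epsilon = (\<Sum>s'<N. \<Sum>t'<M. ev2 2 3 coh_u (Pos 0 M s' t'))"
definition cell_a where "cell_a = (\<Sum>s<K. \<Sum>s'<N. \<Sum>t'<M. ev3 0 2 3 coh_T (Pos s M s' t'))"
definition cell_b where "cell_b = (\<Sum>s<N. \<Sum>t<M. \<Sum>s'<K. ev3 0 1 2 coh_T (Pos s t s' M))"

lemma dvd_sum_diff: "(\<And>x. x \<in> A \<Longrightarrow> c dvd f x - g x) \<Longrightarrow> c dvd (\<Sum>x\<in>A. f x) - (\<Sum>x\<in>A. g x)" for c :: int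
  by (simp add: sum_subtractf[symmetric] dvd_sum)

lemma grp_sh_diff: "int n dvd grp (sh k v) - grp v - k"
  by (simp add: sh_def minus_mult_div_eq_mod[symmetric])

text \<open>Modulo \<open>n\<close> the sum telescopes to the shift of the group element by one deck
  transformation.\<close>

lemma alpha_eq: "int n dvd alpha - 1"
proof -
  have 1: "int n dvd alpha - (\<Sum>s<K. grp (\<l> (Pos (Suc s) M 0 M)) - grp (\<l> (Pos s M 0 M)))"
    unfolding alpha_def using ev1_a[of 0 "Pos _ M 0 M"] by (intro dvd_sum_diff) simp
  have 2: "(\<Sum>s<K. grp (\<l> (Pos (Suc s) M 0 M)) - grp (\<l> (Pos s M 0 M))) =
      grp (sh 1 (\<l> (Pos 0 M 0 M))) - grp (\<l> (Pos 0 M 0 M))"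
    using rotate0[of 0 0 M] by (subst sum_lessThan_telescope) simp
  from dvd_add[OF 1[unfolded 2] grp_sh_diff[of "1" "\<l> (Pos 0 M 0 M)"]] show ?thesis
    by simp
qed

lemma beta_eq: "int n dvd beta + 1"
proof -
  have 1: "int n dvd beta - (\<Sum>s<K. grp (\<l> (Pos 0 M (Suc s) M)) - grp (\<l> (Pos 0 M s M)))"
    unfolding beta_def using ev1_a[of 2 "Pos 0 M _ M"] by (intro dvd_sum_diff) simp
  have 2: "(\<Sum>s<K. grp (\<l> (Pos 0 M (Suc s) M)) - grp (\<l> (Pos 0 M s M))) =
      grp (sh (-1) (\<l> (Pos 0 M 0 M))) - grp (\<l> (Pos 0 M 0 M))"
    using rotate2[of 0 M 0] by (subst sum_lessThan_telescope) simp
  from dvd_add[OF 1[unfolded 2] grp_sh_diff[of "-1" "\<l> (Pos 0 M 0 M)"]] show ?thesis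
    by simp
qed

text \<open>The boundary of the disc runs \<open>n\<close> times over the arc and
  \<open>n * coh_u\<close> is a coboundary, so Stokes gives \<open>n * delta = - n * alpha\<close>,
  to be divided by \<open>n\<close> over the integers. The sign comes from listing the angle before
  the radius.\<close>

lemma delta_eq: "delta = - alpha"
proof -
  have 1: "(\<Sum>s<N. \<Sum>t<M. diff 0 (ev1 1) coh_a (Pos s t 0 M)) = 0"
  proof -
    have "(\<Sum>s<N. \<Sum>t<M. diff 0 (ev1 1) coh_a (Pos s t 0 M)) =
      (\<Sum>t<M. \<Sum>s<N. ev1 1 coh_a (Pos (Suc s) t 0 M) - ev1 1 coh_a (Pos s t 0 M))"
      by (subst sum.swap) (simp add: diff_def)
    also have "\<dots> = (\<Sum>t<M. ev1 1 coh_a (Pos N t 0 M) - ev1 1 coh_a (Pos 0 t 0 M))"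
      by (subst sum_lessThan_telescope) simp
    also have "\<dots> = 0" using period_ev1(1)[of 1 coh_a 0] by simp
    finally show ?thesis .
  qed
  have "(\<Sum>s<N. \<Sum>t<M. diff 1 (ev1 0) coh_a (Pos s t 0 M)) =
      (\<Sum>s<N. \<Sum>t<M. ev1 0 coh_a (Pos s (Suc t) 0 M) - ev1 0 coh_a (Pos s t 0 M))"
    by (simp add: diff_def)
  also have "\<dots> = (\<Sum>s<N. ev1 0 coh_a (Pos s M 0 M) - ev1 0 coh_a (Pos s 0 0 M))"
    by (subst sum_lessThan_telescope) simp
  also have "\<dots> = (\<Sum>s<N. ev1 0 coh_a (Pos s M 0 M))"
    using ev1_const[OF constant_centre0] by simp
  also have "\<dots> = int n * alpha"
    unfolding sum_blocks alpha_def by (simp add: rotate_ev1_0)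
  finally have 2: "(\<Sum>s<N. \<Sum>t<M. diff 1 (ev1 0) coh_a (Pos s t 0 M)) = int n * alpha" .
  have "int n * delta = 0 - int n * alpha"
    unfolding delta_def sum_distrib_left ev2_u sum_subtractf 1 2 ..
  then have "int n * (delta + alpha) = 0" by (simp add: algebra_simps)
  then show ?thesis using d_pos by (simp add: eq_neg_iff_add_eq_0)
qed

lemma epsilon_eq: "epsilon = - beta"
proof -
  have 1: "(\<Sum>s<N. \<Sum>t<M. diff 2 (ev1 3) coh_a (Pos 0 M s t)) = 0"
  proof -
    have "(\<Sum>s<N. \<Sum>t<M. diff 2 (ev1 3) coh_a (Pos 0 M s t)) =
      (\<Sum>t<M. \<Sum>s<N. ev1 3 coh_a (Pos 0 M (Suc s) t) - ev1 3 coh_a (Pos 0 M s t))"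
      by (subst sum.swap) (simp add: diff_def)
    also have "\<dots> = (\<Sum>t<M. ev1 3 coh_a (Pos 0 M N t) - ev1 3 coh_a (Pos 0 M 0 t))"
      by (subst sum_lessThan_telescope) simp
    also have "\<dots> = 0" using period_ev1(2)[of 3 coh_a _ _ 0] by simp
    finally show ?thesis .
  qed
  have "(\<Sum>s<N. \<Sum>t<M. diff 3 (ev1 2) coh_a (Pos 0 M s t)) =
      (\<Sum>s<N. \<Sum>t<M. ev1 2 coh_a (Pos 0 M s (Suc t)) - ev1 2 coh_a (Pos 0 M s t))"
    by (simp add: diff_def)
  also have "\<dots> = (\<Sum>s<N. ev1 2 coh_a (Pos 0 M s M) - ev1 2 coh_a (Pos 0 M s 0))"
    by (subst sum_lessThan_telescope) simp
  also have "\<dots> = (\<Sum>s<N. ev1 2 coh_a (Pos 0 M s M))"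
    using ev1_const[OF constant_centre2] by simp
  also have "\<dots> = int n * beta"
    unfolding sum_blocks beta_def by (simp add: rotate_ev1_2)
  finally have 2: "(\<Sum>s<N. \<Sum>t<M. diff 3 (ev1 2) coh_a (Pos 0 M s t)) = int n * beta" .
  have "int n * epsilon = 0 - int n * beta"
    unfolding epsilon_def sum_distrib_left ev2_u sum_subtractf 1 2 ..
  then have "int n * (epsilon + beta) = 0" by (simp add: algebra_simps)
  then show ?thesis using d_pos by (simp add: eq_neg_iff_add_eq_0)
qed

text \<open>A block of \<open>K\<close> by \<open>K\<close> steps on the outer torus closes up under
  the two deck transformations. They preserve \<open>coh_a\<close>, so Stokes leaves no boundary
  term.\<close>

lemma nu_u: "(\<Sum>s<K. \<Sum>s'<K. ev2 0 2 coh_u (Pos s M s' M)) = 0"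
proof -
  have 1: "(\<Sum>s<K. \<Sum>s'<K. diff 0 (ev1 2) coh_a (Pos s M s' M)) = 0"
  proof -
    have "(\<Sum>s<K. \<Sum>s'<K. diff 0 (ev1 2) coh_a (Pos s M s' M)) =
      (\<Sum>s'<K. \<Sum>s<K. ev1 2 coh_a (Pos (Suc s) M s' M) - ev1 2 coh_a (Pos s M s' M))"
      by (subst sum.swap) (simp add: diff_def)
    also have "\<dots> = (\<Sum>s'<K. ev1 2 coh_a (Pos K M s' M) - ev1 2 coh_a (Pos 0 M s' M))"
      by (subst sum_lessThan_telescope) simp
    also have "\<dots> = 0" using rotate_ev1_0[of 2 0 1] by simp
    finally show ?thesis .
  qed
  have "(\<Sum>s<K. \<Sum>s'<K. diff 2 (ev1 0) coh_a (Pos s M s' M)) =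
      (\<Sum>s<K. \<Sum>s'<K. ev1 0 coh_a (Pos s M (Suc s') M) - ev1 0 coh_a (Pos s M s' M))"
    by (simp add: diff_def)
  also have "\<dots> = (\<Sum>s<K. ev1 0 coh_a (Pos s M K M) - ev1 0 coh_a (Pos s M 0 M))"
    by (subst sum_lessThan_telescope) simp
  also have "\<dots> = 0" using rotate_ev1_2[of 0 _ M 0 1] by simp
  finally have 2: "(\<Sum>s<K. \<Sum>s'<K. diff 2 (ev1 0) coh_a (Pos s M s' M)) = 0" .
  have "int n * (\<Sum>s<K. \<Sum>s'<K. ev2 0 2 coh_u (Pos s M s' M)) = 0 - 0"
    unfolding sum_distrib_left ev2_u sum_subtractf 1 2 ..
  then show ?thesis using d_pos by simp
qed

text \<open>The \<open>k\<close>-th of the \<open>n\<close> rotated blocks has the value of the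
  block at \<open>k = 0\<close> plus \<open>k\<close> times that of \<open>coh_u\<close>, which is 0
  by \<open>nu_u\<close>; so the total is \<open>n\<close> times the value of one block.\<close>

lemma nu_gu_0: "int n dvd (\<Sum>s<N. \<Sum>s'<K. ev2 0 2 coh_gu (Pos s M s' M))"
proof -
  let ?G = "\<Sum>s<K. \<Sum>s'<K. ev2 0 2 coh_gu (Pos s M s' M)"
  have "int n dvd (\<Sum>k<n. \<Sum>s<K. \<Sum>s'<K. ev2 0 2 coh_gu (Pos (s + k * K) M s' M)) -
      (\<Sum>k<n. \<Sum>s<K. \<Sum>s'<K. ev2 0 2 coh_gu (Pos s M s' M) + int k * ev2 0 2 coh_u (Pos s M s' M))"
    by (intro dvd_sum_diff rotate_gu_0) auto
  moreover have "(\<Sum>k<n. \<Sum>s<K. \<Sum>s'<K. ev2 0 2 coh_gu (Pos s M s' M) + int k * ev2 0 2 coh_u (Pos s M s' M)) = int n * ?G"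
    by (simp add: sum.distrib flip: sum_distrib_left) (simp add: nu_u)
  ultimately show ?thesis unfolding sum_blocks
    using dvd_add[OF _ dvd_triv_left[of "int n" ?G]] by fastforce
qed

lemma nu_gu_2: "int n dvd (\<Sum>s<K. \<Sum>s'<N. ev2 0 2 coh_gu (Pos s M s' M))"
proof -
  let ?G = "\<Sum>s<K. \<Sum>s'<K. ev2 0 2 coh_gu (Pos s M s' M)"
  have "int n dvd (\<Sum>s<K. \<Sum>k<n. \<Sum>s'<K. ev2 0 2 coh_gu (Pos s M (s' + k * K) M)) -
      (\<Sum>s<K. \<Sum>k<n. \<Sum>s'<K. ev2 0 2 coh_gu (Pos s M s' M) - int k * ev2 0 2 coh_u (Pos s M s' M))"
    by (intro dvd_sum_diff rotate_gu_2) auto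
  moreover have "(\<Sum>s<K. \<Sum>k<n. \<Sum>s'<K. ev2 0 2 coh_gu (Pos s M s' M) - int k * ev2 0 2 coh_u (Pos s M s' M)) = int n * ?G"
    by (subst sum.swap) (simp add: sum_subtractf nu_u flip: sum_distrib_left)
  ultimately show ?thesis unfolding sum_blocks
    using dvd_add[OF _ dvd_triv_left[of "int n" ?G]] by fastforce
qed

text \<open>Stokes for \<open>coh_gu\<close> modulo \<open>n\<close>: the faces in direction 0
  cancel by periodicity, the inner radial face is degenerate and the outer one divisible by
  \<open>n\<close>. The faces in direction 2 differ by a shift by -1, whose defect is
  \<open>- delta = alpha\<close>.\<close>

lemma cell_b_eq: "int n dvd cell_b - 1"
proof -
  have 1: "(\<Sum>s<N. \<Sum>t<M. \<Sum>s'<K. diff 0 (ev2 1 2) coh_gu (Pos s t s' M)) = 0"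
  proof -
    have "(\<Sum>s<N. \<Sum>t<M. \<Sum>s'<K. diff 0 (ev2 1 2) coh_gu (Pos s t s' M)) =
      (\<Sum>t<M. \<Sum>s'<K. \<Sum>s<N. ev2 1 2 coh_gu (Pos (Suc s) t s' M) - ev2 1 2 coh_gu (Pos s t s' M))"
      by (subst sum.swap, rule sum.cong[OF refl], subst sum.swap) (simp add: diff_def)
    also have "\<dots> = (\<Sum>t<M. \<Sum>s'<K. ev2 1 2 coh_gu (Pos N t s' M) - ev2 1 2 coh_gu (Pos 0 t s' M))"
      by (subst sum_lessThan_telescope) simp
    also have "\<dots> = 0" using period_ev2(1)[of 1 2 coh_gu 0] by simp
    finally show ?thesis .
  qed
  have 2: "int n dvd (\<Sum>s<N. \<Sum>t<M. \<Sum>s'<K. diff 1 (ev2 0 2) coh_gu (Pos s t s' M))"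
  proof -
    have "(\<Sum>s<N. \<Sum>t<M. \<Sum>s'<K. diff 1 (ev2 0 2) coh_gu (Pos s t s' M)) =
      (\<Sum>s<N. \<Sum>s'<K. \<Sum>t<M. ev2 0 2 coh_gu (Pos s (Suc t) s' M) - ev2 0 2 coh_gu (Pos s t s' M))"
      by (rule sum.cong[OF refl], subst sum.swap) (simp add: diff_def)
    also have "\<dots> = (\<Sum>s<N. \<Sum>s'<K. ev2 0 2 coh_gu (Pos s M s' M) - ev2 0 2 coh_gu (Pos s 0 s' M))"
      by (subst sum_lessThan_telescope) simp
    also have "\<dots> = (\<Sum>s<N. \<Sum>s'<K. ev2 0 2 coh_gu (Pos s M s' M))"
      using ev2_const1[OF constant_centre0, of _ 2] by simp
    finally show ?thesis using nu_gu_0 by simp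
  qed
  have 3: "int n dvd (\<Sum>s<N. \<Sum>t<M. \<Sum>s'<K. diff 2 (ev2 0 1) coh_gu (Pos s t s' M)) + delta"
  proof -
    have "(\<Sum>s<N. \<Sum>t<M. \<Sum>s'<K. diff 2 (ev2 0 1) coh_gu (Pos s t s' M)) =
      (\<Sum>s<N. \<Sum>t<M. \<Sum>s'<K. ev2 0 1 coh_gu (Pos s t (Suc s') M) - ev2 0 1 coh_gu (Pos s t s' M))"
      by (simp add: diff_def)
    also have "\<dots> = (\<Sum>s<N. \<Sum>t<M. ev2 0 1 coh_gu (Pos s t K M) - ev2 0 1 coh_gu (Pos s t 0 M))"
      by (subst sum_lessThan_telescope) simp
    finally have e: "(\<Sum>s<N. \<Sum>t<M. \<Sum>s'<K. diff 2 (ev2 0 1) coh_gu (Pos s t s' M)) =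
      (\<Sum>s<N. \<Sum>t<M. ev2 0 1 coh_gu (Pos s t K M) - ev2 0 1 coh_gu (Pos s t 0 M))" .
    have "int n dvd (\<Sum>s<N. \<Sum>t<M. ev2 0 1 coh_gu (Pos s t K M) - ev2 0 1 coh_gu (Pos s t 0 M)) -
       (\<Sum>s<N. \<Sum>t<M. - ev2 0 1 coh_u (Pos s t 0 M))"
      using rotate_gu_2[of 0 1 _ _ 0 1] by (intro dvd_sum_diff) (simp add: algebra_simps)
    then show ?thesis unfolding e delta_def by (simp add: sum_negf)
  qed
  have "int n dvd cell_b - (\<Sum>s<N. \<Sum>t<M. \<Sum>s'<K.
      diff 0 (ev2 1 2) coh_gu (Pos s t s' M) - diff 1 (ev2 0 2) coh_gu (Pos s t s' M) + diff 2 (ev2 0 1) coh_gu (Pos s t s' M))"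
    unfolding cell_b_def by (intro dvd_sum_diff ev3_T)
  then have "int n dvd cell_b - (0 - (\<Sum>s<N. \<Sum>t<M. \<Sum>s'<K. diff 1 (ev2 0 2) coh_gu (Pos s t s' M)) +
    (\<Sum>s<N. \<Sum>t<M. \<Sum>s'<K. diff 2 (ev2 0 1) coh_gu (Pos s t s' M)))"
    unfolding sum.distrib sum_subtractf 1 .
  from dvd_add[OF dvd_diff[OF dvd_add[OF this 3] 2] alpha_eq] show ?thesis
    by (simp add: delta_eq)
qed

text \<open>As for \<open>cell_b\<close>, with the roles of the factors exchanged: the shift is by 1
  and the defect is \<open>epsilon = - beta\<close>. As the two shifts are opposite, both cells have
  the same value and do not cancel in the sum over the boundary.\<close>

lemma cell_a_eq: "int n dvd cell_a - 1"
proof -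
  have 1: "(\<Sum>s<K. \<Sum>s'<N. \<Sum>t'<M. diff 2 (ev2 0 3) coh_gu (Pos s M s' t')) = 0"
  proof -
    have "(\<Sum>s<K. \<Sum>s'<N. \<Sum>t'<M. diff 2 (ev2 0 3) coh_gu (Pos s M s' t')) =
      (\<Sum>s<K. \<Sum>t'<M. \<Sum>s'<N. ev2 0 3 coh_gu (Pos s M (Suc s') t') - ev2 0 3 coh_gu (Pos s M s' t'))"
      by (rule sum.cong[OF refl], subst sum.swap) (simp add: diff_def)
    also have "\<dots> = (\<Sum>s<K. \<Sum>t'<M. ev2 0 3 coh_gu (Pos s M N t') - ev2 0 3 coh_gu (Pos s M 0 t'))"
      by (subst sum_lessThan_telescope) simp
    also have "\<dots> = 0" using period_ev2(2)[of 0 3 coh_gu _ _ 0] by simp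
    finally show ?thesis .
  qed
  have 2: "int n dvd (\<Sum>s<K. \<Sum>s'<N. \<Sum>t'<M. diff 3 (ev2 0 2) coh_gu (Pos s M s' t'))"
  proof -
    have "(\<Sum>s<K. \<Sum>s'<N. \<Sum>t'<M. diff 3 (ev2 0 2) coh_gu (Pos s M s' t')) =
      (\<Sum>s<K. \<Sum>s'<N. \<Sum>t'<M. ev2 0 2 coh_gu (Pos s M s' (Suc t')) - ev2 0 2 coh_gu (Pos s M s' t'))"
      by (simp add: diff_def)
    also have "\<dots> = (\<Sum>s<K. \<Sum>s'<N. ev2 0 2 coh_gu (Pos s M s' M) - ev2 0 2 coh_gu (Pos s M s' 0))"
      by (subst sum_lessThan_telescope) simp
    also have "\<dots> = (\<Sum>s<K. \<Sum>s'<N. ev2 0 2 coh_gu (Pos s M s' M))"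
      using ev2_const2[OF constant_centre2, of _ 0] by simp
    finally show ?thesis using nu_gu_2 by simp
  qed
  have 3: "int n dvd (\<Sum>s<K. \<Sum>s'<N. \<Sum>t'<M. diff 0 (ev2 2 3) coh_gu (Pos s M s' t')) - epsilon"
  proof -
    have "(\<Sum>s<K. \<Sum>s'<N. \<Sum>t'<M. diff 0 (ev2 2 3) coh_gu (Pos s M s' t')) =
      (\<Sum>s'<N. \<Sum>t'<M. \<Sum>s<K. ev2 2 3 coh_gu (Pos (Suc s) M s' t') - ev2 2 3 coh_gu (Pos s M s' t'))"
      by (subst sum.swap, rule sum.cong[OF refl], subst sum.swap) (simp add: diff_def)
    also have "\<dots> = (\<Sum>s'<N. \<Sum>t'<M. ev2 2 3 coh_gu (Pos K M s' t') - ev2 2 3 coh_gu (Pos 0 M s' t'))"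
      by (subst sum_lessThan_telescope) simp
    finally have e: "(\<Sum>s<K. \<Sum>s'<N. \<Sum>t'<M. diff 0 (ev2 2 3) coh_gu (Pos s M s' t')) =
      (\<Sum>s'<N. \<Sum>t'<M. ev2 2 3 coh_gu (Pos K M s' t') - ev2 2 3 coh_gu (Pos 0 M s' t'))" .
    have "int n dvd (\<Sum>s'<N. \<Sum>t'<M. ev2 2 3 coh_gu (Pos K M s' t') - ev2 2 3 coh_gu (Pos 0 M s' t')) -
       (\<Sum>s'<N. \<Sum>t'<M. ev2 2 3 coh_u (Pos 0 M s' t'))"
      using rotate_gu_0[of 2 3 0 1] by (intro dvd_sum_diff) (simp add: algebra_simps)
    then show ?thesis unfolding e epsilon_def .
  qed
  have "int n dvd cell_a - (\<Sum>s<K. \<Sum>s'<N. \<Sum>t'<M.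
      diff 0 (ev2 2 3) coh_gu (Pos s M s' t') - diff 2 (ev2 0 3) coh_gu (Pos s M s' t') + diff 3 (ev2 0 2) coh_gu (Pos s M s' t'))"
    unfolding cell_a_def by (intro dvd_sum_diff ev3_T)
  then have "int n dvd cell_a - ((\<Sum>s<K. \<Sum>s'<N. \<Sum>t'<M. diff 0 (ev2 2 3) coh_gu (Pos s M s' t')) - 0 +
    (\<Sum>s<K. \<Sum>s'<N. \<Sum>t'<M. diff 3 (ev2 0 2) coh_gu (Pos s M s' t')))"
    unfolding sum.distrib sum_subtractf 1 .
  from dvd_diff[OF dvd_add[OF dvd_add[OF this 3] 2] beta_eq] show ?thesis
    by (simp add: epsilon_eq)
qed

lemma corners_chain_consistent:
  assumes "l \<in> chains E p" "corners E p \<subseteq> cube p" "v \<in> set l" "w \<in> set l" "idx v = idx w"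
  shows "v = w"
proof -
  from assms(1,3,4) obtain q q' where q: "q \<in> corners E p" "q' \<in> corners E p" "v = \<l> q" "w = \<l> q'"
    unfolding chains_def by blast
  then show ?thesis using consistent[of q p q'] assms(2,5) by blast
qed

text \<open>The product of a disc and a circle has \<open>coh_T\<close>-value 1 modulo \<open>n\<close>, but \<open>coh_T\<close> vanishes on
  four vertices as soon as two adjacent ones have the same index.\<close>

theorem three_indices:
  assumes "\<And>p. idx (\<l> p) < 3"
  shows "n = 1"
proof -
  have "ev3 0 1 2 coh_T p = 0" for p
  proof -
    have sub: "corners [0, 1, 2] p \<subseteq> cube p" by (cases p) (auto simp: cube_def)
    have "ev3 0 1 2 coh_T p = ev3 0 1 2 (\<lambda>l. 0) p"
    proof (rule ev3_cong)
      fix l assume l: "l \<in> chains [0, 1, 2] p"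
      show "coh_T l = 0"
        using l assms by (intro coh_T_degenerate corners_chain_consistent[OF l sub]) (auto simp: chains_def)
    qed
    then show ?thesis by simp
  qed
  then have "cell_b = 0" by (simp add: cell_b_def)
  then show ?thesis using cell_b_eq by (simp add: zdvd1_eq)
qed

text \<open>Likewise \<open>cobd coh_T\<close> vanishes on five vertices, so the value of \<open>coh_T\<close> on the boundary of the
  product of the discs is 0.  This boundary consists of \<open>n\<close> copies each of disc times circle
  and circle times disc.\<close>

theorem four_indices:
  assumes "\<And>p. idx (\<l> p) < 4"
  shows "n dvd 2"
proof -
  have 0: "ev4 0 1 2 3 (cobd coh_T) p = 0" for p
  proof -
    have sub: "corners [0, 1, 2, 3] p \<subseteq> cube p" by (simp add: cube_def)
    have "ev4 0 1 2 3 (cobd coh_T) p = ev4 0 1 2 3 (\<lambda>l. 0) p"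
    proof (rule ev4_cong)
      fix l assume l: "l \<in> chains [0, 1, 2, 3] p"
      show "cobd coh_T l = 0"
        using l assms by (intro cobd_T_degenerate corners_chain_consistent[OF l sub]) (auto simp: chains_def)
    qed
    then show ?thesis by simp
  qed
  let ?S = "\<lambda>F. (\<Sum>s<N. \<Sum>t<M. \<Sum>s'<N. \<Sum>t'<M. F (Pos s t s' t') :: int)"
  have 1: "?S (diff 0 (ev3 1 2 3) coh_T) = 0"
  proof -
    have "?S (diff 0 (ev3 1 2 3) coh_T) = (\<Sum>t<M. \<Sum>s'<N. \<Sum>t'<M. \<Sum>s<N.
         ev3 1 2 3 coh_T (Pos (Suc s) t s' t') - ev3 1 2 3 coh_T (Pos s t s' t'))"
      by (subst sum.swap, rule sum.cong[OF refl], subst sum.swap, rule sum.cong[OF refl], subst sum.swap)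
        (simp add: diff_def)
    also have "\<dots> = (\<Sum>t<M. \<Sum>s'<N. \<Sum>t'<M. ev3 1 2 3 coh_T (Pos N t s' t') - ev3 1 2 3 coh_T (Pos 0 t s' t'))"
      by (subst sum_lessThan_telescope) simp
    also have "\<dots> = 0" using period_ev3(1)[of 1 2 3 coh_T 0] by simp
    finally show ?thesis .
  qed
  have 2: "?S (diff 1 (ev3 0 2 3) coh_T) = int n * cell_a"
  proof -
    have "?S (diff 1 (ev3 0 2 3) coh_T) = (\<Sum>s<N. \<Sum>s'<N. \<Sum>t'<M. \<Sum>t<M.
         ev3 0 2 3 coh_T (Pos s (Suc t) s' t') - ev3 0 2 3 coh_T (Pos s t s' t'))"
      by (rule sum.cong[OF refl], subst sum.swap, rule sum.cong[OF refl], subst sum.swap)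
        (simp add: diff_def)
    also have "\<dots> = (\<Sum>s<N. \<Sum>s'<N. \<Sum>t'<M. ev3 0 2 3 coh_T (Pos s M s' t') - ev3 0 2 3 coh_T (Pos s 0 s' t'))"
      by (subst sum_lessThan_telescope) simp
    also have "\<dots> = (\<Sum>s<N. \<Sum>s'<N. \<Sum>t'<M. ev3 0 2 3 coh_T (Pos s M s' t'))"
      using ev3_const1[OF constant_centre0, of _ 2 3] by simp
    also have "\<dots> = int n * cell_a"
      unfolding sum_blocks[of "\<lambda>s. \<Sum>s'<N. \<Sum>t'<M. ev3 0 2 3 coh_T (Pos s M s' t')"] cell_a_def
      by (simp add: rotate_ev3_0)
    finally show ?thesis .
  qed
  have 3: "?S (diff 2 (ev3 0 1 3) coh_T) = 0"
  proof -
    have "?S (diff 2 (ev3 0 1 3) coh_T) = (\<Sum>s<N. \<Sum>t<M. \<Sum>t'<M. \<Sum>s'<N.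
         ev3 0 1 3 coh_T (Pos s t (Suc s') t') - ev3 0 1 3 coh_T (Pos s t s' t'))"
      by (rule sum.cong[OF refl], rule sum.cong[OF refl], subst sum.swap) (simp add: diff_def)
    also have "\<dots> = (\<Sum>s<N. \<Sum>t<M. \<Sum>t'<M. ev3 0 1 3 coh_T (Pos s t N t') - ev3 0 1 3 coh_T (Pos s t 0 t'))"
      by (subst sum_lessThan_telescope) simp
    also have "\<dots> = 0" using period_ev3(2)[of 0 1 3 coh_T _ _ 0] by simp
    finally show ?thesis .
  qed
  have 4: "?S (diff 3 (ev3 0 1 2) coh_T) = int n * cell_b"
  proof -
    have "?S (diff 3 (ev3 0 1 2) coh_T) = (\<Sum>s<N. \<Sum>t<M. \<Sum>s'<N. \<Sum>t'<M.
         ev3 0 1 2 coh_T (Pos s t s' (Suc t')) - ev3 0 1 2 coh_T (Pos s t s' t'))"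
      by (simp add: diff_def)
    also have "\<dots> = (\<Sum>s<N. \<Sum>t<M. \<Sum>s'<N. ev3 0 1 2 coh_T (Pos s t s' M) - ev3 0 1 2 coh_T (Pos s t s' 0))"
      by (subst sum_lessThan_telescope) simp
    also have "\<dots> = (\<Sum>s<N. \<Sum>t<M. \<Sum>s'<N. ev3 0 1 2 coh_T (Pos s t s' M))"
      using ev3_const3[OF constant_centre2, of _ 0 1] by simp
    also have "\<dots> = int n * cell_b"
      unfolding sum_blocks[of "\<lambda>s'. ev3 0 1 2 coh_T (Pos _ _ s' M)"] cell_b_def
      by (simp add: rotate_ev3_2[simplified] sum_distrib_left)
    finally show ?thesis .
  qed
  have "0 = ?S (\<lambda>p. ev4 0 1 2 3 (cobd coh_T) p)" by (simp only: 0 sum.neutral_const)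
  also have "\<dots> = 0 - int n * cell_a + 0 - int n * cell_b"
    unfolding stokes4 sum.distrib sum_subtractf 1 2 3 4 ..
  finally have "int n * (cell_a + cell_b) = 0" by (simp add: algebra_simps)
  \<comment> \<open>The common factor \<open>n\<close> is removed over the integers, before reducing
    modulo \<open>n\<close>.\<close>
  then have "cell_a + cell_b = 0" using d_pos by simp
  then have "int n dvd 2"
    using dvd_add[OF cell_a_eq cell_b_eq] by (simp add: algebra_simps)
  then show ?thesis by (metis int_dvd_int_iff of_nat_numeral)
qed

end

section \<open>The universal cover of the cone\<close>

locale cyclic_cover =
  fixes n :: nat
  assumes n2: "n \<ge> 2"
begin

definition act :: "complex \<Rightarrow> complex \<times> complex \<Rightarrow> complex \<times> complex" where
  "act \<omega> x = (\<omega> * fst x, \<omega> * snd x)"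

text \<open>The universal cover of the cone: \<open>n\<close> discs, indexed by the argument of the second coordinate,
  glued along the unit circle of the first coordinate.\<close>

definition cover :: "(complex \<times> complex) set" where
  "cover = {x. norm (fst x) + norm (snd x) = 1 \<and> snd x ^ n = of_real (norm (snd x)) ^ n}"

text \<open>All components are invariant under a common root of unity; on
  \<open>(t * x, 1 - t)\<close> they are those of \<open>cone_pt\<close>.\<close>

definition pr :: "complex \<times> complex \<Rightarrow> complex \<times> complex \<times> real" where
  "pr x = (of_real (norm (fst x)) * sgn (fst x) ^ n, fst x * cnj (snd x), norm (fst x))"

abbreviation "Y \<equiv> cone_set (\<lambda>z. z ^ n)"

lemma root_norm: "\<omega> ^ n = 1 \<Longrightarrow> norm \<omega> = 1" for \<omega> :: complex
  using n2 by (metis power_eq_1_iff le_numeral_extra(4) not_numeral_le_zero)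

lemma act_cover:
  assumes "\<omega> ^ n = 1"
  shows "act \<omega> x \<in> cover \<longleftrightarrow> x \<in> cover"
  using assms root_norm[OF assms] by (simp add: act_def cover_def norm_mult power_mult_distrib)

lemma pr_act: "\<omega> ^ n = 1 \<Longrightarrow> pr (act \<omega> x) = pr x"
  using root_norm[of \<omega>] complex_norm_square[of \<omega>]
  by (simp add: act_def pr_def norm_mult sgn_mult power_mult_distrib mult_ac) (simp add: sgn_div_norm)

lemma act_act: "act a (act b x) = act (a * b) x"
  by (simp add: act_def mult_ac)

lemma act_1: "act 1 x = x"
  by (simp add: act_def)

lemma continuous_on_pr: "continuous_on S pr"
  unfolding pr_def
  by (intro continuous_intros continuous_on_compose2[OF continuous_on_radial_power[of UNIV]]) auto

lemma continuous_on_act: "continuous_on S (act \<omega>)"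
  unfolding act_def by (intro continuous_intros)

lemma compact_cover: "compact cover"
proof -
  have "closed cover"
    unfolding cover_def Collect_conj_eq
    by (intro closed_Int closed_Collect_eq continuous_intros)
  moreover have "cover \<subseteq> cball 0 1 \<times> cball 0 1"
    by (auto simp: cover_def) (smt (verit) norm_ge_zero)+
  then have "bounded cover"
    by (rule bounded_subset[rotated]) (intro bounded_Times bounded_cball)
  ultimately show ?thesis by (simp add: compact_eq_bounded_closed)
qed

lemma cover_norm: "x \<in> cover \<Longrightarrow> norm x \<ge> 1 / 2"
proof -
  assume "x \<in> cover"
  then have "norm (fst x) + norm (snd x) = 1" by (simp add: cover_def)
  then show ?thesis
    using norm_fst_le[of "fst x" "snd x"] norm_snd_le[of "snd x" "fst x"] by simp
qed

text \<open>The fibres are orbits: the root of unity is the quotient of the second coordinates, or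
  of the first ones on the gluing circle, where the second ones vanish.\<close>

lemma pr_fibre:
  assumes x: "x \<in> cover" and y: "y \<in> cover" and eq: "pr x = pr y"
  shows "\<exists>\<omega>. \<omega> ^ n = 1 \<and> y = act \<omega> x"
proof -
  obtain w r where xw: "x = (w, r)" by (cases x)
  obtain w' r' where yw: "y = (w', r')" by (cases y)
  have nw: "norm w = norm w'" using eq by (simp add: pr_def xw yw)
  have nr: "norm r = norm r'" using x y nw by (simp add: cover_def xw yw)
  have m: "w * cnj r = w' * cnj r'" using eq by (simp add: pr_def xw yw)
  have rn: "r ^ n = r' ^ n" using x y nr by (simp add: cover_def xw yw)
  show ?thesis
  proof (cases "r = 0")
    case False
    define \<omega> where "\<omega> = r' / r"
    have r'0: "r' \<noteq> 0" using False nr by auto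
    have r': "r' = \<omega> * r" using False by (simp add: \<omega>_def)
    have 1: "\<omega> ^ n = 1" using False rn r'0 by (simp add: \<omega>_def power_divide)
    have "w' * (cnj r' * r') = w * cnj r * r'" using m by (simp add: mult_ac)
    also have "\<dots> = \<omega> * w * (cnj r * r)" unfolding r' by (simp add: mult_ac)
    also have "cnj r * r = cnj r' * r'"
      using nr by (metis complex_norm_square mult.commute)
    finally have "w' = \<omega> * w" using r'0 by simp
    then show ?thesis using r' 1 by (auto simp: xw yw act_def)
  next
    case True
    then have r0: "r = 0" "r' = 0" using nr by auto
    then have nw1: "norm w = 1" "norm w' = 1" using x y by (auto simp: cover_def xw yw)
    then have "w ^ n = w' ^ n" using eq by (simp add: pr_def xw yw sgn_div_norm)
    moreover have "w \<noteq> 0" "w' \<noteq> 0" using nw1 by auto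
    ultimately have "(w' / w) ^ n = 1" "w' = (w' / w) * w" by (auto simp: power_divide)
    then show ?thesis using r0 by (auto simp: xw yw act_def intro!: exI[of _ "w' / w"])
  qed
qed

lemma pr_image: "pr ` cover = Y"
proof
  show "pr ` cover \<subseteq> Y"
  proof
    fix y assume "y \<in> pr ` cover"
    then obtain x where x: "x \<in> cover" "y = pr x" by auto
    obtain w r where xw: "x = (w, r)" by (cases x)
    have nr: "norm w + norm r = 1" "r ^ n = of_real (norm r) ^ n" using x by (auto simp: cover_def xw)
    show "y \<in> Y"
    proof (cases "r = 0")
      case True
      then have "norm w = 1" using nr by simp
      then have "y = rim (w ^ n)" "w ^ n \<in> circle"
        using True x by (auto simp: xw pr_def rim_def sgn_div_norm norm_power)
      then show ?thesis by (auto simp: cone_set_def)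
    next
      case False
      \<comment> \<open>The sheet containing the point; division by \<open>\<omega>\<close> moves it
        to the sheet with positive second coordinate, where \<open>pr\<close> is visibly a cone
        point.\<close>
      define \<omega> where "\<omega> = r / of_real (norm r)"
      have om: "\<omega> ^ n = 1" using nr(2) False by (simp add: \<omega>_def power_divide)
      have no: "norm \<omega> = 1" using False by (simp add: \<omega>_def norm_divide)
      have r: "r = \<omega> * of_real (1 - norm w)" using False nr(1) by (simp add: \<omega>_def eq_diff_eq[symmetric])
      define u where "u = (if w = 0 then 1 else sgn w / \<omega>)"
      have u: "u \<in> circle" using no by (simp add: u_def norm_divide norm_sgn)
      have w: "w = of_real (norm w) * (u * \<omega>)"
        using no by (auto simp: u_def sgn_div_norm scaleR_conv_of_real)
      have t: "norm w \<in> {0..1}" using nr(1) by (smt (verit) atLeastAtMost_iff norm_ge_zero)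
      have "of_real (norm w) * sgn w ^ n = of_real (norm w) * u ^ n"
        using om by (auto simp: u_def power_divide)
      moreover have "w * cnj r = of_real (norm w * (1 - norm w)) * u"
      proof -
        have "w * cnj r = of_real (norm w) * (u * \<omega>) * cnj (\<omega> * of_real (1 - norm w))"
          using w r by simp
        also have "\<dots> = of_real (norm w * (1 - norm w)) * u * (\<omega> * cnj \<omega>)"
          by (simp add: mult_ac)
        also have "\<omega> * cnj \<omega> = 1" using no complex_norm_square[of \<omega>] by simp
        finally show ?thesis by simp
      qed
      ultimately have "y = cone_pt (\<lambda>z. z ^ n) (u, norm w)"
        by (simp add: x xw pr_def cone_pt_def)
      then show ?thesis using u t by (auto simp: cone_set_def)
    qed
  qed
  show "Y \<subseteq> pr ` cover"
  proof
    fix y assume "y \<in> Y"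
    then show "y \<in> pr ` cover"
      unfolding cone_set_def
    proof
      assume "y \<in> cone_pt (\<lambda>z. z ^ n) ` (circle \<times> {0..1})"
      then obtain x t where xt: "x \<in> circle" "t \<in> {0..1}" "y = cone_pt (\<lambda>z. z ^ n) (x, t)" by auto
      have "(of_real t * x, of_real (1 - t)) \<in> cover"
        using xt by (auto simp: cover_def norm_mult simp del: of_real_diff)
      moreover have "pr (of_real t * x, of_real (1 - t)) = y"
      proof -
        have sx: "sgn x = x" using xt(1) by (simp add: sgn_div_norm)
        have "of_real t * sgn (of_real t * x) ^ n = of_real t * x ^ n"
          using xt(2) by (cases "t = 0") (auto simp: sgn_mult sx sgn_of_real)
        then show ?thesis
          using xt by (simp add: pr_def cone_pt_def norm_mult)
      qed
      ultimately show ?thesis by force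
    next
      assume "y \<in> rim ` circle"
      then obtain u where u: "u \<in> circle" "y = rim u" by auto
      have n0: "n \<noteq> 0" using n2 by simp
      obtain w where w: "u = w ^ n" by (rule exists_complex_root[OF n0])
      have "norm (w ^ n) = 1" using u(1) unfolding w by simp
      then have "norm w ^ n = 1 ^ n" by (simp add: norm_power)
      then have "norm w = 1" by (rule power_eq_imp_eq_base) (use n0 in auto)
      then have "(w, 0) \<in> cover" "pr (w, 0) = y"
        using n2 w u by (auto simp: cover_def pr_def rim_def sgn_div_norm)
      then show ?thesis by force
    qed
  qed
qed

lemma finite_roots: "finite {\<omega>::complex. \<omega> ^ n = 1}"
  using n2 by (intro finite_roots_unity) auto

text \<open>Saturate \<open>G\<close> by the deck transformations; the complement is closed, and
  \<open>pr\<close> is a closed map by compactness.\<close>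

lemma pr_open_map:
  assumes "openin (top_of_set cover) G"
  shows "openin (top_of_set Y) (pr ` G)"
proof -
  let ?V = "\<Union>\<omega>\<in>{\<omega>. \<omega> ^ n = 1}. cover \<inter> act \<omega> -` G"
  have V: "openin (top_of_set cover) ?V"
  proof (intro openin_Union ballI)
    fix W assume "W \<in> (\<lambda>\<omega>. cover \<inter> act \<omega> -` G) ` {\<omega>. \<omega> ^ n = 1}"
    then obtain \<omega> where w: "\<omega> ^ n = 1" "W = cover \<inter> act \<omega> -` G" by auto
    show "openin (top_of_set cover) W"
      unfolding w(2) using act_cover[OF w(1)]
      by (intro continuous_openin_preimage[OF continuous_on_act _ assms]) auto
  qed
  then have "closedin (top_of_set cover) (cover - ?V)" by (rule closedin_diff[rotated]) auto
  then have "closedin (top_of_set Y) (pr ` (cover - ?V))"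
    using Abstract_Topology_2.continuous_imp_closed_map[OF _ continuous_on_pr pr_image compact_cover] by blast
  moreover have "pr ` (cover - ?V) = Y - pr ` G"
  proof -
    have G: "G \<subseteq> cover" using openin_imp_subset[OF assms] .
    have A: "pr x \<notin> pr ` G" if "x \<in> cover - ?V" for x
    proof
      assume "pr x \<in> pr ` G"
      then obtain y where y: "y \<in> G" "pr x = pr y" by auto
      have "x \<in> cover" "y \<in> cover" using that y G by blast+
      then obtain \<omega> where "\<omega> ^ n = 1" "y = act \<omega> x" using pr_fibre y by blast
      then show False using that y \<open>x \<in> cover\<close> by auto
    qed
    have B: "pr x \<in> pr ` (cover - ?V)" if "x \<in> cover" "pr x \<notin> pr ` G" for x
    proof (rule imageI, rule DiffI)
      show "x \<in> cover" by (rule that)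
      show "x \<notin> ?V"
      proof
        assume "x \<in> ?V"
        then obtain \<omega> where "\<omega> ^ n = 1" "act \<omega> x \<in> G" by auto
        then show False using that(2) pr_act by (metis imageI)
      qed
    qed
    show ?thesis
    proof (intro equalityI subsetI)
      fix z assume "z \<in> pr ` (cover - ?V)"
      then obtain x where x: "x \<in> cover - ?V" "z = pr x" by (rule imageE)
      have "x \<in> cover" using x(1) by (rule DiffD1)
      then show "z \<in> Y - pr ` G" using A[OF x(1)] unfolding x(2) pr_image[symmetric] by (intro DiffI imageI)
    next
      fix z assume z: "z \<in> Y - pr ` G"
      then obtain x where x: "x \<in> cover" "z = pr x" unfolding pr_image[symmetric] by (elim DiffE imageE)
      show "z \<in> pr ` (cover - ?V)"
        unfolding x(2) by (rule B[OF x(1)]) (use z x(2) in simp)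
    qed
  qed
  ultimately have "closedin (top_of_set Y) (Y - pr ` G)" by simp
  then have "openin (top_of_set Y) (Y - (Y - pr ` G))" by (rule openin_diff[rotated]) auto
  moreover have "Y - (Y - pr ` G) = pr ` G"
    using openin_imp_subset[OF assms] pr_image by blast
  ultimately show ?thesis by simp
qed

lemma covering: "covering_space cover pr Y"
proof
  show "continuous_on cover pr" "pr ` cover = Y" by (rule continuous_on_pr pr_image)+
  \<comment> \<open>The least distance of a nontrivial root from 1, the extra element 1 keeping the
    set nonempty. Points of the cover have norm at least \<open>1 / 2\<close>, so a nontrivial deck
    transformation moves them by at least \<open>\<kappa> / 2\<close>, more than the diameter of a
    ball of radius \<open>\<kappa> / 8\<close>.\<close>
  define \<kappa> where "\<kappa> = Min ((\<lambda>\<omega>::complex. norm (\<omega> - 1)) ` ({\<omega>. \<omega> ^ n = 1} - {1}) \<union> {1})"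
  have fin: "finite ((\<lambda>\<omega>::complex. norm (\<omega> - 1)) ` ({\<omega>. \<omega> ^ n = 1} - {1}) \<union> {1})"
    using finite_roots by auto
  have \<kappa>: "\<kappa> > 0" unfolding \<kappa>_def using fin by (subst Min_gr_iff) auto
  have \<kappa>le: "\<kappa> \<le> norm (\<omega> - 1)" if "\<omega> ^ n = 1" "\<omega> \<noteq> 1" for \<omega> :: complex
    unfolding \<kappa>_def using that fin by (intro Min_le) auto
  fix y assume "y \<in> Y"
  then have "y \<in> pr ` cover" by (simp only: pr_image)
  then obtain x0 where x0: "x0 \<in> cover" "pr x0 = y" by auto
  define B where "B = cover \<inter> ball x0 (\<kappa> / 8)"
  have B: "openin (top_of_set cover) B" unfolding B_def by (intro openin_open_Int open_ball)
  have uniq: "\<omega> = 1" if "x \<in> B" "act \<omega> x \<in> B" "\<omega> ^ n = 1" for \<omega> x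
  proof (rule ccontr)
    assume "\<omega> \<noteq> 1"
    have "norm (act \<omega> x - x) = norm (\<omega> - 1) * norm x"
    proof -
      have "act \<omega> x - x = ((\<omega> - 1) * fst x, (\<omega> - 1) * snd x)"
        by (simp add: act_def algebra_simps minus_prod_def)
      then have "norm (act \<omega> x - x) = sqrt ((norm (\<omega> - 1))\<^sup>2 * ((norm (fst x))\<^sup>2 + (norm (snd x))\<^sup>2))"
        by (simp add: norm_Pair norm_mult power_mult_distrib distrib_left)
      also have "\<dots> = norm (\<omega> - 1) * sqrt ((norm (fst x))\<^sup>2 + (norm (snd x))\<^sup>2)"
        by (simp add: real_sqrt_mult)
      also have "sqrt ((norm (fst x))\<^sup>2 + (norm (snd x))\<^sup>2) = norm x"
        by (metis norm_Pair prod.collapse)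
      finally show ?thesis .
    qed
    moreover have "norm (\<omega> - 1) * norm x \<ge> \<kappa> * (1 / 2)"
      using \<kappa>le[OF that(3) \<open>\<omega> \<noteq> 1\<close>] cover_norm[of x] that(1) \<kappa> by (intro mult_mono) (auto simp: B_def)
    moreover have "norm (act \<omega> x - x) < \<kappa> / 8 + \<kappa> / 8"
      using that(1,2) unfolding B_def dist_norm[symmetric]
      by (smt (verit, best) IntD2 dist_commute dist_triangle mem_ball)
    ultimately show False using \<kappa> by simp
  qed
  let ?v = "(\<lambda>\<omega>. cover \<inter> act \<omega> -` B) ` {\<omega>. \<omega> ^ n = 1}"
  have Bc: "B \<subseteq> cover" by (auto simp: B_def)
  have inv: "inverse \<omega> ^ n = 1" "\<omega> \<noteq> 0" if "\<omega> ^ n = 1" for \<omega> :: complex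
  proof -
    show "inverse \<omega> ^ n = 1" using that by (simp add: power_inverse)
    show "\<omega> \<noteq> 0" using root_norm[OF that] by auto
  qed
  have op: "openin (top_of_set cover) (cover \<inter> act \<omega> -` B)" if "\<omega> ^ n = 1" for \<omega>
    using act_cover[OF that] by (intro continuous_openin_preimage[OF continuous_on_act _ B]) auto
  show "\<exists>T. y \<in> T \<and> openin (top_of_set Y) T \<and>
           (\<exists>v. \<Union> v = cover \<inter> pr -` T \<and> (\<forall>u\<in>v. openin (top_of_set cover) u) \<and>
                pairwise disjnt v \<and> (\<forall>u\<in>v. \<exists>q. homeomorphism u T pr q))"
  proof (intro exI[of _ "pr ` B"] exI[of _ ?v] conjI ballI)
    show "y \<in> pr ` B" using x0 \<kappa> by (auto simp: B_def)
    show "openin (top_of_set Y) (pr ` B)" by (rule pr_open_map[OF B])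
    show "\<Union> ?v = cover \<inter> pr -` pr ` B"
    proof
      show "\<Union> ?v \<subseteq> cover \<inter> pr -` pr ` B" using pr_act by (auto, metis imageI)
      show "cover \<inter> pr -` pr ` B \<subseteq> \<Union> ?v"
      proof
        fix x assume x: "x \<in> cover \<inter> pr -` pr ` B"
        then obtain z where "z \<in> B" "pr x = pr z" by auto
        then obtain \<omega> where "\<omega> ^ n = 1" "z = act \<omega> x" using pr_fibre[of x z] x Bc by auto
        then show "x \<in> \<Union> ?v" using x \<open>z \<in> B\<close> by auto
      qed
    qed
    show "openin (top_of_set cover) u" if "u \<in> ?v" for u using that op by auto
    show "pairwise disjnt ?v"
    proof (rule pairwiseI)
      fix u u' assume "u \<in> ?v" "u' \<in> ?v" "u \<noteq> u'"
      then obtain a b where ab: "a ^ n = 1" "b ^ n = 1" "u = cover \<inter> act a -` B" "u' = cover \<inter> act b -` B"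
        by auto
      show "disjnt u u'"
        unfolding disjnt_def
      proof (rule ccontr)
        assume "u \<inter> u' \<noteq> {}"
        then obtain x where "x \<in> u" "x \<in> u'" by blast
        then have x: "act a x \<in> B" "act b x \<in> B" using ab by blast+
        have "act (b * inverse a) (act a x) = act b x"
          using inv[OF ab(1)] by (simp add: act_act mult.assoc)
        then have "b * inverse a = 1"
          using uniq[OF x(1), of "b * inverse a"] x(2) inv[OF ab(1)] ab by (simp add: power_mult_distrib)
        then have "b = a" using inv[OF ab(1)] by (simp add: field_simps)
        then show False using ab \<open>u \<noteq> u'\<close> by simp
      qed
    qed
    fix u assume "u \<in> ?v"
    then obtain a where a: "a ^ n = 1" "u = cover \<inter> act a -` B" by auto
    have uB: "pr ` u = pr ` B"
      proof
        show "pr ` u \<subseteq> pr ` B" using pr_act[OF a(1)] a(2) by (auto, metis imageI)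
        show "pr ` B \<subseteq> pr ` u"
        proof
          fix z assume "z \<in> pr ` B"
          then obtain x where x: "x \<in> B" "z = pr x" by auto
          have "act a (act (inverse a) x) = x" using inv[OF a(1)] by (simp add: act_act act_1)
          then have "act (inverse a) x \<in> u"
            using x a act_cover[OF inv(1)[OF a(1)]] Bc by auto
          then show "z \<in> pr ` u" using x pr_act[OF inv(1)[OF a(1)]] by (metis imageI)
        qed
      qed
    have inj: "inj_on pr u"
      proof (rule inj_onI)
        fix x z assume xz: "x \<in> u" "z \<in> u" "pr x = pr z"
        then obtain \<omega> where om: "\<omega> ^ n = 1" "z = act \<omega> x" using pr_fibre[of x z] a by auto
        have "act \<omega> (act a x) = act a z" using om by (simp add: act_act mult_ac)
        then have "\<omega> = 1" using uniq[of "act a x" \<omega>] xz om a by auto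
        then show "x = z" using om by (simp add: act_1)
      qed
    have op': "openin (top_of_set (pr ` B)) (pr ` V)" if "openin (top_of_set u) V" for V
    proof -
      from that have "openin (top_of_set cover) V" using op[OF a(1)] a(2) openin_trans by blast
      then have "openin (top_of_set Y) (pr ` V)" by (rule pr_open_map)
      moreover have "pr ` V \<subseteq> pr ` B"
      proof -
        have "V \<subseteq> u" using that by (rule openin_imp_subset)
        then show ?thesis unfolding uB[symmetric] by (rule image_mono)
      qed
      moreover have "pr ` B \<subseteq> Y" using Bc pr_image by auto
      ultimately show "openin (top_of_set (pr ` B)) (pr ` V)" by (rule openin_subset_trans)
    qed
    show "\<exists>q. homeomorphism u (pr ` B) pr q"
      using homeomorphism_injective_open_map[OF continuous_on_pr uB inj op'] by blast
  qed
qed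

section \<open>Label functions of motion planners\<close>

text \<open>The Hermitian product; dividing by \<open>inner2 y y\<close> recovers the root of unity
  from \<open>act \<omega> y\<close> by a continuous formula.\<close>

definition inner2 :: "complex \<times> complex \<Rightarrow> complex \<times> complex \<Rightarrow> complex" where
  "inner2 x y = fst x * cnj (fst y) + snd x * cnj (snd y)"

lemma inner2_act: "inner2 (act \<omega> x) y = \<omega> * inner2 x y"
  by (simp add: inner2_def act_def algebra_simps)

lemma inner2_self: "x \<in> cover \<Longrightarrow> inner2 x x \<noteq> 0"
proof -
  assume "x \<in> cover"
  then have "fst x \<noteq> 0 \<or> snd x \<noteq> 0" by (auto simp: cover_def)
  then have "(norm (fst x))\<^sup>2 + (norm (snd x))\<^sup>2 \<noteq> 0" by (simp add: add_nonneg_eq_0_iff)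
  then show ?thesis
    unfolding inner2_def complex_norm_square[symmetric] by (metis of_real_add of_real_eq_0_iff)
qed

lemma act_inj: "x \<in> cover \<Longrightarrow> act a x = act b x \<Longrightarrow> a = b"
proof -
  assume x: "x \<in> cover" and "act a x = act b x"
  then have "a * inner2 x x = b * inner2 x x" by (metis inner2_act)
  then show "a = b" using inner2_self[OF x] by simp
qed

definition lift_dom :: "((complex \<times> complex \<times> real) \<times> complex \<times> complex \<times> real) set \<Rightarrow> ((complex \<times> complex) \<times> complex \<times> complex) set" where
  "lift_dom U = {q \<in> cover \<times> cover. (pr (fst q), pr (snd q)) \<in> U}"

text \<open>Lifting the path of the planner from \<open>x\<close> ends in \<open>s (x, y) * y\<close>.\<close>

lemma motion_planner_label:
  assumes "motion_planner Y U h"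
  obtains s where "continuous_on (lift_dom U) s" "\<And>q. q \<in> lift_dom U \<Longrightarrow> s q ^ n = 1"
    "\<And>x y \<omega>. (x, y) \<in> lift_dom U \<Longrightarrow> \<omega> ^ n = 1 \<Longrightarrow> s (act \<omega> x, y) = \<omega> * s (x, y)"
    "\<And>x y \<omega>. (x, y) \<in> lift_dom U \<Longrightarrow> \<omega> ^ n = 1 \<Longrightarrow> s (x, act \<omega> y) * \<omega> = s (x, y)"
proof -
  have h: "continuous_on (U \<times> {0..1}) h" "h ` (U \<times> {0..1}) \<subseteq> Y"
      "\<And>p. p \<in> U \<Longrightarrow> h (p, 0) = fst p" "\<And>p. p \<in> U \<Longrightarrow> h (p, 1) = snd p"
    using assms unfolding motion_planner_def by blast+
  let ?D = "lift_dom U"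
  define H where "H = (\<lambda>z::real \<times> (complex \<times> complex) \<times> complex \<times> complex. h ((pr (fst (snd z)), pr (snd (snd z))), fst z))"
  have contH: "continuous_on ({0..1} \<times> ?D) H"
    unfolding H_def
    by (intro continuous_on_compose2[OF h(1)] continuous_intros continuous_on_compose2[OF continuous_on_pr[of UNIV]])
       (auto simp: lift_dom_def)
  have Him: "H \<in> {0..1} \<times> ?D \<rightarrow> Y"
    using h(2) by (auto simp: H_def lift_dom_def)
  have H0: "H (0, q) = pr (fst q)" and H1: "H (1, q) = pr (snd q)" if "q \<in> ?D" for q
    using that h(3,4)[of "(pr (fst q), pr (snd q))"] by (auto simp: H_def lift_dom_def)
  obtain k where k: "continuous_on ({0..1} \<times> ?D) k" "k \<in> {0..1} \<times> ?D \<rightarrow> cover"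
      "\<And>q. q \<in> ?D \<Longrightarrow> k (0, q) = fst q" "\<And>z. z \<in> {0..1} \<times> ?D \<Longrightarrow> H z = pr (k z)"
  proof (rule covering_space_lift_homotopy[OF covering contH Him])
    show "H (0, q) = pr (fst q)" if "q \<in> ?D" for q using that by (rule H0)
    show "continuous_on ?D fst" by (intro continuous_intros)
    show "fst \<in> ?D \<rightarrow> cover" by (auto simp: lift_dom_def)
  qed (rule that)
  define s where "s q = inner2 (k (1, q)) (snd q) / inner2 (snd q) (snd q)" for q
  have end_: "k (1, q) \<in> cover" "snd q \<in> cover" "\<exists>\<omega>. \<omega> ^ n = 1 \<and> k (1, q) = act \<omega> (snd q)" if q: "q \<in> ?D" for q
  proof -
    show "k (1, q) \<in> cover" "snd q \<in> cover" using k(2) q by (auto simp: lift_dom_def)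
    moreover have "pr (snd q) = pr (k (1, q))" using H1[OF q] k(4)[of "(1, q)"] q by simp
    ultimately show "\<exists>\<omega>. \<omega> ^ n = 1 \<and> k (1, q) = act \<omega> (snd q)" using pr_fibre by blast
  qed
  have sq: "s q ^ n = 1 \<and> k (1, q) = act (s q) (snd q)" if q: "q \<in> ?D" for q
  proof -
    obtain \<omega> where om: "\<omega> ^ n = 1" "k (1, q) = act \<omega> (snd q)" using end_[OF q] by blast
    then have "s q = \<omega>" unfolding s_def om(2) inner2_act using inner2_self[OF end_(2)[OF q]] by simp
    then show ?thesis using om by simp
  qed
  have Dact1: "(act \<omega> x, y) \<in> ?D" if "(x, y) \<in> ?D" "\<omega> ^ n = 1" for x y \<omega>
    using that by (simp add: lift_dom_def act_cover pr_act)
  have Dact2: "(x, act \<omega> y) \<in> ?D" if "(x, y) \<in> ?D" "\<omega> ^ n = 1" for x y \<omega>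
    using that by (simp add: lift_dom_def act_cover pr_act)
  have path: "continuous_on {0..1} (\<lambda>t. k (t, q))" if "q \<in> ?D" for q
    by (rule continuous_on_compose2[OF k(1)]) (use that in \<open>auto intro!: continuous_intros\<close>)
  have pathH: "continuous_on {0..1} (\<lambda>t. H (t, q))" if "q \<in> ?D" for q
    by (rule continuous_on_compose2[OF contH]) (use that in \<open>auto intro!: continuous_intros\<close>)
  show thesis
  proof
    show "continuous_on ?D s"
    proof -
      have "continuous_on ?D (\<lambda>q. k (1, q))"
        by (rule continuous_on_compose2[OF k(1)]) (auto intro!: continuous_intros)
      then show ?thesis
        unfolding s_def inner2_def using inner2_self end_(2)
        by (intro continuous_intros) (auto simp: inner2_def)
    qed
    show "s q ^ n = 1" if "q \<in> ?D" for q using sq[OF that] by blast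
    fix x y and \<omega> :: complex assume xy: "(x, y) \<in> ?D" and om: "\<omega> ^ n = 1"
    \<comment> \<open>The translate by \<open>\<omega>\<close> of the lift starting at
      \<open>x\<close> is a lift of the same path starting at \<open>act \<omega> x\<close>.\<close>
    have k1: "k (1, (act \<omega> x, y)) = act \<omega> (k (1, (x, y)))"
    proof (rule covering_space_lift_unique[OF covering, where T = "{0..1::real}" and a = 0 and f = "\<lambda>t. H (t, (x, y))"
          and ?g1.0 = "\<lambda>t. k (t, (act \<omega> x, y))" and ?g2.0 = "\<lambda>t. act \<omega> (k (t, (x, y)))"])
      show "k (0, act \<omega> x, y) = act \<omega> (k (0, x, y))"
        using k(3)[OF xy] k(3)[OF Dact1[OF xy om]] by simp
      show "continuous_on {0..1} (\<lambda>t. act \<omega> (k (t, x, y)))"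
        by (rule continuous_on_compose2[OF continuous_on_act[of UNIV] path[OF xy]]) auto
      show "(\<lambda>t. act \<omega> (k (t, x, y))) \<in> {0..1} \<rightarrow> cover"
      proof (rule funcsetI)
        fix t :: real assume "t \<in> {0..1}"
        then have "k (t, x, y) \<in> cover" using funcset_mem[OF k(2), of "(t, x, y)"] xy by simp
        then show "act \<omega> (k (t, x, y)) \<in> cover" by (simp only: act_cover[OF om])
      qed
      show "H (t, x, y) = pr (k (t, act \<omega> x, y))" if "t \<in> {0..1}" for t
        using k(4)[of "(t, act \<omega> x, y)"] that Dact1[OF xy om] by (simp add: H_def pr_act[OF om])
      show "H (t, x, y) = pr (act \<omega> (k (t, x, y)))" if "t \<in> {0..1}" for t
        using k(4)[of "(t, x, y)"] that xy by (simp add: pr_act[OF om])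
    qed (use path[OF Dact1[OF xy om]] pathH[OF xy] k(2) Him xy Dact1[OF xy om] in auto)
    have "act (s (act \<omega> x, y)) y = act (\<omega> * s (x, y)) y"
      using k1 sq[OF xy] sq[OF Dact1[OF xy om]] by (simp add: act_act)
    then show "s (act \<omega> x, y) = \<omega> * s (x, y)" using act_inj end_(2)[OF xy] by auto
    \<comment> \<open>Changing \<open>y\<close> within its fibre changes neither the path in the
      cone nor the start of its lift.\<close>
    have k2: "k (1, (x, act \<omega> y)) = k (1, (x, y))"
    proof (rule covering_space_lift_unique[OF covering, where T = "{0..1::real}" and a = 0 and f = "\<lambda>t. H (t, (x, y))"
          and ?g1.0 = "\<lambda>t. k (t, (x, act \<omega> y))" and ?g2.0 = "\<lambda>t. k (t, (x, y))"])
      show "k (0, x, act \<omega> y) = k (0, x, y)"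
        using k(3)[OF xy] k(3)[OF Dact2[OF xy om]] by simp
      show "H (t, x, y) = pr (k (t, x, act \<omega> y))" if "t \<in> {0..1}" for t
        using k(4)[of "(t, x, act \<omega> y)"] that Dact2[OF xy om] by (simp add: H_def pr_act[OF om])
      show "H (t, x, y) = pr (k (t, x, y))" if "t \<in> {0..1}" for t
        using k(4)[of "(t, x, y)"] that xy by simp
    qed (use path[OF Dact2[OF xy om]] path[OF xy] pathH[OF xy] k(2) Him xy Dact2[OF xy om] in auto)
    have "act (s (x, act \<omega> y) * \<omega>) y = act (s (x, y)) y"
      using k2 sq[OF xy] sq[OF Dact2[OF xy om]] by (simp add: act_act)
    then show "s (x, act \<omega> y) * \<omega> = s (x, y)" using act_inj end_(2)[OF xy] by auto
  qed
qed

section \<open>Roots of unity and polar coordinates\<close>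

definition zeta :: complex where "zeta = cis (2 * pi / n)"

lemma zeta_pow: "zeta ^ n = 1"
  using n2 by (simp add: zeta_def Complex.DeMoivre)

lemma zeta_power_cis: "zeta ^ k = cis (2 * pi * k / n)"
  by (simp add: zeta_def Complex.DeMoivre mult_ac)

lemma zeta_power_mod: "zeta ^ k = zeta ^ (k mod n)"
  by (metis zeta_pow mult_div_mod_eq power_add power_mult power_one mult_1)

lemma root_eq_zeta_power:
  assumes "\<omega> ^ n = 1"
  shows "\<exists>!g. g < n \<and> \<omega> = zeta ^ g"
proof -
  have b: "bij_betw (\<lambda>k. cis (2 * pi * real k / real n)) {..<n} {z. z ^ n = 1}"
    by (rule Complex.bij_betw_roots_unity) (use n2 in auto)
  have "\<omega> \<in> (\<lambda>k. cis (2 * pi * real k / real n)) ` {..<n}"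
    using b assms by (auto simp: bij_betw_def)
  moreover have "inj_on (\<lambda>k. cis (2 * pi * real k / real n)) {..<n}"
    using b by (auto simp: bij_betw_def)
  ultimately show ?thesis
    unfolding zeta_power_cis by (auto simp: inj_on_def)
qed

definition log_zeta :: "complex \<Rightarrow> nat" where
  "log_zeta \<omega> = (THE g. g < n \<and> \<omega> = zeta ^ g)"

lemma log_zeta: "\<omega> ^ n = 1 \<Longrightarrow> log_zeta \<omega> < n \<and> \<omega> = zeta ^ log_zeta \<omega>"
  unfolding log_zeta_def by (rule theI'[OF root_eq_zeta_power])

lemma log_zeta_eqI:
  assumes "g < n" "\<omega> = zeta ^ g"
  shows "log_zeta \<omega> = g"
proof -
  have "\<omega> ^ n = 1" using assms by (metis zeta_pow power_mult mult.commute power_one)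
  then show ?thesis using root_eq_zeta_power[of \<omega>] log_zeta[of \<omega>] assms by blast
qed

lemma log_zeta_mult:
  assumes "\<omega> ^ n = 1"
  shows "int (log_zeta (zeta * \<omega>)) = (int (log_zeta \<omega>) + 1) mod int n"
proof -
  have "log_zeta (zeta * \<omega>) = (log_zeta \<omega> + 1) mod n"
  proof (rule log_zeta_eqI)
    show "(log_zeta \<omega> + 1) mod n < n" using n2 by simp
    show "zeta * \<omega> = zeta ^ ((log_zeta \<omega> + 1) mod n)"
      using log_zeta[OF assms] by (metis zeta_power_mod power_Suc Suc_eq_plus1)
  qed
  then show ?thesis by (simp add: zmod_int add.commute)
qed

definition polar :: "real \<Rightarrow> real \<Rightarrow> complex \<times> complex" where
  "polar s t = (of_real t * cis (2 * pi * s), of_real (1 - t))"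

lemma polar_cover: "t \<in> {0..1} \<Longrightarrow> polar s t \<in> cover"
  by (auto simp: polar_def cover_def norm_mult simp del: of_real_diff)

lemma polar_0: "polar s 0 = polar 0 0" by (simp add: polar_def)

lemma polar_period: "polar (s + 1) t = polar s t"
  by (simp add: polar_def distrib_left flip: cis_mult)

text \<open>Rotating the sheet is a deck transformation on the gluing circle only, where the second
  coordinate is 0.\<close>

lemma polar_rotate: "polar (s + 1 / n) 1 = act zeta (polar s 1)"
  by (simp add: polar_def act_def zeta_def distrib_left mult_ac flip: cis_mult)

lemma dist_cis: "dist (cis a) (cis b) \<le> \<bar>a - b\<bar>"
proof -
  have "cis a - cis b = cis b * (cis (a - b) - 1)"
    by (simp add: algebra_simps cis_mult)
  then have "dist (cis a) (cis b) = norm (cis (a - b) - 1)"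
    by (simp add: dist_norm norm_mult)
  also have "\<dots> = 2 * \<bar>sin ((a - b) / 2)\<bar>"
    using dist_exp_i_1[of "a - b"] by (simp add: cis_conv_exp)
  also have "\<dots> \<le> 2 * \<bar>(a - b) / 2\<bar>" by (intro mult_left_mono abs_sin_x_le_abs_x) simp
  finally show ?thesis by simp
qed

lemma dist_polar:
  assumes "t \<in> {0..1}" "t' \<in> {0..1}"
  shows "dist (polar s t) (polar s' t') \<le> 2 * \<bar>t - t'\<bar> + 2 * pi * \<bar>s - s'\<bar>"
proof -
  have "dist (of_real t * cis (2 * pi * s)) (of_real t' * cis (2 * pi * s'))
     \<le> dist (of_real t * cis (2 * pi * s)) (of_real t * cis (2 * pi * s')) +
       dist (of_real t * cis (2 * pi * s')) (of_real t' * cis (2 * pi * s'))"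
    by (rule dist_triangle)
  also have "dist (of_real t * cis (2 * pi * s)) (of_real t * cis (2 * pi * s')) = \<bar>t\<bar> * dist (cis (2 * pi * s)) (cis (2 * pi * s'))"
    by (simp add: dist_norm norm_mult flip: right_diff_distrib)
  also have "\<dots> \<le> 1 * (2 * pi * \<bar>s - s'\<bar>)"
  proof (rule mult_mono)
    show "dist (cis (2 * pi * s)) (cis (2 * pi * s')) \<le> 2 * pi * \<bar>s - s'\<bar>"
      using dist_cis[of "2 * pi * s" "2 * pi * s'"] by (simp add: abs_mult flip: right_diff_distrib)
  qed (use assms in auto)
  also have "dist (of_real t * cis (2 * pi * s')) (of_real t' * cis (2 * pi * s')) = \<bar>t - t'\<bar>"
    by (simp add: dist_norm norm_mult flip: left_diff_distrib of_real_diff)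
  finally have 1: "dist (fst (polar s t)) (fst (polar s' t')) \<le> 2 * pi * \<bar>s - s'\<bar> + \<bar>t - t'\<bar>"
    by (simp add: polar_def)
  have 2: "dist (snd (polar s t)) (snd (polar s' t')) = \<bar>t - t'\<bar>"
    by (simp add: polar_def dist_norm flip: of_real_diff)
  have "dist (polar s t) (polar s' t') \<le> dist (fst (polar s t)) (fst (polar s' t')) + dist (snd (polar s t)) (snd (polar s' t'))"
    unfolding dist_prod_def by (rule sqrt_sum_squares_le_sum) auto
  then show ?thesis using 1 2 by simp
qed

definition base_pt :: "(complex \<times> complex) \<times> complex \<times> complex \<Rightarrow> (complex \<times> complex \<times> real) \<times> complex \<times> complex \<times> real" where
  "base_pt q = (pr (fst q), pr (snd q))"

definition polar2 :: "real \<times> real \<times> real \<times> real \<Rightarrow> (complex \<times> complex) \<times> complex \<times> complex" where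
  "polar2 = (\<lambda>(s, t, s', t'). (polar s t, polar s' t'))"

text \<open>Positions are unbounded, so radii beyond \<open>M\<close> are clamped to 1; angles may
  grow, being periodic.\<close>

definition grid_real :: "nat \<Rightarrow> nat \<Rightarrow> pos \<Rightarrow> real \<times> real \<times> real \<times> real" where
  "grid_real K M p = (case p of Pos s t s' t' \<Rightarrow>
     (real s / real (n * K), real (min t M) / real M, real s' / real (n * K), real (min t' M) / real M))"

lemma uniformly_continuous_base_pt: "uniformly_continuous_on (cover \<times> cover) base_pt"
  unfolding base_pt_def
  by (intro compact_uniformly_continuous compact_Times compact_cover continuous_intros
      continuous_on_compose2[OF continuous_on_pr[of UNIV]]) auto

definition params :: "(real \<times> real \<times> real \<times> real) set" where
  "params = {(s, t, s', t'). t \<in> {0..1} \<and> t' \<in> {0..1}}"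

lemma polar2_cover: "x \<in> params \<Longrightarrow> polar2 x \<in> cover \<times> cover"
  by (auto simp: params_def polar2_def intro!: polar_cover)

lemma continuous_on_polar2: "continuous_on S polar2"
  unfolding polar2_def polar_def case_prod_beta by (intro continuous_intros)

text \<open>Each factor contributes \<open>10 * e\<close>: \<open>2 * e\<close> from the radius and,
  as \<open>pi < 4\<close>, at most \<open>8 * e\<close> from the angle.\<close>

lemma dist_polar2:
  assumes "(s, t, s', t') \<in> params" "(u, v, u', v') \<in> params"
    and "\<bar>s - u\<bar> \<le> e" "\<bar>t - v\<bar> \<le> e" "\<bar>s' - u'\<bar> \<le> e" "\<bar>t' - v'\<bar> \<le> e"
  shows "dist (polar2 (s, t, s', t')) (polar2 (u, v, u', v')) \<le> 20 * e"
proof -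
  have pi: "2 * pi * a \<le> 8 * e" if "a \<le> e" "0 \<le> a" for a
  proof -
    have "2 * pi * a \<le> 8 * a" using pi_less_4 that by (intro mult_right_mono) auto
    then show ?thesis using that by linarith
  qed
  have "dist (polar s t) (polar u v) \<le> 10 * e"
    using dist_polar[of t v s u] pi[of "\<bar>s - u\<bar>"] assms by (simp add: params_def)
  moreover have "dist (polar s' t') (polar u' v') \<le> 10 * e"
    using dist_polar[of t' v' s' u'] pi[of "\<bar>s' - u'\<bar>"] assms by (simp add: params_def)
  moreover have "dist (polar2 (s, t, s', t')) (polar2 (u, v, u', v')) \<le> dist (polar s t) (polar u v) + dist (polar s' t') (polar u' v')"
    unfolding polar2_def by (simp add: dist_Pair_Pair) (rule sqrt_sum_squares_le_sum, auto)
  ultimately show ?thesis by linarith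
qed

lemma act_snd_mult:
  assumes "w ^ n = 1" "\<omega> * zeta = w"
  shows "int (log_zeta \<omega>) = (int (log_zeta w) - 1) mod int n"
proof -
  have z: "zeta \<noteq> 0" by (simp add: zeta_def)
  have "\<omega> ^ n = 1"
    using assms zeta_pow by (metis mult_cancel_right2 power_mult_distrib mult.commute mult_1)
  from log_zeta_mult[OF this] have "(int (log_zeta w) - 1) mod int n = (int (log_zeta \<omega>)) mod int n"
    using assms by (simp add: mult.commute mod_simps)
  then show ?thesis using log_zeta[OF \<open>\<omega> ^ n = 1\<close>] by simp
qed

section \<open>The labelling of a fine grid\<close>

lemma labelling_exists:
  assumes "TC_le Y m"
  obtains \<l> K M where "cell_labelling \<l> n K M" "\<And>p. idx (\<l> p) \<le> m"
proof -
  obtain U where U: "\<And>i. i \<le> m \<Longrightarrow> openin (top_of_set (Y \<times> Y)) (U i)" "\<And>i. i \<le> m \<Longrightarrow> \<exists>h. motion_planner Y (U i) h"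
      and UY: "(\<Union>i\<le>m. U i) = Y \<times> Y"
    using assms by (auto simp: TC_le_def)
  define good where "good i s \<longleftrightarrow> continuous_on (lift_dom (U i)) s \<and> (\<forall>q\<in>lift_dom (U i). s q ^ n = 1) \<and>
    (\<forall>x y \<omega>. (x, y) \<in> lift_dom (U i) \<longrightarrow> \<omega> ^ n = 1 \<longrightarrow> s (act \<omega> x, y) = \<omega> * s (x, y)) \<and>
    (\<forall>x y \<omega>. (x, y) \<in> lift_dom (U i) \<longrightarrow> \<omega> ^ n = 1 \<longrightarrow> s (x, act \<omega> y) * \<omega> = s (x, y))" for i s
  have "\<exists>s. good i s" if i: "i \<le> m" for i
  proof -
    obtain h where "motion_planner Y (U i) h" using U(2)[OF i] by blast
    then show ?thesis by (rule motion_planner_label) (auto simp: good_def)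
  qed
  then obtain s where s': "\<And>i. i \<le> m \<Longrightarrow> good i (s i)" by metis
  have s: "\<And>i. i \<le> m \<Longrightarrow> continuous_on (lift_dom (U i)) (s i)"
    "\<And>i q. i \<le> m \<Longrightarrow> q \<in> lift_dom (U i) \<Longrightarrow> s i q ^ n = 1"
    "\<And>i x y \<omega>. i \<le> m \<Longrightarrow> (x, y) \<in> lift_dom (U i) \<Longrightarrow> \<omega> ^ n = 1 \<Longrightarrow> s i (act \<omega> x, y) = \<omega> * s i (x, y)"
    "\<And>i x y \<omega>. i \<le> m \<Longrightarrow> (x, y) \<in> lift_dom (U i) \<Longrightarrow> \<omega> ^ n = 1 \<Longrightarrow> s i (x, act \<omega> y) * \<omega> = s i (x, y)"
    using s' unfolding good_def by blast+
  have "\<exists>G. open G \<and> U i = (Y \<times> Y) \<inter> G" if "i \<le> m" for i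
    using U(1)[OF that] by (auto simp: openin_open)
  then obtain G where G: "\<And>i. i \<le> m \<Longrightarrow> open (G i) \<and> U i = (Y \<times> Y) \<inter> G i" by metis
  have cY: "compact Y" by (intro compact_cone_set continuous_intros)
  obtain \<delta> where \<delta>: "\<delta> > 0" "\<And>T. T \<subseteq> Y \<times> Y \<Longrightarrow> diameter T < \<delta> \<Longrightarrow> \<exists>B\<in>G ` {..m}. T \<subseteq> B"
  proof (rule Lebesgue_number_lemma[of "Y \<times> Y" "G ` {..m}"])
    show "compact (Y \<times> Y)" by (intro compact_Times cY)
    show "Y \<times> Y \<subseteq> \<Union> (G ` {..m})" using UY G by fastforce
    show "open B" if "B \<in> G ` {..m}" for B using that G by auto
  qed (auto intro: that)
  \<comment> \<open>Balls of radius \<open>e\<close> have diameter at most \<open>2 * e\<close>,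
    below the Lebesgue number \<open>\<delta>\<close>.\<close>
  define e where "e = \<delta> / 3"
  have e: "e > 0" using \<delta>(1) by (simp add: e_def)
  have ex: "\<exists>i\<le>m. (Y \<times> Y) \<inter> ball y e \<subseteq> U i" for y
  proof -
    have "diameter ((Y \<times> Y) \<inter> ball y e) \<le> diameter (ball y e)"
      by (intro diameter_subset) auto
    also have "\<dots> \<le> 2 * e" using e by (simp add: diameter_ball)
    finally have "diameter ((Y \<times> Y) \<inter> ball y e) < \<delta>" using \<delta>(1) by (simp add: e_def)
    then obtain i where "i \<le> m" "(Y \<times> Y) \<inter> ball y e \<subseteq> G i" using \<delta>(2)[of "(Y \<times> Y) \<inter> ball y e"] by auto
    then show ?thesis using G[of i] by auto
  qed
  \<comment> \<open>The index depends on the image in the cone only, so deck transformations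
    preserve it. It asks for a whole ball inside the member, so that the member contains the images
    of all points of a cube around.\<close>
  define ind where "ind y = (LEAST i. i \<le> m \<and> (Y \<times> Y) \<inter> ball y e \<subseteq> U i)" for y
  have ind: "ind y \<le> m" "(Y \<times> Y) \<inter> ball y e \<subseteq> U (ind y)" for y
    using LeastI_ex[OF ex[of y, unfolded Bex_def]] unfolding ind_def by auto
  obtain \<eta> where \<eta>: "\<eta> > 0" "\<And>x x'. x \<in> cover \<times> cover \<Longrightarrow> x' \<in> cover \<times> cover \<Longrightarrow> dist x' x < \<eta> \<Longrightarrow> dist (base_pt x') (base_pt x) < e"
    using uniformly_continuous_base_pt e unfolding uniformly_continuous_on_def by metis
  \<comment> \<open>The 20 is the constant of \<open>dist_polar2\<close>; the angular step
    \<open>1 / N\<close> does not exceed the radial step \<open>1 / K\<close>.\<close>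
  obtain K :: nat where K: "K > 0" "1 / real K < \<eta> / 20"
    using \<eta>(1) by (metis zero_less_divide_iff nat_approx_posE zero_less_numeral zero_less_Suc)
  define N where "N = n * K"
  have N: "N > 0" "K \<le> N" using n2 K by (auto simp: N_def)
  let ?r = "grid_real K K"
  define \<l> where "\<l> p = (let q = polar2 (?r p); i = ind (base_pt q) in Label i (int (log_zeta (s i q))))" for p
  have rp: "?r p \<in> params" for p
    using K by (cases p) (auto simp: grid_real_def params_def)
  have base_in: "base_pt q \<in> Y \<times> Y" if "q \<in> cover \<times> cover" for q
    using that pr_image by (auto simp: base_pt_def)
  have dom: "q \<in> lift_dom (U (ind y))" if "q \<in> cover \<times> cover" "dist (base_pt q) y < e" for q y
    using that ind(2)[of y] base_in[OF that(1)] by (auto simp: lift_dom_def base_pt_def dist_commute)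
  have dom0: "q \<in> lift_dom (U (ind (base_pt q)))" if "q \<in> cover \<times> cover" for q
    using dom[OF that] e by simp
  have consistent: "\<l> q = \<l> q'" if q: "q \<in> cube p" "q' \<in> cube p" "idx (\<l> q) = idx (\<l> q')" for p q q'
  proof -
    obtain a b c d where p: "p = Pos a b c d" by (cases p)
    \<comment> \<open>The box in parameter space spanned by the cube. It is connected and is carried
      into the domain of one label function, whose values are finitely many roots; so this function
      is constant on it.\<close>
    define R where "R = {real a / N..real (Suc a) / N} \<times> {real (min b K) / K..real (min (Suc b) K) / K}
       \<times> {real c / N..real (Suc c) / N} \<times> {real (min d K) / K..real (min (Suc d) K) / K}"
    have Rp: "R \<subseteq> params"
    proof -
      have b: "0 \<le> real (min x K) / K" "real (min x K) / K \<le> 1" for x using K by auto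
      show ?thesis
      proof
        fix x assume x: "x \<in> R"
        obtain s t u v where e: "x = (s, t, u, v)" by (cases x)
        have "t \<in> {0..1}" "v \<in> {0..1}"
          using x b[of b] b[of "Suc b"] b[of d] b[of "Suc d"] unfolding e R_def mem_Times_iff fst_conv snd_conv atLeastAtMost_iff by linarith+
        then show "x \<in> params" by (simp add: e params_def)
      qed
    qed
    have qR: "?r x \<in> R" if "x \<in> cube p" for x
    proof -
      obtain a' b' c' d' where x: "x = Pos a' b' c' d'" by (cases x)
      have "a' \<in> {a, Suc a}" "b' \<in> {b, Suc b}" "c' \<in> {c, Suc c}" "d' \<in> {d, Suc d}"
        using that unfolding x p cube_def by auto
      then show ?thesis
        unfolding R_def x grid_real_def N_def[symmetric] using K N by (auto simp: divide_right_mono)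
    qed
    have close: "dist (polar2 x) (polar2 x') < \<eta>" if x: "x \<in> R" "x' \<in> R" for x x'
    proof -
      obtain s1 t1 u1 v1 where x1: "x = (s1, t1, u1, v1)" by (cases x)
      obtain s2 t2 u2 v2 where x2: "x' = (s2, t2, u2, v2)" by (cases x')
      have 1: "real (Suc k) / N - real k / N \<le> 1 / K" for k
      proof -
        have "real (Suc k) / N - real k / N = 1 / N" by (simp add: diff_divide_distrib[symmetric])
        also have "\<dots> \<le> 1 / K" using N K by (intro divide_left_mono) auto
        finally show ?thesis .
      qed
      have 2: "real (min (Suc k) K) / K - real (min k K) / K \<le> 1 / K" for k
        using K by (simp add: diff_divide_distrib[symmetric] divide_right_mono)
      have "\<bar>s1 - s2\<bar> \<le> 1 / K" "\<bar>t1 - t2\<bar> \<le> 1 / K" "\<bar>u1 - u2\<bar> \<le> 1 / K" "\<bar>v1 - v2\<bar> \<le> 1 / K"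
        using x 1[of a] 1[of c] 2[of b] 2[of d] unfolding x1 x2 R_def by (simp_all only: mem_Times_iff atLeastAtMost_iff fst_conv snd_conv, linarith+)
      then have "dist (polar2 x) (polar2 x') \<le> 20 * (1 / K)"
        unfolding x1 x2 using x Rp by (intro dist_polar2) (auto simp: x1 x2)
      then show ?thesis using K by simp
    qed
    have cov: "polar2 x \<in> cover \<times> cover" if "x \<in> R" for x using polar2_cover Rp that by blast
    define i where "i = ind (base_pt (polar2 (?r q)))"
    have i': "ind (base_pt (polar2 (?r q'))) = i" using q(3) by (simp add: \<l>_def Let_def i_def)
    have Rdom: "polar2 x \<in> lift_dom (U i)" if "x \<in> R" for x
      unfolding i_def
      by (rule dom[OF cov[OF that] \<eta>(2)[OF cov[OF qR[OF q(1)]] cov[OF that] close[OF that qR[OF q(1)]]]])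
    have "(\<lambda>x. s i (polar2 x)) constant_on R"
    proof (rule continuous_finite_range_constant)
      show "connected R" unfolding R_def by (intro connected_Times connected_Icc)
      show "continuous_on R (\<lambda>x. s i (polar2 x))"
        using Rdom ind(1) by (intro continuous_on_compose2[OF s(1) continuous_on_polar2]) (auto simp: i_def)
      have "(\<lambda>x. s i (polar2 x)) ` R \<subseteq> {\<omega>. \<omega> ^ n = 1}"
        using s(2)[OF _ Rdom] ind(1) by (auto simp: i_def)
      then show "finite ((\<lambda>x. s i (polar2 x)) ` R)" using finite_roots finite_subset by blast
    qed
    then have "s i (polar2 (?r q)) = s i (polar2 (?r q'))"
      using qR[OF q(1)] qR[OF q(2)] unfolding constant_on_def by auto
    then show ?thesis unfolding \<l>_def Let_def i' i_def[symmetric] by simp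
  qed
  have lab: "\<l> p = Label (ind (base_pt q)) (int (log_zeta (s (ind (base_pt q)) q)))" if "polar2 (?r p) = q" for p q
    using that by (simp add: \<l>_def Let_def)
  have root: "s (ind (base_pt q)) q ^ n = 1" if "q \<in> cover \<times> cover" for q
    using s(2)[OF ind(1) dom0[OF that]] .
  have n0: "real n > 0" using n2 by simp
  have pc: "polar s' (real (min t K) / K) \<in> cover" for s' t using K by (intro polar_cover) auto
  have "cell_labelling \<l> n K K"
  proof unfold_locales
    show "\<And>q p q'. q \<in> cube p \<Longrightarrow> q' \<in> cube p \<Longrightarrow> idx (\<l> q) = idx (\<l> q') \<Longrightarrow> \<l> q = \<l> q'" by (rule consistent)
    show "0 < int n" using n2 by simp
    fix p show "0 \<le> grp (\<l> p)" by (simp add: \<l>_def Let_def)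
    show "grp (\<l> p) < int n"
      using log_zeta[OF root[OF polar2_cover[OF rp[of p]]]] by (simp add: \<l>_def Let_def)
  next
    fix a b c d :: nat
    have st: "real (a + K) / real N = real a / N + 1 / n" for a
      using K n0 by (simp add: N_def field_simps)
    have sN: "real (a + n * K) / real N = real a / N + 1" for a
      using K n0 by (simp add: N_def field_simps)
    have cyc: "cyclic_cochains (int n)" using n2 by unfold_locales simp
    let ?x = "\<lambda>a b. polar (real a / N) (real (min b K) / K)"
    have pos: "polar2 (?r (Pos a b c d)) = (?x a b, ?x c d)" for a b c d
      by (simp add: grid_real_def polar2_def N_def)
    have K1: "real (min K K) / K = 1" using K by simp
    have xr: "?x (a + K) K = act zeta (?x a K)" for a
      unfolding K1 st by (rule polar_rotate)
    show "\<l> (Pos (a + K) K c d) = cyclic_cochains.sh (int n) 1 (\<l> (Pos a K c d))"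
    proof -
      let ?q = "(?x a K, ?x c d)" and ?q' = "(act zeta (?x a K), ?x c d)"
      have q: "?q \<in> cover \<times> cover" by (simp only: mem_Times_iff fst_conv snd_conv pc simp_thms)
      have b: "base_pt ?q' = base_pt ?q" by (simp add: base_pt_def pr_act[OF zeta_pow])
      have "s (ind (base_pt ?q)) ?q' = zeta * s (ind (base_pt ?q)) ?q"
        by (rule s(3)[OF ind(1) dom0[OF q] zeta_pow])
      then show ?thesis
        unfolding lab[OF pos] xr b cyclic_cochains.sh_def[OF cyc]
        using log_zeta_mult[OF root[OF q]] by simp
    qed
    show "\<l> (Pos a b (c + K) K) = cyclic_cochains.sh (int n) (- 1) (\<l> (Pos a b c K))"
    proof -
      let ?q = "(?x a b, ?x c K)" and ?q' = "(?x a b, act zeta (?x c K))"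
      have q: "?q \<in> cover \<times> cover" by (simp only: mem_Times_iff fst_conv snd_conv pc simp_thms)
      have b: "base_pt ?q' = base_pt ?q" by (simp add: base_pt_def pr_act[OF zeta_pow])
      have "s (ind (base_pt ?q)) ?q' * zeta = s (ind (base_pt ?q)) ?q"
        by (rule s(4)[OF ind(1) dom0[OF q] zeta_pow])
      then show ?thesis
        unfolding lab[OF pos] xr b cyclic_cochains.sh_def[OF cyc]
        using act_snd_mult[OF root[OF q]] by simp
    qed
    have z: "polar u (real (min 0 K) / K) = polar 0 0" for u by (simp add: polar_0[of u])
    show "\<l> (Pos a 0 c d) = \<l> (Pos 0 0 c d)" unfolding lab[OF pos] z ..
    show "\<l> (Pos a b c 0) = \<l> (Pos a b 0 0)" unfolding lab[OF pos] z ..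
    show "\<l> (Pos (a + n * K) b c d) = \<l> (Pos a b c d)" unfolding lab[OF pos] sN polar_period ..
    show "\<l> (Pos a b (c + n * K) d) = \<l> (Pos a b c d)" unfolding lab[OF pos] sN polar_period ..
  qed
  moreover have "idx (\<l> p) \<le> m" for p using ind(1) by (simp add: \<l>_def Let_def)
  ultimately show thesis by (rule that)
qed

theorem not_TC_le_2: "\<not> TC_le Y 2"
proof
  assume "TC_le Y 2"
  then obtain \<l> K M where l: "cell_labelling \<l> n K M" "\<And>p. idx (\<l> p) \<le> 2" by (rule labelling_exists) (rule that)
  have "idx (\<l> p) < 3" for p using l(2)[of p] by simp
  then have "n = 1" by (rule cell_labelling.three_indices[OF l(1)])
  then show False using n2 by simp
qed

theorem not_TC_le_3:
  assumes "n \<ge> 3"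
  shows "\<not> TC_le Y 3"
proof
  assume "TC_le Y 3"
  then obtain \<l> K M where l: "cell_labelling \<l> n K M" "\<And>p. idx (\<l> p) \<le> 3" by (rule labelling_exists) (rule that)
  have "idx (\<l> p) < 4" for p using l(2)[of p] by simp
  then have "n dvd 2" by (rule cell_labelling.four_indices[OF l(1)])
  then have "n \<le> 2" by (rule dvd_imp_le) simp
  then show False using assms by simp
qed

end

section \<open>The wedge of a circle and a sphere\<close>

lemma homotopic_canonI:
  fixes K :: "'a::topological_space set" and T :: "'b::topological_space set"
  assumes "continuous_on ({0..1::real} \<times> K) h" "\<And>t x. t \<in> {0..1} \<Longrightarrow> x \<in> K \<Longrightarrow> h (t, x) \<in> T"
    "\<And>x. x \<in> K \<Longrightarrow> h (0, x) = p x" "\<And>x. x \<in> K \<Longrightarrow> h (1, x) = q x"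
  shows "homotopic_with_canon (\<lambda>x. True) K T p q"
  using assms by (subst homotopic_with) (auto intro!: exI[of _ h])

lemma sum_squares_1_bounds:
  fixes a b :: real
  assumes "a\<^sup>2 + b\<^sup>2 = 1"
  shows "\<bar>a\<bar> \<le> 1" "\<bar>b\<bar> \<le> 1"
proof -
  have "a\<^sup>2 \<le> 1\<^sup>2" "b\<^sup>2 \<le> 1\<^sup>2"
    using assms zero_le_power2[of a] zero_le_power2[of b] unfolding one_power2 by linarith+
  then show "\<bar>a\<bar> \<le> 1" "\<bar>b\<bar> \<le> 1" by (simp_all add: abs_square_le_1)
qed

text \<open>The product of a circle and a sphere, embedded in \<open>\<complex>\<^sup>2\<close> as the boundary of a tube around
  the circle of radius 2.\<close>

definition tube :: "(complex \<times> complex) set" where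
  "tube = {x. (norm (fst x) - 2)\<^sup>2 + (norm (snd x))\<^sup>2 = 1}"

lemma compact_tube: "compact tube"
proof -
  have "closed tube"
    unfolding tube_def by (intro closed_Collect_eq continuous_intros)
  moreover have "bounded tube"
  proof (rule bounded_subset)
    show "bounded (cball (0::complex) 3 \<times> cball (0::complex) 1)" by (intro bounded_Times bounded_cball)
    show "tube \<subseteq> cball 0 3 \<times> cball 0 1"
    proof
      fix x assume "x \<in> tube"
      then have e: "(norm (fst x) - 2)\<^sup>2 + (norm (snd x))\<^sup>2 = 1" by (simp add: tube_def)
      have "\<bar>norm (fst x) - 2\<bar> \<le> 1" "norm (snd x) \<le> 1"
        using sum_squares_1_bounds[OF e] by auto
      then show "x \<in> cball 0 3 \<times> cball 0 1" by (simp add: mem_Times_iff)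
    qed
  qed
  ultimately show ?thesis by (simp add: compact_eq_bounded_closed)
qed

lemma tube_norm:
  assumes "x \<in> tube"
  shows "norm (fst x) \<ge> 1"
proof -
  have "\<bar>norm (fst x) - 2\<bar> \<le> 1"
    using assms sum_squares_1_bounds(1) by (simp add: tube_def)
  then show ?thesis by simp
qed

text \<open>By Borsuk's theorem it is enough that \<open>(2, 0)\<close>, a point inside the tube,
  lies in a bounded component of the complement. There \<open>?\<phi>\<close> avoids the value 1,
  hence stays below it by connectedness.\<close>

lemma tube_essential:
  "\<nexists>c. homotopic_with_canon (\<lambda>x. True) tube (- {0}) (\<lambda>x. x - (2, 0)) (\<lambda>x. c)"
proof
  let ?a = "(2, 0) :: complex \<times> complex"
  let ?\<phi> = "\<lambda>x :: complex \<times> complex. (norm (fst x) - 2)\<^sup>2 + (norm (snd x))\<^sup>2"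
  let ?C = "connected_component_set (- tube) ?a"
  assume "\<exists>c. homotopic_with_canon (\<lambda>x. True) tube (- {0}) (\<lambda>x. x - (2, 0)) (\<lambda>x. c)"
  then obtain c where "homotopic_with_canon (\<lambda>x. True) tube (- {0}) (\<lambda>x. x - (2, 0)) (\<lambda>x. c)" by blast
  moreover have "continuous_map (top_of_set (- {0})) (top_of_set (sphere 0 1)) (\<lambda>x :: complex \<times> complex. inverse (norm x) *\<^sub>R x)"
    by (auto simp: continuous_map_in_subtopology intro!: continuous_intros)
  ultimately have "homotopic_with_canon (\<lambda>x. True) tube (sphere 0 1)
      ((\<lambda>x. inverse (norm x) *\<^sub>R x) \<circ> (\<lambda>x. x - (2, 0))) ((\<lambda>x. inverse (norm x) *\<^sub>R x) \<circ> (\<lambda>x. c))"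
    by (rule homotopic_with_compose_continuous_map_left) auto
  then have "\<exists>c. homotopic_with_canon (\<lambda>x. True) tube (sphere 0 1)
     (\<lambda>x. inverse (norm (x - ?a)) *\<^sub>R (x - ?a)) (\<lambda>x. c)"
    unfolding comp_def by blast
  moreover have "?a \<notin> tube" by (simp add: tube_def)
  ultimately have "\<not> bounded ?C"
    using Borsuk_map_essential_bounded_component[OF compact_tube] by blast
  moreover have "?C \<subseteq> ball 0 3 \<times> ball 0 1"
  proof
    fix x assume x: "x \<in> ?C"
    have con: "connected (?\<phi> ` ?C)"
      by (intro connected_continuous_image continuous_intros connected_connected_component)
    have "?\<phi> y \<noteq> 1" if "y \<in> ?C" for y
      using that connected_component_subset[of "- tube" ?a] by (auto simp: tube_def)
    then have "1 \<notin> ?\<phi> ` ?C" by auto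
    moreover have "?a \<in> ?C" using \<open>?a \<notin> tube\<close> by simp
    then have "?\<phi> ?a \<in> ?\<phi> ` ?C" by (rule imageI)
    moreover have "?\<phi> x \<in> ?\<phi> ` ?C" using x by (rule imageI)
    ultimately have lt: "?\<phi> x < 1"
      using connectedD_interval[OF con, of "?\<phi> ?a" "?\<phi> x" 1] by (cases "?\<phi> x < 1") auto
    then have "(norm (fst x) - 2)\<^sup>2 < 1\<^sup>2" "(norm (snd x))\<^sup>2 < 1\<^sup>2"
      using zero_le_power2[of "norm (fst x) - 2"] zero_le_power2[of "norm (snd x)"] unfolding one_power2 by linarith+
    then have "\<bar>norm (fst x) - 2\<bar> < 1" "norm (snd x) < 1"
      using abs_square_less_1[of "norm (fst x) - 2"] abs_square_less_1[of "norm (snd x)"] by auto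
    then show "x \<in> ball 0 3 \<times> ball 0 1" by (simp add: mem_Times_iff)
  qed
  then have "bounded ?C"
    by (rule bounded_subset[rotated]) (intro bounded_Times bounded_ball)
  ultimately show False by blast
qed

section \<open>The wedge, its two factors and the tube\<close>

abbreviation "wedge \<equiv> cone_set (\<lambda>z. 1)"

text \<open>Collapses the rim to \<open>(0, 1 / 2)\<close>; the remaining cone becomes a sphere
  around the origin that is round only up to radial projection.\<close>

definition to_sphere :: "complex \<times> complex \<times> real \<Rightarrow> complex \<times> real" where
  "to_sphere y = (fst (snd y), snd (snd y) - 1 / 2)"

definition to_circle :: "complex \<times> complex \<times> real \<Rightarrow> complex" where
  "to_circle y = (if snd (snd y) = 1 then fst y else 1)"

text \<open>With \<open>t = (1 + snd v) / 2\<close> a unit vector satisfies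
  \<open>t * (1 - t) = (norm (fst v))\<^sup>2 / 4\<close>, which explains the middle
  component.\<close>

definition from_sphere :: "complex \<times> real \<Rightarrow> complex \<times> complex \<times> real" where
  "from_sphere v = (of_real ((1 + snd v) / 2), of_real (norm (fst v) / 4) * fst v, (1 + snd v) / 2)"

lemma to_sphere_nonzero: "y \<in> wedge \<Longrightarrow> to_sphere y \<noteq> 0"
  by (auto simp: cone_set_def to_sphere_def cone_pt_def rim_def zero_prod_def)

lemma continuous_on_to_sphere: "continuous_on S to_sphere"
  unfolding to_sphere_def by (intro continuous_intros)

text \<open>The cone part and the rim are closed and meet in \<open>rim 1\<close>, where both
  formulas give 1.\<close>

lemma continuous_on_to_circle: "continuous_on wedge to_circle"
  unfolding cone_set_def
proof (rule continuous_on_closed_Un)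
  have "compact (cone_pt (\<lambda>z. 1) ` (circle \<times> {0..1}))" "compact (rim ` circle)"
    by (intro compact_continuous_image continuous_on_cone_pt continuous_on_rim compact_Times continuous_intros; simp)+
  then show "closed (cone_pt (\<lambda>z. 1) ` (circle \<times> {0..1}))" "closed (rim ` circle)"
    by (auto intro: compact_imp_closed)
  show "continuous_on (cone_pt (\<lambda>z. 1) ` (circle \<times> {0..1})) to_circle"
    by (rule continuous_on_eq[of _ "\<lambda>_. 1"]) (auto simp: to_circle_def cone_pt_def)
  show "continuous_on (rim ` circle) to_circle"
    by (rule continuous_on_eq[of _ fst]) (auto simp: to_circle_def rim_def intro: continuous_intros)
qed

lemma to_circle_in: "y \<in> wedge \<Longrightarrow> to_circle y \<in> circle"
  by (auto simp: cone_set_def to_circle_def cone_pt_def rim_def)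

lemma from_sphere_in:
  assumes "norm (fst v)^2 + (snd v)^2 = 1"
  shows "from_sphere v \<in> wedge"
proof -
  obtain b \<tau> where v: "v = (b, \<tau>)" by (cases v)
  define t where "t = (1 + \<tau>) / 2"
  have "\<bar>\<tau>\<bar> \<le> 1" using assms sum_squares_1_bounds(2)[of "norm b" \<tau>] by (simp add: v)
  then have t: "t \<in> {0..1}" by (auto simp: t_def)
  have tt: "t * (1 - t) = norm b ^ 2 / 4"
    using assms by (simp add: t_def v field_simps power2_eq_square)
  define x where "x = (if b = 0 then 1 else sgn b)"
  have x1: "x \<in> circle" by (simp add: x_def norm_sgn)
  have "b = of_real (norm b) * x" by (simp add: x_def sgn_div_norm scaleR_conv_of_real)
  note x = x1 this
  have "of_real (t * (1 - t)) * x = of_real (norm b / 4) * b"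
    unfolding tt using x(2) by (simp add: power2_eq_square)
  moreover have "from_sphere v = (of_real t, of_real (norm b / 4) * b, t)"
    by (simp add: from_sphere_def v t_def)
  ultimately have "from_sphere v = cone_pt (\<lambda>z. 1) (x, t)"
    by (simp only: cone_pt_def fst_conv snd_conv mult_1_right)
  then show ?thesis using x t by (auto simp: cone_set_def)
qed

lemma to_circle_from_sphere: "to_circle (from_sphere v) = 1"
  by (auto simp: to_circle_def from_sphere_def)

lemma continuous_on_from_sphere: "continuous_on S from_sphere"
  unfolding from_sphere_def by (intro continuous_intros) auto

text \<open>The point of the tube with circle coordinate \<open>u\<close> and sphere direction
  \<open>w / norm w\<close>, as seen from \<open>(2, 0)\<close>.\<close>

definition tube_map :: "complex \<Rightarrow> complex \<times> real \<Rightarrow> complex \<times> complex" where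
  "tube_map u w = (of_real (2 + snd w / norm w) * u - 2, of_real (inverse (norm w)) * fst w)"

text \<open>If the second component vanishes, \<open>w\<close> lies on the axis, and the first one
  is \<open>3 * u - 2\<close> or \<open>u - 2\<close>.\<close>

lemma tube_map_nonzero:
  assumes "u \<in> circle" "w \<noteq> 0"
  shows "tube_map u w \<noteq> 0"
proof
  assume z: "tube_map u w = 0"
  then have "fst w = 0" using assms by (simp add: tube_map_def zero_prod_def)
  then have n: "norm w = \<bar>snd w\<bar>" by (simp add: norm_prod_def)
  have "snd w \<noteq> 0" using n assms(2) by auto
  then have "snd w / norm w = 1 \<or> snd w / norm w = - 1" unfolding n by (auto simp: abs_if)
  then have "norm (of_real (2 + snd w / norm w) * u) = 3 \<or> norm (of_real (2 + snd w / norm w) * u) = 1"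
    using assms(1) by (auto simp: norm_mult simp del: of_real_add of_real_divide)
  moreover have "of_real (2 + snd w / norm w) * u = 2" using z by (simp add: tube_map_def zero_prod_def)
  ultimately show False by auto
qed

text \<open>With two planners, moving the first coordinate over one set and the second over the other compresses
  the product of the circle and the sphere into their wedge.\<close>

theorem not_TC_le_1_wedge: "\<not> TC_le wedge 1"
proof
  assume "TC_le wedge 1"
  then obtain U where U: "\<And>i. i \<le> 1 \<Longrightarrow> openin (top_of_set (wedge \<times> wedge)) (U i)"
      "\<And>i. i \<le> 1 \<Longrightarrow> \<exists>h. motion_planner wedge (U i) h" and UY: "(\<Union>i\<le>1::nat. U i) = wedge \<times> wedge"
    by (auto simp: TC_le_def)
  \<comment> \<open>A point of the tube splits into the direction \<open>sgn (fst x)\<close> on the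
    circle and the unit vector \<open>v x\<close> on the sphere; \<open>\<Psi>\<close> places these
    in the two parts of the wedge.\<close>
  define v where "v x = (snd x, norm (fst x) - 2)" for x :: "complex \<times> complex"
  define \<Psi> where "\<Psi> x = (rim (sgn (fst x)), from_sphere (v x))" for x
  have fst0: "fst x \<noteq> 0" if "x \<in> tube" for x using tube_norm[OF that] by auto
  have u: "sgn (fst x) \<in> circle" if "x \<in> tube" for x using fst0[OF that] by (simp add: norm_sgn)
  have v1: "norm (fst (v x))^2 + (snd (v x))^2 = 1" if "x \<in> tube" for x
    using that by (simp add: tube_def v_def add.commute)
  have csgn: "continuous_on tube (\<lambda>x. sgn (fst x))"
    using fst0 by (intro continuous_intros) auto
  have cv: "continuous_on tube v" unfolding v_def by (intro continuous_intros)
  have c\<Psi>: "continuous_on tube \<Psi>"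
    unfolding \<Psi>_def
    by (intro continuous_intros continuous_on_compose2[OF continuous_on_rim[of UNIV] csgn]
       continuous_on_compose2[OF continuous_on_from_sphere[of UNIV] cv]) auto
  have \<Psi>: "\<Psi> x \<in> wedge \<times> wedge" if "x \<in> tube" for x
    using u[OF that] from_sphere_in[OF v1[OF that]] by (auto simp: \<Psi>_def cone_set_def)
  define V where "V i = tube \<inter> \<Psi> -` U i" for i
  have V: "openin (top_of_set tube) (V i)" if "i \<le> 1" for i
    unfolding V_def by (rule continuous_openin_preimage[OF c\<Psi> _ U(1)[OF that]]) (use \<Psi> in auto)
  have Vcov: "x \<in> V 0 \<or> x \<in> V 1" if "x \<in> tube" for x
  proof -
    have "\<Psi> x \<in> (\<Union>i\<le>1. U i)" using \<Psi>[OF that] UY by simp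
    then obtain i where "i \<le> 1" "\<Psi> x \<in> U i" by auto
    then have "i = 0 \<or> i = 1" by linarith
    then show ?thesis using \<open>\<Psi> x \<in> U i\<close> that by (auto simp: V_def)
  qed
  obtain h0 where "motion_planner wedge (U 0) h0" using U(2)[of 0] by auto
  then have h0: "continuous_on (U 0 \<times> {0..1}) h0" "h0 ` (U 0 \<times> {0..1}) \<subseteq> wedge"
      "\<And>p. p \<in> U 0 \<Longrightarrow> h0 (p, 0) = fst p" "\<And>p. p \<in> U 0 \<Longrightarrow> h0 (p, 1) = snd p"
    unfolding motion_planner_def by blast+
  obtain h1 where "motion_planner wedge (U 1) h1" using U(2)[of 1] by auto
  then have h1: "continuous_on (U 1 \<times> {0..1}) h1" "h1 ` (U 1 \<times> {0..1}) \<subseteq> wedge"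
      "\<And>p. p \<in> U 1 \<Longrightarrow> h1 (p, 0) = fst p" "\<And>p. p \<in> U 1 \<Longrightarrow> h1 (p, 1) = snd p"
    unfolding motion_planner_def by blast+
  \<comment> \<open>Seen in the circle, the planned path moves the circle coordinate to 1. Seen in
    the sphere and run backwards, it moves the sphere coordinate to
    \<open>(0, 1 / 2)\<close>.\<close>
  define k0 where "k0 q = to_circle (h0 (\<Psi> (fst q), snd q))" for q :: "(complex \<times> complex) \<times> real"
  define k1 where "k1 q = to_sphere (h1 (\<Psi> (fst q), 1 - snd q))" for q :: "(complex \<times> complex) \<times> real"
  have V\<Psi>: "V i \<subseteq> tube" "x \<in> V i \<Longrightarrow> \<Psi> x \<in> U i" for i x by (auto simp: V_def)
  have k0c: "continuous_on (V 0 \<times> {0..1}) k0"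
    unfolding k0_def
  proof (rule continuous_on_compose2[OF continuous_on_to_circle])
    show "continuous_on (V 0 \<times> {0..1}) (\<lambda>q. h0 (\<Psi> (fst q), snd q))"
      using V\<Psi>(1)[of 0] V\<Psi>(2)[of _ 0]
      by (intro continuous_on_compose2[OF h0(1)] continuous_intros continuous_on_compose2[OF c\<Psi>]) auto
    show "(\<lambda>q. h0 (\<Psi> (fst q), snd q)) ` (V 0 \<times> {0..1}) \<subseteq> wedge"
      using V\<Psi>(1)[of 0] V\<Psi>(2)[of _ 0] h0(2) by (auto simp: image_subset_iff)
  qed
  have k1c: "continuous_on (V 1 \<times> {0..1}) k1"
    unfolding k1_def
  proof (rule continuous_on_compose2[OF continuous_on_to_sphere[of UNIV]])
    show "continuous_on (V 1 \<times> {0..1}) (\<lambda>q. h1 (\<Psi> (fst q), 1 - snd q))"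
      using V\<Psi>(1)[of 1] V\<Psi>(2)[of _ 1]
      by (intro continuous_on_compose2[OF h1(1)] continuous_intros continuous_on_compose2[OF c\<Psi>]) auto
  qed auto
  have k0v: "k0 (x, 0) = sgn (fst x)" "k0 (x, 1) = 1" "t \<in> {0..1} \<Longrightarrow> k0 (x, t) \<in> circle" if "x \<in> V 0" for x t
  proof -
    show "k0 (x, 0) = sgn (fst x)" "k0 (x, 1) = 1"
      using h0(3,4)[OF V\<Psi>(2)[OF that]] to_circle_from_sphere
      by (simp_all add: k0_def \<Psi>_def) (simp add: to_circle_def rim_def)
    show "t \<in> {0..1} \<Longrightarrow> k0 (x, t) \<in> circle"
      using h0(2) V\<Psi>(2)[OF that] unfolding k0_def by (intro to_circle_in) auto
  qed
  have k1v: "k1 (x, 0) = to_sphere (from_sphere (v x))" "k1 (x, 1) = (0, 1 / 2)" "t \<in> {0..1} \<Longrightarrow> k1 (x, t) \<noteq> 0"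
    if "x \<in> V 1" for x t
  proof -
    show "k1 (x, 0) = to_sphere (from_sphere (v x))" "k1 (x, 1) = (0, 1 / 2)"
      using h1(3,4)[OF V\<Psi>(2)[OF that]] by (simp_all add: k1_def \<Psi>_def) (simp add: to_sphere_def rim_def)
    show "t \<in> {0..1} \<Longrightarrow> k1 (x, t) \<noteq> 0"
      using h1(2) V\<Psi>(2)[OF that] unfolding k1_def by (intro to_sphere_nonzero) auto
  qed
  obtain \<mu> :: "complex \<times> complex \<Rightarrow> real" where \<mu>: "continuous_on tube \<mu>" "\<And>x. x \<in> tube \<Longrightarrow> \<mu> x \<in> closed_segment 0 1"
     "\<And>x. x \<in> tube - V 0 \<Longrightarrow> \<mu> x = 0" "\<And>x. x \<in> tube - V 1 \<Longrightarrow> \<mu> x = 1"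
  proof (rule Urysohn_local[of tube "tube - V 0" "tube - V 1" "0::real" 1])
    show "closedin (top_of_set tube) (tube - V 0)" "closedin (top_of_set tube) (tube - V 1)"
      using V by (auto intro!: closedin_diff)
    show "(tube - V 0) \<inter> (tube - V 1) = {}" using Vcov by blast
  qed (rule that)
  \<comment> \<open>The first motion is complete for \<open>\<mu> \<ge> 1 / 2\<close> and rests for
    \<open>\<mu> \<le> 1 / 4\<close>; \<open>P2\<close> is complete for
    \<open>\<mu> \<le> 1 / 2\<close> and rests for \<open>\<mu> \<ge> 3 / 4\<close>. So everywhere
    at least one of the two is completed.\<close>
  define P1 where "P1 q = (if \<mu> (snd q) \<le> 1/4 then sgn (fst (snd q)) else k0 (snd q, fst q * max 0 (min 1 (4 * \<mu> (snd q) - 1))))"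
    for q :: "real \<times> complex \<times> complex"
  define P2 where "P2 q = (if 3/4 \<le> \<mu> (snd q) then to_sphere (from_sphere (v (snd q))) else k1 (snd q, fst q * max 0 (min 1 (3 - 4 * \<mu> (snd q)))))"
    for q :: "real \<times> complex \<times> complex"
  let ?D = "{0..1::real} \<times> tube"
  have c\<mu>: "continuous_on ?D (\<lambda>q. \<mu> (snd q))"
    by (rule continuous_on_compose2[OF \<mu>(1)]) (auto intro: continuous_intros)
  have cl1: "closedin (top_of_set ?D) (?D \<inter> (\<lambda>q. \<mu> (snd q)) -` {..a})" and cl2: "closedin (top_of_set ?D) (?D \<inter> (\<lambda>q. \<mu> (snd q)) -` {a..})" for a
    by (intro continuous_closedin_preimage c\<mu> closed_atMost closed_atLeast)+
  have unit: "a * max 0 (min 1 b) \<in> {0..1}" if "a \<in> {0..1}" for a b :: real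
    using that by (auto simp: mult_le_one)
  have cP1: "continuous_on ?D P1"
  proof -
    let ?A = "?D \<inter> (\<lambda>q. \<mu> (snd q)) -` {..1/4}" and ?B = "?D \<inter> (\<lambda>q. \<mu> (snd q)) -` {1/4..}"
    have AB: "?D = ?A \<union> ?B" by auto
    have "continuous_on (?A \<union> ?B) P1"
      unfolding P1_def
    proof (rule continuous_on_cases_local)
      show "closedin (top_of_set (?A \<union> ?B)) ?A" "closedin (top_of_set (?A \<union> ?B)) ?B"
        unfolding AB[symmetric] by (rule cl1 cl2)+
      show "continuous_on ?A (\<lambda>q. sgn (fst (snd q)))"
        by (rule continuous_on_compose2[OF csgn]) (auto intro: continuous_intros)
      have BV: "snd q \<in> V 0" if "q \<in> ?B" for q using that \<mu>(3)[of "snd q"] by force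
      show "continuous_on ?B (\<lambda>q. k0 (snd q, fst q * max 0 (min 1 (4 * \<mu> (snd q) - 1))))"
      proof (rule continuous_on_compose2[OF k0c])
        show "continuous_on ?B (\<lambda>q. (snd q, fst q * max 0 (min 1 (4 * \<mu> (snd q) - 1))))"
          by (intro continuous_intros continuous_on_max continuous_on_min continuous_on_subset[OF c\<mu>]) auto
        show "(\<lambda>q. (snd q, fst q * max 0 (min 1 (4 * \<mu> (snd q) - 1)))) ` ?B \<subseteq> V 0 \<times> {0..1}"
        proof (intro image_subsetI SigmaI)
          fix q assume "q \<in> ?B"
          then show "snd q \<in> V 0" by (rule BV)
          from \<open>q \<in> ?B\<close> have "fst q \<in> {0..1}" by auto
          then show "fst q * max 0 (min 1 (4 * \<mu> (snd q) - 1)) \<in> {0..1}" by (rule unit)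
        qed
      qed
      fix q assume "q \<in> ?A \<and> \<not> \<mu> (snd q) \<le> 1/4 \<or> q \<in> ?B \<and> \<mu> (snd q) \<le> 1/4"
      then have "q \<in> ?B" "\<mu> (snd q) = 1/4" by auto
      then show "sgn (fst (snd q)) = k0 (snd q, fst q * max 0 (min 1 (4 * \<mu> (snd q) - 1)))"
        using k0v(1)[OF BV] by simp
    qed
    then show ?thesis using AB by simp
  qed
  have cP2: "continuous_on ?D P2"
  proof -
    let ?A = "?D \<inter> (\<lambda>q. \<mu> (snd q)) -` {3/4..}" and ?B = "?D \<inter> (\<lambda>q. \<mu> (snd q)) -` {..3/4}"
    have AB: "?D = ?A \<union> ?B" by auto
    have "continuous_on (?A \<union> ?B) P2"
      unfolding P2_def
    proof (rule continuous_on_cases_local)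
      show "closedin (top_of_set (?A \<union> ?B)) ?A" "closedin (top_of_set (?A \<union> ?B)) ?B"
        unfolding AB[symmetric] by (rule cl1 cl2)+
      show "continuous_on ?A (\<lambda>q. to_sphere (from_sphere (v (snd q))))"
        by (rule continuous_on_compose2[OF continuous_on_to_sphere[of UNIV]],
            rule continuous_on_compose2[OF continuous_on_from_sphere[of UNIV]],
            rule continuous_on_compose2[OF cv]) (auto intro: continuous_intros)
      have BV: "snd q \<in> V 1" if "q \<in> ?B" for q using that \<mu>(4)[of "snd q"] by force
      show "continuous_on ?B (\<lambda>q. k1 (snd q, fst q * max 0 (min 1 (3 - 4 * \<mu> (snd q)))))"
      proof (rule continuous_on_compose2[OF k1c])
        show "continuous_on ?B (\<lambda>q. (snd q, fst q * max 0 (min 1 (3 - 4 * \<mu> (snd q)))))"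
          by (intro continuous_intros continuous_on_max continuous_on_min continuous_on_subset[OF c\<mu>]) auto
        show "(\<lambda>q. (snd q, fst q * max 0 (min 1 (3 - 4 * \<mu> (snd q))))) ` ?B \<subseteq> V 1 \<times> {0..1}"
        proof (intro image_subsetI SigmaI)
          fix q assume "q \<in> ?B"
          then show "snd q \<in> V 1" by (rule BV)
          from \<open>q \<in> ?B\<close> have "fst q \<in> {0..1}" by auto
          then show "fst q * max 0 (min 1 (3 - 4 * \<mu> (snd q))) \<in> {0..1}" by (rule unit)
        qed
      qed
      fix q assume "q \<in> ?A \<and> \<not> 3/4 \<le> \<mu> (snd q) \<or> q \<in> ?B \<and> 3/4 \<le> \<mu> (snd q)"
      then have "q \<in> ?B" "\<mu> (snd q) = 3/4" by auto
      then show "to_sphere (from_sphere (v (snd q))) = k1 (snd q, fst q * max 0 (min 1 (3 - 4 * \<mu> (snd q))))"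
        using k1v(1)[OF BV] by simp
    qed
    then show ?thesis using AB by simp
  qed
  have P1in: "P1 (t, x) \<in> circle" if "t \<in> {0..1}" "x \<in> tube" for t x
  proof (cases "\<mu> x \<le> 1/4")
    case False
    then have "x \<in> V 0" using \<mu>(3)[of x] that by force
    then have "k0 (x, t * max 0 (min 1 (4 * \<mu> x - 1))) \<in> circle" by (rule k0v(3)[OF _ unit[OF that(1)]])
    then show ?thesis using False by (simp only: P1_def fst_conv snd_conv if_False)
  qed (use u[OF that(2)] in \<open>simp add: P1_def\<close>)
  have P2in: "P2 (t, x) \<noteq> 0" if "t \<in> {0..1}" "x \<in> tube" for t x
  proof (cases "3/4 \<le> \<mu> x")
    case False
    then have "x \<in> V 1" using \<mu>(4)[of x] that by force
    then have "k1 (x, t * max 0 (min 1 (3 - 4 * \<mu> x))) \<noteq> 0" by (rule k1v(3)[OF _ unit[OF that(1)]])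
    then show ?thesis using False by (simp only: P2_def fst_conv snd_conv if_False simp_thms)
  qed (use to_sphere_nonzero[OF from_sphere_in[OF v1[OF that(2)]]] in \<open>simp add: P2_def\<close>)
  have P0: "P1 (0, x) = sgn (fst x)" "P2 (0, x) = to_sphere (from_sphere (v x))" if "x \<in> tube" for x
  proof -
    have "x \<in> V 0" if "\<not> \<mu> x \<le> 1/4" using \<mu>(3)[of x] \<open>x \<in> tube\<close> that by force
    then show "P1 (0, x) = sgn (fst x)" using k0v(1) by (simp add: P1_def)
    have "x \<in> V 1" if "\<not> 3/4 \<le> \<mu> x" using \<mu>(4)[of x] \<open>x \<in> tube\<close> that by force
    then show "P2 (0, x) = to_sphere (from_sphere (v x))" using k1v(1) by (simp add: P2_def)
  qed
  have P1': "P1 (1, x) = 1 \<or> P2 (1, x) = (0, 1/2)" if "x \<in> tube" for x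
  proof (cases "1/2 \<le> \<mu> x")
    case True
    then have "x \<in> V 0" using \<mu>(3)[of x] that by force
    then show ?thesis using True k0v(2) by (simp add: P1_def)
  next
    case False
    then have "x \<in> V 1" using \<mu>(4)[of x] that by force
    then show ?thesis using False k1v(2) by (simp add: P2_def)
  qed
  have cT: "continuous_on S (\<lambda>q. tube_map (f q) (w q))"
    if "continuous_on S f" "continuous_on S w" "\<And>q. q \<in> S \<Longrightarrow> w q \<noteq> 0" for S and f :: "real \<times> complex \<times> complex \<Rightarrow> complex" and w
    unfolding tube_map_def using that by (intro continuous_intros) auto
  have csgnD: "continuous_on ?D (\<lambda>q. sgn (fst (snd q)))"
    by (rule continuous_on_compose2[OF csgn]) (auto intro: continuous_intros)
  have cvD: "continuous_on ?D (\<lambda>q. v (snd q))"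
    by (rule continuous_on_compose2[OF cv]) (auto intro: continuous_intros)
  have cwD: "continuous_on ?D (\<lambda>q. to_sphere (from_sphere (v (snd q))))"
    by (rule continuous_on_compose2[OF continuous_on_to_sphere[of UNIV]],
        rule continuous_on_compose2[OF continuous_on_from_sphere[of UNIV] cvD]) auto
  \<comment> \<open>Replaces the sphere coordinate by its image under the round trip through the
    wedge, along a segment that avoids 0.\<close>
  have A: "homotopic_with_canon (\<lambda>x. True) tube (- {0}) (\<lambda>x. x - (2, 0)) (\<lambda>x. tube_map (sgn (fst x)) (to_sphere (from_sphere (v x))))"
  proof (rule homotopic_canonI)
    let ?w = "\<lambda>q. (1 - fst q) *\<^sub>R v (snd q) + fst q *\<^sub>R to_sphere (from_sphere (v (snd q)))"
    have nz: "?w q \<noteq> 0" if q: "q \<in> ?D" for q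
    proof
      assume z: "?w q = 0"
      obtain t x where tx: "q = (t, x)" by (cases q)
      obtain b \<tau> where b: "v x = (b, \<tau>)" by (cases "v x")
      have t: "0 \<le> t" "t \<le> 1" "x \<in> tube" using q by (auto simp: tx)
      have e: "?w q = (of_real (1 - t + t * norm b / 4) * b, (1 - t / 2) * \<tau>)"
        by (simp add: tx b to_sphere_def from_sphere_def scaleR_conv_of_real algebra_simps)
      have "\<tau> = 0" using z t unfolding e by (auto simp: zero_prod_def)
      then have nb: "norm b = 1"
        using v1[OF t(3)] norm_ge_zero[of b] by (auto simp: b power2_eq_1_iff simp del: norm_ge_zero)
      have "1 - t + t * norm b / 4 > 0" using t nb by auto
      moreover have "b \<noteq> 0" using nb by auto
      ultimately have "of_real (1 - t + t * norm b / 4) * b \<noteq> 0"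
        by (simp only: mult_eq_0_iff of_real_eq_0_iff) auto
      then show False using z unfolding e by (simp add: zero_prod_def)
    qed
    show "continuous_on ?D (\<lambda>q. tube_map (sgn (fst (snd q))) (?w q))"
      by (intro cT csgnD continuous_intros cvD cwD nz)
    show "tube_map (sgn (fst (snd (t, x)))) (?w (t, x)) \<in> - {0}" if "t \<in> {0..1}" "x \<in> tube" for t x
      using tube_map_nonzero[OF u[OF that(2)] nz[of "(t, x)"]] that by simp
    fix x assume x: "x \<in> tube"
    have "norm (v x) = 1" using v1[OF x] by (simp add: norm_prod_def)
    then have "tube_map (sgn (fst x)) (v x) = (of_real (norm (fst x)) * sgn (fst x) - 2, snd x)"
      by (simp add: tube_map_def v_def)
    also have "of_real (norm (fst x)) * sgn (fst x) = fst x"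
      by (simp add: sgn_div_norm scaleR_conv_of_real fst0[OF x])
    finally have "tube_map (sgn (fst x)) (v x) = x - (2, 0)" by (simp add: prod_eq_iff)
    then show "tube_map (sgn (fst (snd (0, x)))) (?w (0, x)) = x - (2, 0)" by simp
  qed simp
  have B: "homotopic_with_canon (\<lambda>x. True) tube (- {0}) (\<lambda>x. tube_map (sgn (fst x)) (to_sphere (from_sphere (v x))))
     (\<lambda>x. tube_map (P1 (1, x)) (P2 (1, x)))"
  proof (rule homotopic_canonI)
    show "continuous_on ?D (\<lambda>q. tube_map (P1 q) (P2 q))"
      using P2in by (intro cT cP1 cP2) auto
    show "tube_map (P1 (t, x)) (P2 (t, x)) \<in> - {0}" if "t \<in> {0..1}" "x \<in> tube" for t x
      using tube_map_nonzero[OF P1in[OF that] P2in[OF that]] by simp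
  qed (simp_all add: P0)
  \<comment> \<open>At the end either the first component is real or the second is 0, so no value is
    a positive multiple of \<open>(\<i>, 1)\<close>. The segments to \<open>- ?c\<close> therefore
    avoid the origin.\<close>
  let ?c = "(\<i>, 1) :: complex \<times> complex"
  have C: "homotopic_with_canon (\<lambda>x. True) tube (- {0}) (\<lambda>x. tube_map (P1 (1, x)) (P2 (1, x))) (\<lambda>x. - ?c)"
  proof (rule homotopic_canonI)
    let ?g = "\<lambda>x. tube_map (P1 (1, x)) (P2 (1, x))"
    have cg: "continuous_on ?D (\<lambda>q. ?g (snd q))"
      using P2in
      by (intro cT continuous_on_compose2[OF cP1] continuous_on_compose2[OF cP2] continuous_intros) auto
    show "continuous_on ?D (\<lambda>q. (1 - fst q) *\<^sub>R ?g (snd q) + fst q *\<^sub>R (- ?c))"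
      by (intro continuous_intros cg)
    fix t :: real and x assume t: "t \<in> {0..1}" and x: "x \<in> tube"
    have "(1 - t) *\<^sub>R ?g x + t *\<^sub>R (- ?c) \<noteq> 0"
    proof
      assume z: "(1 - t) *\<^sub>R ?g x + t *\<^sub>R (- ?c) = 0"
      then have z1: "of_real (1 - t) * fst (?g x) = of_real t * \<i>" and z2: "of_real (1 - t) * snd (?g x) = of_real t"
        by (auto simp: zero_prod_def prod_eq_iff scaleR_conv_of_real)
      show False
      proof (cases "t = 0")
        case True
        then have "?g x = 0" using z1 z2 by (simp add: prod_eq_iff)
        then show False using tube_map_nonzero[OF P1in[of 1 x] P2in[of 1 x]] x by simp
      next
        case False
        from P1'[OF x] show False
        proof
          assume "P1 (1, x) = 1"
          then have "fst (?g x) = of_real (snd (P2 (1, x)) / norm (P2 (1, x)))"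
            by (simp add: tube_map_def)
          then have "Im (of_real (1 - t) * fst (?g x)) = 0" by simp
          then show False unfolding z1 using False by simp
        next
          assume "P2 (1, x) = (0, 1/2)"
          then have "snd (?g x) = 0" by (simp add: tube_map_def)
          then show False using z2 False by simp
        qed
      qed
    qed
    then show "(1 - fst (t, x)) *\<^sub>R ?g (snd (t, x)) + fst (t, x) *\<^sub>R (- ?c) \<in> - {0}" by simp
  qed (simp_all add: zero_prod_def)
  show False
    using tube_essential homotopic_with_trans[OF homotopic_with_trans[OF A B] C] by blast
qed

section \<open>Independence of the sign of the degree\<close>

lemma cone_set_cong: "(\<And>z. norm z = 1 \<Longrightarrow> \<beta> z = \<gamma> z) \<Longrightarrow> cone_set \<beta> = cone_set \<gamma>"
  unfolding cone_set_def by (intro arg_cong2[where f = "(\<union>)"] image_cong refl) (auto simp: cone_pt_def)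

text \<open>Precomposing the attaching map with a reflection of the circle gives a homeomorphic
  cone; the reflection acts on the middle component only.\<close>

lemma TC_le_cone_set_cnj:
  "TC_le (cone_set (\<lambda>z. cnj z ^ n)) k \<longleftrightarrow> TC_le (cone_set (\<lambda>z. z ^ n)) k"
proof -
  define F :: "complex \<times> complex \<times> real \<Rightarrow> complex \<times> complex \<times> real"
    where "F y = (fst y, cnj (fst (snd y)), snd (snd y))" for y
  have FF: "F (F y) = y" for y by (simp add: F_def)
  have cF: "continuous_on S F" for S unfolding F_def by (intro continuous_intros)
  have pt: "F (cone_pt (\<lambda>z. cnj z ^ n) (x, t)) = cone_pt (\<lambda>z. z ^ n) (cnj x, t)"
    "F (cone_pt (\<lambda>z. z ^ n) (x, t)) = cone_pt (\<lambda>z. cnj z ^ n) (cnj x, t)" "F (rim x) = rim x" for x t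
    by (simp_all add: F_def cone_pt_def rim_def)
  have 1: "F ` cone_set (\<lambda>z. cnj z ^ n) \<subseteq> cone_set (\<lambda>z. z ^ n)"
    using pt by (force simp: cone_set_def)
  have 2: "F ` cone_set (\<lambda>z. z ^ n) \<subseteq> cone_set (\<lambda>z. cnj z ^ n)"
    using pt by (force simp: cone_set_def)
  have "homeomorphism (cone_set (\<lambda>z. cnj z ^ n)) (cone_set (\<lambda>z. z ^ n)) F F"
    using 1 2 by (intro homeomorphismI cF) (auto simp: FF)
  then have "cone_set (\<lambda>z. cnj z ^ n) homeomorphic cone_set (\<lambda>z. z ^ n)"
    unfolding homeomorphic_def by blast
  then show ?thesis using TC_le_homeomorphic homeomorphic_sym by blast
qed

lemma TC_le_cone_set_powi:
  "TC_le (cone_set (\<lambda>z. z powi d)) k \<longleftrightarrow> TC_le (cone_set (\<lambda>z. z ^ nat \<bar>d\<bar>)) k"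
proof (cases "d \<ge> 0")
  case True
  then show ?thesis by (simp add: power_int_def)
next
  case False
  have "cone_set (\<lambda>z. z powi d) = cone_set (\<lambda>z. cnj z ^ nat \<bar>d\<bar>)"
  proof (rule cone_set_cong)
    fix z :: complex assume "norm z = 1"
    then have "inverse z = cnj z"
      using complex_norm_square[of z] by (intro inverse_unique) simp
    then show "z powi d = cnj z ^ nat \<bar>d\<bar>" using False by (simp add: power_int_def)
  qed
  then show ?thesis by (simp add: TC_le_cone_set_cnj)
qed

theorem theorem5p1:
  fixes \<alpha> :: "(nat \<Rightarrow> real) \<Rightarrow> (nat \<Rightarrow> real)"
  assumes "continuous_map (nsphere 1) (nsphere 1) \<alpha>"
  shows "TC (mapping_cone (nsphere 1) (nsphere 1) \<alpha>) =
    (let d = Brouwer_degree2 1 \<alpha> in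
      if d = 0 then 2
      else if d = 1 \<or> d = -1 then 0
      else if d = 2 \<or> d = -2 then 3
      else 4)"
proof -
  define d where "d = Brouwer_degree2 1 \<alpha>"
  let ?Y = "cone_set (\<lambda>z. z ^ nat \<bar>d\<bar>)"
  have iff: "TC_le (cone_set (circle_map \<alpha>)) k \<longleftrightarrow> TC_le ?Y k" for k
    unfolding TC_le_cone_set_degree[OF assms] d_def[symmetric] by (rule TC_le_cone_set_powi)
  have TC: "TC (mapping_cone (nsphere 1) (nsphere 1) \<alpha>) = enat n"
    if "TC_le ?Y n" "\<And>m. n = Suc m \<Longrightarrow> \<not> TC_le ?Y m" for n
    by (rule TC_eqI[OF mapping_cone_homeomorphic[OF assms]]) (use that in \<open>simp_all add: iff\<close>)
  consider "d = 0" | "\<bar>d\<bar> = 1" | "\<bar>d\<bar> = 2" | "\<bar>d\<bar> \<ge> 3" by linarith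
  then show ?thesis
  proof cases
    case 1
    then have "TC (mapping_cone (nsphere 1) (nsphere 1) \<alpha>) = enat 2"
      using TC_le_2_wedge not_TC_le_1_wedge by (intro TC) auto
    then show ?thesis using 1 by (simp add: d_def numeral_eq_enat)
  next
    case 2
    then have "TC (mapping_cone (nsphere 1) (nsphere 1) \<alpha>) = enat 0"
      using TC_le_0_disc by (intro TC) auto
    moreover have "d = 1 \<or> d = -1" "d \<noteq> 0" using 2 by linarith+
    ultimately show ?thesis by (simp add: d_def Let_def zero_enat_def)
  next
    case 3
    interpret cyclic_cover 2 by standard simp
    have "TC (mapping_cone (nsphere 1) (nsphere 1) \<alpha>) = enat 3"
      using TC_le_3_square_cone not_TC_le_2 3 by (intro TC) (auto simp: numeral_2_eq_2 eval_nat_numeral)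
    moreover have "d = 2 \<or> d = -2" "d \<noteq> 0" "d \<noteq> 1" "d \<noteq> -1" using 3 by linarith+
    ultimately show ?thesis by (simp add: d_def Let_def numeral_eq_enat)
  next
    case 4
    then interpret cyclic_cover "nat \<bar>d\<bar>" by unfold_locales linarith
    have "nat \<bar>d\<bar> \<ge> 3" using 4 by linarith
    then have "\<not> TC_le ?Y 3" by (rule not_TC_le_3)
    then have "TC (mapping_cone (nsphere 1) (nsphere 1) \<alpha>) = enat 4"
      using TC_le_4_cone_set[of "nat \<bar>d\<bar>"] by (intro TC) auto
    moreover have "d \<notin> {0, 1, -1, 2, -2}" using 4 by auto
    ultimately show ?thesis by (simp add: d_def Let_def numeral_eq_enat)
  qed
qed

end
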